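(* Let $w$ be a standard Brownian motion and let $\beta,\gamma\in(0,1)$ with $\beta-\gamma>-\frac12$. Then, for every $a\in\mathbb{R}$, $X_0\in\mathbb{R}$ and $T>0$, the equation $$\partial_t^{\beta}X(t)=-aX(t)+\partial_t^{\gamma}w(t),\qquad X(0)=X_0,$$ has a unique (classical) solution in the class $\mathcal{E}$, and $$X(t)=X_0E_{\beta}(-at^{\beta})+\int_0^t(t-s)^{\beta-\gamma}E_{\beta,\beta-\gamma+1}\big(-a(t-s)^{\beta}\big)\,dw(s).$$
   Context: For $p>0$, $J^{p}f(t)=\frac{1}{\Gamma(p)}\int_0^t(t-s)^{p-1}(f(s)-f(0))\,ds$, where $f(0)=f(0+)$; for $\beta\in(0,1)$, $\partial_t^{\beta}f=\frac{d}{dt}J^{1-\beta}f$. A classical solution on $[0,T]$ is a continuous process $X$ with $X(0)=X_0$ such that $\mathbb{P}\big(J^{1-\beta}X(t)=-a\int_0^tX(s)\,ds+J^{1-\gamma}w(t),\ t\in[0,T]\big)=1$. The class $\mathcal{E}$ consists of functions $f\in L_{1,loc}((0,+\infty))$ such that $\sup_{t>0}|f(t)|e^{ct}<\infty$ for some $c\in\mathbb{R}$; a process is in $\mathcal{E}$ if its trajectories on $(0,\infty)$ are in $\mathcal{E}$ with probability one (and the process is then a classical solution on $[0,T]$ for every $T>0$). The Mittag-Leffler functions are $E_{\beta,\rho}(z)=\sum_{k=0}^{\infty}\frac{z^k}{\Gamma(\beta k+\rho)}$ and $E_{\beta}=E_{\beta,1}$. *)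

theory Defs
  imports "HOL-Probability.Probability"
begin

text \<open>
  The real processes below are indexed by all of \<open>real\<close>; only times \<open>t \<ge> 0\<close> are ever used.
\<close>

definition standard_brownian_motion :: "'a measure \<Rightarrow> (real \<Rightarrow> 'a \<Rightarrow> real) \<Rightarrow> bool" where
  "standard_brownian_motion M w \<longleftrightarrow>
     (\<forall>t\<ge>0. w t \<in> borel_measurable M) \<and>
     (AE \<omega> in M. w 0 \<omega> = 0) \<and>
     (\<forall>(n::nat) ts. 0 \<le> ts 0 \<and> (\<forall>i<n. ts i < ts (Suc i)) \<longrightarrow>
        prob_space.indep_vars M (\<lambda>_. borel) (\<lambda>i \<omega>. w (ts (Suc i)) \<omega> - w (ts i) \<omega>) {..<n}) \<and>
     (\<forall>s t. 0 \<le> s \<and> s < t \<longrightarrow>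
        distributed M lborel (\<lambda>\<omega>. w t \<omega> - w s \<omega>) (normal_density 0 (sqrt (t - s)))) \<and>
     (AE \<omega> in M. continuous_on {0..} (\<lambda>t. w t \<omega>))"

text \<open>
  The fractional integral \<open>J\<^sup>p\<close> acts on \<open>f - f(0)\<close>, where \<open>f(0)\<close> means the right limit \<open>f(0+)\<close>.
\<close>

definition frac_int :: "real \<Rightarrow> (real \<Rightarrow> real) \<Rightarrow> real \<Rightarrow> real" where
  "frac_int p f t =
     1 / Gamma p *
       (LINT s:{0..t}|lebesgue. (t - s) powr (p - 1) * (f s - Lim (at_right 0) f))"

definition mittag_leffler :: "real \<Rightarrow> real \<Rightarrow> real \<Rightarrow> real" where
  "mittag_leffler \<beta> \<rho> z = (\<Sum>k. z ^ k / Gamma (\<beta> * real k + \<rho>))"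

abbreviation mittag_leffler1 :: "real \<Rightarrow> real \<Rightarrow> real" where
  "mittag_leffler1 \<beta> \<equiv> mittag_leffler \<beta> 1"

definition class_E :: "(real \<Rightarrow> real) set" where
  "class_E = {f. (\<forall>K. compact K \<and> K \<subseteq> {0<..} \<longrightarrow> f absolutely_integrable_on K) \<and>
                 (\<exists>c. bdd_above ((\<lambda>t. \<bar>f t\<bar> * exp (c * t)) ` {0<..}))}"

definition process_in_E :: "'a measure \<Rightarrow> (real \<Rightarrow> 'a \<Rightarrow> real) \<Rightarrow> bool" where
  "process_in_E M X \<longleftrightarrow> (AE \<omega> in M. (\<lambda>t. X t \<omega>) \<in> class_E)"

text \<open>
  A classical solution on \<open>[0, T]\<close> of \<open>\<partial>\<^sup>\<beta> X = - a X + \<partial>\<^sup>\<gamma> w\<close>, \<open>X(0) = X\<^sub>0\<close>. Since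
  \<open>\<partial>\<^sup>\<beta> = (d/dt) J\<^sup>1\<^sup>-\<^sup>\<beta>\<close>, the equation is understood in its time-integrated form,
  with probability one simultaneously for all \<open>t\<close>.
\<close>

definition classical_solution ::
  "'a measure \<Rightarrow> (real \<Rightarrow> 'a \<Rightarrow> real) \<Rightarrow> real \<Rightarrow> real \<Rightarrow> real \<Rightarrow> real \<Rightarrow> real \<Rightarrow>
     (real \<Rightarrow> 'a \<Rightarrow> real) \<Rightarrow> bool" where
  "classical_solution M w \<beta> \<gamma> a X0 T X \<longleftrightarrow>
     (\<forall>t\<in>{0..T}. X t \<in> borel_measurable M) \<and>
     (AE \<omega> in M. continuous_on {0..T} (\<lambda>t. X t \<omega>)) \<and>
     (AE \<omega> in M. X 0 \<omega> = X0) \<and>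
     (AE \<omega> in M. \<forall>t\<in>{0..T}.
        frac_int (1 - \<beta>) (\<lambda>s. X s \<omega>) t =
          - a * (LINT s:{0..t}|lebesgue. X s \<omega>) + frac_int (1 - \<gamma>) (\<lambda>s. w s \<omega>) t)"

text \<open>
  Wiener integral of a deterministic function \<open>h\<close> over \<open>[0, t]\<close>: the \<open>L\<^sup>2\<close> limit of the
  integrals of step functions that converge to \<open>h\<close> in \<open>L\<^sup>2([0, t])\<close>. It is determined up to
  almost sure equality, hence a relation rather than a function. The triple \<open>(n, u, c)\<close> stands
  for the step function with value \<open>c i\<close> on \<open>(u i, u (i + 1)]\<close>, \<open>i < n\<close>.
\<close>

definition step_fun :: "nat \<Rightarrow> (nat \<Rightarrow> real) \<Rightarrow> (nat \<Rightarrow> real) \<Rightarrow> real \<Rightarrow> real" where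
  "step_fun n u c s = (\<Sum>i<n. c i * indicator {u i<..u (Suc i)} s)"

definition step_integral ::
  "(real \<Rightarrow> 'a \<Rightarrow> real) \<Rightarrow> nat \<Rightarrow> (nat \<Rightarrow> real) \<Rightarrow> (nat \<Rightarrow> real) \<Rightarrow> 'a \<Rightarrow> real" where
  "step_integral w n u c \<omega> = (\<Sum>i<n. c i * (w (u (Suc i)) \<omega> - w (u i) \<omega>))"

definition has_wiener_integral ::
  "'a measure \<Rightarrow> (real \<Rightarrow> 'a \<Rightarrow> real) \<Rightarrow> (real \<Rightarrow> real) \<Rightarrow> real \<Rightarrow> ('a \<Rightarrow> real) \<Rightarrow> bool" where
  "has_wiener_integral M w h t Y \<longleftrightarrow>
     set_borel_measurable lborel {0..t} h \<and>
     set_integrable lborel {0..t} (\<lambda>s. (h s)\<^sup>2) \<and>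
     Y \<in> borel_measurable M \<and>
     (\<exists>n u c.
        (\<forall>k. u k 0 = 0 \<and> u k (n k) = t \<and> (\<forall>i<n k. u k i < u k (Suc i))) \<and>
        (\<lambda>k::nat. \<integral>\<^sup>+s\<in>{0..t}. ennreal ((h s - step_fun (n k) (u k) (c k) s)\<^sup>2) \<partial>lborel)
          \<longlonglongrightarrow> 0 \<and>
        (\<lambda>k. \<integral>\<^sup>+\<omega>. ennreal ((Y \<omega> - step_integral w (n k) (u k) (c k) \<omega>)\<^sup>2) \<partial>M)
          \<longlonglongrightarrow> 0)"

end

theory Submission imports Defs begin

text \<open>
  The equation is solved one Brownian path at a time; probability enters only through the Hoelder
  continuity of the paths and through the \<open>L\<^sup>2\<close> isometry.

  Write \<open>g\<^sub>p(u) = u\<^sup>p\<^sup>-\<^sup>1 / \<Gamma>(p)\<close> (\<open>frac_kernel\<close>) and \<open>h\<^sub>q(u) = u\<^sup>q\<^sup>-\<^sup>1 E\<^sub>\<beta>\<^sub>,\<^sub>q(- a u\<^sup>\<beta>)\<close>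
  (\<open>ml_kernel\<close>), both set to zero for \<open>u \<le> 0\<close>, so that fractional integration \<open>J\<^sup>p\<close> is convolution
  with \<open>g\<^sub>p\<close>. Expanding \<open>h\<^sub>q\<close> as the series of the \<open>(- a)\<^sup>k g\<close> with index \<open>\<beta>k + q\<close> and using Euler's
  Beta integral termwise gives the two identities that drive the argument:
  \<open>g\<^sub>p * h\<^sub>q\<close> is the kernel \<open>h\<close> of index \<open>p + q\<close> (\<open>conv_frac_ml\<close>), and \<open>h\<^sub>q\<close> plus \<open>a\<close> times the kernel
  of index \<open>q + \<beta>\<close> is \<open>g\<^sub>q\<close> (\<open>ml_kernel_rec\<close>). In other words \<open>h\<^sub>\<beta>\<close> is the resolvent of
  \<open>k = g\<close> (of index \<open>1 - \<beta>\<close>) \<open>+ a g\<^sub>1\<close>, in the sense that \<open>k * h\<^sub>\<beta> = g\<^sub>1\<close>.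

  Uniqueness: the difference \<open>D\<close> of two solutions satisfies \<open>k * D = 0\<close> on \<open>[0, T]\<close>. Convolving with
  \<open>h\<^sub>\<beta>\<close> gives \<open>g\<^sub>1 * D = 0\<close>, so \<open>D\<close> integrates to zero over every \<open>[0, t]\<close> and vanishes.

  Existence: the candidate is \<open>X(t) = X\<^sub>0 E\<^sub>\<beta>(- a t\<^sup>\<beta>) + V(t)\<close> with \<open>V(t) = \<integral> h\<^sub>q(t - s) dw(s)\<close> and
  \<open>q = 1 + \<beta> - \<gamma>\<close>. If \<open>\<beta> < \<gamma>\<close> this kernel is singular at \<open>0\<close>, but \<open>q > 1/2\<close>, and Brownian paths are
  Hoelder of every order \<open>\<alpha> < 1/2\<close>; with \<open>\<alpha> + q > 1\<close> the integral makes sense path by path as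
  \<open>V(t) = h\<^sub>q(t) w(t) + \<integral> (w(t - u) - w(t)) h\<^sub>q'(u) du\<close>, the integral being over \<open>[0, t]\<close>.
  One application of Fubini and of the fundamental theorem of calculus yields \<open>g\<^sub>1 * V = h\<^sub>q * w\<close>
  (\<open>conv_one_wint\<close>). Hence \<open>g\<^sub>1 * k * V = k * h\<^sub>q * w = g\<^sub>1 * g * w\<close> with \<open>g\<close> of index \<open>1 - \<gamma>\<close>, and
  cancelling \<open>g\<^sub>1\<close> between continuous functions gives the equation.

  Representation: summation by parts shows that the Riemann sums of \<open>h\<^sub>q(t - s) dw(s)\<close> converge to
  \<open>V(t)\<close> on every Hoelder path (\<open>riemann_sum_tendsto_wint\<close>), while the step functions converge to
  \<open>h\<^sub>q(t - s)\<close> in \<open>L\<^sup>2\<close> because \<open>q > 1/2\<close>. Isometry and Fatou's lemma then identify \<open>V(t)\<close> as the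
  Wiener integral (\<open>wiener_integral_limit\<close>). The same Riemann sums show that \<open>V(t)\<close> is a random
  variable, and a Hoelder bound with exponential weight in time puts \<open>X\<close> into the class \<open>\<E>\<close>.
\<close>

section \<open>Mittag-Leffler kernels\<close>

text \<open>
  Keep only the part \<open>t \<ge> A\<close> of Euler's integral for \<open>\<Gamma>(x)\<close> and bound the power there from below
  by its value at \<open>A\<close>. The choice of \<open>A\<close> is left open, to be adapted to the argument of the kernels.
\<close>

lemma Gamma_ge_powr:
  fixes x A :: real
  assumes "x \<ge> 1" "A > 0"
  shows "A powr (x - 1) * exp (- A) \<le> Gamma x"
proof -
  have "((\<lambda>t. A powr (x - 1) * exp (- 1 * t)) has_integral A powr (x - 1) * (exp (- 1 * A) / 1)) {A..}"
    by (intro has_integral_mult_right has_integral_exp_minus_to_infinity) simp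
  then have "((\<lambda>t. if t \<in> {A..} then A powr (x - 1) * exp (- t) else 0) has_integral
      A powr (x - 1) * exp (- A)) {0..}"
    using assms by (subst has_integral_restrict) auto
  moreover have "((\<lambda>t. t powr (x - 1) / exp t) has_integral Gamma x) {0..}"
    using assms Gamma_integral_real[of x] by simp
  ultimately show ?thesis
  proof (rule has_integral_le)
    fix t :: real assume "t \<in> {0..}"
    show "(if t \<in> {A..} then A powr (x - 1) * exp (- t) else 0) \<le> t powr (x - 1) / exp t"
      using assms by (auto simp: exp_minus field_simps powr_mono2)
  qed
qed

text \<open>
  The bound is uniform in \<open>A\<close>, so that \<open>A\<close> may be chosen proportional to the argument \<open>u\<close> of the
  kernels. It then gives the convergence of the Mittag-Leffler series and their exponential growth
  at once.
\<close>

lemma rGamma_decay: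
  obtains B :: real where "B \<ge> 0"
    "\<And>x A. x \<ge> - 1 \<Longrightarrow> A \<ge> 1 \<Longrightarrow> \<bar>rGamma x\<bar> \<le> B * A powr (- x) * exp (2 * A)"
proof -
  have "compact (rGamma ` {-1..1::real})"
    by (intro compact_continuous_image continuous_intros) auto
  then obtain B0 where B0: "\<And>x. x \<in> {-1..1::real} \<Longrightarrow> \<bar>rGamma x\<bar> \<le> B0"
    by (metis compact_imp_bounded bounded_iff image_eqI real_norm_def)
  define B where "B = max 1 B0"
  show thesis
  proof
    show "B \<ge> 0" by (simp add: B_def)
    fix x A :: real assume x: "x \<ge> - 1" and A: "A \<ge> 1"
    have expA: "A \<le> exp A" using exp_ge_add_one_self[of A] by linarith
    show "\<bar>rGamma x\<bar> \<le> B * A powr (- x) * exp (2 * A)"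
    proof (cases "x \<ge> 1")
      case True
      have pos: "A powr (x - 1) * exp (- A) > 0" using A by simp
      have "\<bar>rGamma x\<bar> = inverse (Gamma x)"
        using True by (simp add: rGamma_inverse_Gamma Gamma_real_pos)
      also have "\<dots> \<le> inverse (A powr (x - 1) * exp (- A))"
        by (rule le_imp_inverse_le[OF Gamma_ge_powr pos]) (use True A in auto)
      also have "\<dots> = A powr (- x) * A * exp A"
        using A by (simp add: powr_diff powr_minus exp_minus field_simps)
      also have "\<dots> \<le> A powr (- x) * exp A * exp A"
        using expA A by (intro mult_right_mono mult_left_mono) auto
      also have "\<dots> = 1 * (A powr (- x) * exp (2 * A))"
        by (simp add: exp_double power2_eq_square)
      also have "\<dots> \<le> B * (A powr (- x) * exp (2 * A))"
        by (intro mult_right_mono) (auto simp: B_def)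
      finally show ?thesis by (simp add: mult.assoc)
    next
      case False
      have "1 \<le> exp A * (inverse A * exp A)"
      proof -
        have "1 \<le> inverse A * exp A" using expA A by (simp add: inverse_eq_divide)
        then show ?thesis using A mult_mono[of 1 "exp A" 1 "inverse A * exp A"] by simp
      qed
      also have "\<dots> = A powr (- 1) * exp (2 * A)"
        using A by (simp add: powr_minus exp_double power2_eq_square)
      also have "\<dots> \<le> A powr (- x) * exp (2 * A)"
        using False A by (intro mult_right_mono powr_mono) auto
      finally have "B * 1 \<le> B * (A powr (- x) * exp (2 * A))"
        by (intro mult_left_mono) (auto simp: B_def)
      moreover have "\<bar>rGamma x\<bar> \<le> B" using B0[of x] False x by (auto simp: B_def)
      ultimately show ?thesis by (simp add: mult.assoc)
    qed
  qed
qed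

text \<open>
  Apply the preceding bound with \<open>A = d (1 + u)\<close>, where \<open>d\<^sup>\<beta> = 2 \<bar>\<mu>\<bar> + 1\<close>: each factor \<open>\<mu> u\<^sup>\<beta>\<close>
  then costs at most \<open>1/2\<close> against \<open>A\<^sup>\<beta>\<close>, at the price of one exponential in \<open>u\<close>.
\<close>

lemma mittag_leffler_term_bound:
  fixes \<beta> q \<mu> :: real
  assumes "\<beta> > 0" "q \<ge> - 1"
  obtains C c where "C \<ge> 0" "c \<ge> 0"
    "\<And>k u. u \<ge> 0 \<Longrightarrow> \<bar>\<mu> * u powr \<beta>\<bar> ^ k * \<bar>rGamma (\<beta> * real k + q)\<bar> \<le> C * exp (c * u) * (1/2) ^ k"
proof -
  obtain B :: real where B: "B \<ge> 0"
    "\<And>x A. x \<ge> - 1 \<Longrightarrow> A \<ge> 1 \<Longrightarrow> \<bar>rGamma x\<bar> \<le> B * A powr (- x) * exp (2 * A)"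
    using rGamma_decay by blast
  define d where "d = (2 * \<bar>\<mu>\<bar> + 1) powr (1 / \<beta>)"
  have d1: "d \<ge> 1" using assms by (auto simp: d_def ge_one_powr_ge_zero)
  have d\<beta>: "d powr \<beta> = 2 * \<bar>\<mu>\<bar> + 1" using assms by (simp add: d_def powr_powr)
  show thesis
  proof
    show "B * exp (3 * d) \<ge> 0" "3 * d \<ge> 0" using B d1 by auto
    fix k :: nat and u :: real assume u: "u \<ge> 0"
    define A where "A = d * (1 + u)"
    have A1: "A \<ge> 1" using d1 u mult_mono[of 1 d 1 "1 + u"] by (simp add: A_def)
    have expA: "A \<le> exp A" using exp_ge_add_one_self[of A] by linarith
    have "A powr \<beta> = (2 * \<bar>\<mu>\<bar> + 1) * (1 + u) powr \<beta>"
      using d1 u unfolding A_def d\<beta>[symmetric] by (intro powr_mult)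
    then have "(\<bar>\<mu>\<bar> * u powr \<beta>) * A powr (- \<beta>) = \<bar>\<mu>\<bar> / (2 * \<bar>\<mu>\<bar> + 1) * (u powr \<beta> / (1 + u) powr \<beta>)"
      by (simp add: powr_minus divide_inverse mult_ac)
    also have "\<dots> \<le> 1/2 * 1"
      using u assms by (intro mult_mono) (auto simp: field_simps intro!: powr_mono2)
    finally have le: "(\<bar>\<mu>\<bar> * u powr \<beta>) * A powr (- \<beta>) \<le> 1/2" by simp
    have "\<beta> * real k \<ge> 0" using assms by simp
    then have "- 1 \<le> \<beta> * real k + q" using assms by linarith
    then have "\<bar>\<mu> * u powr \<beta>\<bar> ^ k * \<bar>rGamma (\<beta> * real k + q)\<bar> \<le>
        (\<bar>\<mu>\<bar> * u powr \<beta>) ^ k * (B * A powr (- (\<beta> * real k + q)) * exp (2 * A))"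
      using B(2)[of "\<beta> * real k + q" A] A1 assms by (intro mult_mono) (auto simp: abs_mult)
    also have "A powr (- (\<beta> * real k + q)) = (A powr (- \<beta>)) ^ k * A powr (- q)"
      using A1 by (simp add: powr_power powr_add[symmetric] algebra_simps)
    also have "(\<bar>\<mu>\<bar> * u powr \<beta>) ^ k * (B * ((A powr (- \<beta>)) ^ k * A powr (- q)) * exp (2 * A)) =
        B * ((\<bar>\<mu>\<bar> * u powr \<beta>) * A powr (- \<beta>)) ^ k * A powr (- q) * exp (2 * A)"
      by (simp add: power_mult_distrib)
    also have "\<dots> \<le> B * (1/2) ^ k * exp A * exp (2 * A)"
    proof (intro mult_mono power_mono le)
      have "A powr (- q) \<le> A powr 1" using A1 assms by (intro powr_mono) auto
      then show "A powr (- q) \<le> exp A" using expA A1 by simp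
    qed (use B A1 in auto)
    also have "\<dots> = B * exp (3 * d) * exp (3 * d * u) * (1/2) ^ k"
      by (simp add: A_def algebra_simps flip: exp_add)
    finally show "\<bar>\<mu> * u powr \<beta>\<bar> ^ k * \<bar>rGamma (\<beta> * real k + q)\<bar> \<le>
      B * exp (3 * d) * exp (3 * d * u) * (1/2) ^ k" .
  qed
qed

lemma mittag_leffler_rGamma: "mittag_leffler \<beta> q z = (\<Sum>k. rGamma (\<beta> * real k + q) * z ^ k)"
  by (simp add: mittag_leffler_def rGamma_inverse_Gamma field_simps)

lemma summable_mittag_leffler_abs:
  fixes \<beta> q z :: real
  assumes "\<beta> > 0" "q \<ge> - 1"
  shows "summable (\<lambda>k. \<bar>rGamma (\<beta> * real k + q)\<bar> * \<bar>z\<bar> ^ k)"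
proof -
  obtain C c where C: "C \<ge> 0" "c \<ge> 0"
    "\<And>k u. u \<ge> 0 \<Longrightarrow> \<bar>z * u powr \<beta>\<bar> ^ k * \<bar>rGamma (\<beta> * real k + q)\<bar> \<le> C * exp (c * u) * (1/2) ^ k"
    using mittag_leffler_term_bound[OF assms] by blast
  have "summable (\<lambda>k. C * exp c * (1/2::real) ^ k)"
    by (intro summable_mult summable_geometric) auto
  then show ?thesis
    by (rule summable_comparison_test') (use C(3)[of 1] in \<open>auto simp: abs_mult mult_ac\<close>)
qed

lemma summable_mittag_leffler:
  fixes \<beta> q z :: real
  assumes "\<beta> > 0" "q \<ge> - 1"
  shows "summable (\<lambda>k. rGamma (\<beta> * real k + q) * z ^ k)"
  by (rule summable_rabs_cancel) (use summable_mittag_leffler_abs[OF assms] in \<open>simp add: abs_mult power_abs\<close>)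

lemma mittag_leffler_exp_bound:
  fixes \<beta> q \<mu> :: real
  assumes "\<beta> > 0" "q \<ge> - 1"
  obtains C c where "C \<ge> 0" "c \<ge> 0"
    "\<And>u. u \<ge> 0 \<Longrightarrow> \<bar>mittag_leffler \<beta> q (\<mu> * u powr \<beta>)\<bar> \<le> C * exp (c * u)"
proof -
  obtain C c where C: "C \<ge> 0" "c \<ge> 0"
    "\<And>k u. u \<ge> 0 \<Longrightarrow> \<bar>\<mu> * u powr \<beta>\<bar> ^ k * \<bar>rGamma (\<beta> * real k + q)\<bar> \<le> C * exp (c * u) * (1/2) ^ k"
    using mittag_leffler_term_bound[OF assms] by blast
  show thesis
  proof
    show "2 * C \<ge> 0" "c \<ge> 0" using C by auto
    fix u :: real assume u: "u \<ge> 0"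
    have "\<bar>mittag_leffler \<beta> q (\<mu> * u powr \<beta>)\<bar> \<le> (\<Sum>k. \<bar>rGamma (\<beta> * real k + q)\<bar> * \<bar>\<mu> * u powr \<beta>\<bar> ^ k)"
      unfolding mittag_leffler_rGamma
      using summable_rabs[of "\<lambda>k. rGamma (\<beta> * real k + q) * (\<mu> * u powr \<beta>) ^ k"]
        summable_mittag_leffler_abs[OF assms, of "\<mu> * u powr \<beta>"]
      by (simp add: abs_mult power_abs)
    also have "\<dots> \<le> (\<Sum>k. C * exp (c * u) * (1/2) ^ k)"
      using C(3)[OF u] by (intro suminf_le summable_mittag_leffler_abs assms summable_mult summable_geometric)
        (auto simp: mult_ac)
    also have "\<dots> = 2 * C * exp (c * u)"
      by (subst suminf_mult) (auto simp: suminf_geometric summable_geometric)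
    finally show "\<bar>mittag_leffler \<beta> q (\<mu> * u powr \<beta>)\<bar> \<le> 2 * C * exp (c * u)" .
  qed
qed

lemma mittag_leffler_rec:
  assumes "\<beta> > 0" "q \<ge> - 1"
  shows "mittag_leffler \<beta> q z = rGamma q + z * mittag_leffler \<beta> (q + \<beta>) z"
proof -
  have "mittag_leffler \<beta> q z = rGamma q + (\<Sum>k. rGamma (\<beta> * real (Suc k) + q) * z ^ Suc k)"
    unfolding mittag_leffler_rGamma
    using suminf_split_head[OF summable_mittag_leffler[OF assms, of z]] by simp
  also have "(\<Sum>k. rGamma (\<beta> * real (Suc k) + q) * z ^ Suc k) =
      (\<Sum>k. z * (rGamma (\<beta> * real k + (q + \<beta>)) * z ^ k))"
    by (simp add: algebra_simps)
  also have "\<dots> = z * mittag_leffler \<beta> (q + \<beta>) z"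
    unfolding mittag_leffler_rGamma
    by (rule suminf_mult) (use assms in \<open>auto intro: summable_mittag_leffler\<close>)
  finally show ?thesis .
qed

text \<open>
  The functional equation of \<open>1 / \<Gamma>\<close> turns the factor \<open>\<beta>k + q - 1\<close> produced by differentiating the
  \<open>k\<close>-th term into a shift of the second parameter from \<open>q\<close> to \<open>q - 1\<close>.
\<close>

lemma mittag_leffler_deriv:
  fixes \<beta> q z :: real
  assumes "\<beta> > 0" "q \<ge> 0"
  obtains D where "(mittag_leffler \<beta> q has_real_derivative D) (at z)"
    "(q - 1) * mittag_leffler \<beta> q z + \<beta> * z * D = mittag_leffler \<beta> (q - 1) z"
proof
  define c where "c k = rGamma (\<beta> * real k + q)" for k
  have sm: "summable (\<lambda>k. c k * x ^ k)" for x
    unfolding c_def using assms by (intro summable_mittag_leffler) auto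
  have eq: "mittag_leffler \<beta> q = (\<lambda>z. \<Sum>k. c k * z ^ k)"
    by (simp add: fun_eq_iff mittag_leffler_rGamma c_def)
  show "(mittag_leffler \<beta> q has_real_derivative (\<Sum>k. diffs c k * z ^ k)) (at z)"
    unfolding eq by (rule termdiffs_strong_converges_everywhere[OF sm])
  have sd: "(\<lambda>n. of_nat n * c n * z ^ (n - Suc 0)) sums (\<Sum>n. diffs c n * z ^ n)"
    by (rule diffs_equiv) (use termdiff_converges_all[OF sm] in simp)
  have "(\<lambda>n. \<beta> * z * (of_nat n * c n * z ^ (n - Suc 0))) sums (\<beta> * z * (\<Sum>n. diffs c n * z ^ n))"
    by (rule sums_mult[OF sd])
  moreover have "(\<lambda>n. (q - 1) * (c n * z ^ n)) sums ((q - 1) * mittag_leffler \<beta> q z)"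
    unfolding eq by (intro sums_mult summable_sums sm)
  ultimately have "(\<lambda>n. (q - 1) * (c n * z ^ n) + \<beta> * z * (of_nat n * c n * z ^ (n - Suc 0))) sums
     ((q - 1) * mittag_leffler \<beta> q z + \<beta> * z * (\<Sum>k. diffs c k * z ^ k))"
    by (intro sums_add)
  moreover have "(q - 1) * (c n * z ^ n) + \<beta> * z * (of_nat n * c n * z ^ (n - Suc 0)) =
      rGamma (\<beta> * real n + (q - 1)) * z ^ n" for n
  proof -
    have "(q - 1) * (c n * z ^ n) + \<beta> * z * (of_nat n * c n * z ^ (n - Suc 0)) =
        (\<beta> * real n + (q - 1)) * c n * z ^ n"
      by (cases n) (auto simp: algebra_simps)
    also have "(\<beta> * real n + (q - 1)) * c n = rGamma (\<beta> * real n + (q - 1))"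
      using rGamma_plus1[of "\<beta> * real n + (q - 1)"] by (simp add: c_def algebra_simps)
    finally show ?thesis .
  qed
  ultimately show "(q - 1) * mittag_leffler \<beta> q z + \<beta> * z * (\<Sum>k. diffs c k * z ^ k) = mittag_leffler \<beta> (q - 1) z"
    by (simp add: sums_iff mittag_leffler_rGamma)
qed

definition frac_kernel :: "real \<Rightarrow> real \<Rightarrow> real" where
  "frac_kernel p u = (if u > 0 then u powr (p - 1) / Gamma p else 0)"

text \<open>
  The parameter \<open>\<mu>\<close> is \<open>- a\<close> in the application. Kernels vanish on the negative half-line, so that
  convolutions over \<open>[0, t]\<close> are convolutions over the whole line.
\<close>

definition ml_kernel :: "real \<Rightarrow> real \<Rightarrow> real \<Rightarrow> real \<Rightarrow> real" where
  "ml_kernel \<beta> \<mu> q u = (if u > 0 then u powr (q - 1) * mittag_leffler \<beta> q (\<mu> * u powr \<beta>) else 0)"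

lemma kernel_nonpos [simp]: "u \<le> 0 \<Longrightarrow> frac_kernel p u = 0" "u \<le> 0 \<Longrightarrow> ml_kernel \<beta> \<mu> q u = 0"
  by (auto simp: frac_kernel_def ml_kernel_def)

lemma frac_kernel_measurable [measurable]: "frac_kernel p \<in> borel_measurable borel"
  unfolding frac_kernel_def by measurable

lemma ml_kernel_measurable [measurable]: "ml_kernel \<beta> \<mu> q \<in> borel_measurable borel"
  unfolding ml_kernel_def mittag_leffler_def by measurable

lemma ml_kernel_rec:
  assumes "\<beta> > 0" "q \<ge> - 1"
  shows "ml_kernel \<beta> \<mu> q u = frac_kernel q u + \<mu> * ml_kernel \<beta> \<mu> (q + \<beta>) u"
proof (cases "u > 0")
  case True
  have "u powr (q + \<beta> - 1) = u powr (q - 1) * u powr \<beta>"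
    by (subst powr_add[symmetric]) (simp add: algebra_simps)
  then show ?thesis
    using mittag_leffler_rec[OF assms, of "\<mu> * u powr \<beta>"] True
    by (simp add: ml_kernel_def frac_kernel_def rGamma_inverse_Gamma divide_inverse distrib_left mult_ac)
qed (simp add: frac_kernel_def ml_kernel_def)

lemma ml_kernel_bound:
  assumes "\<beta> > 0" "q \<ge> - 1"
  obtains C c where "C \<ge> 0" "c \<ge> 0"
    "\<And>u. u > 0 \<Longrightarrow> \<bar>ml_kernel \<beta> \<mu> q u\<bar> \<le> C * exp (c * u) * u powr (q - 1)"
proof -
  obtain C c where C: "C \<ge> 0" "c \<ge> 0"
    "\<And>u. u \<ge> 0 \<Longrightarrow> \<bar>mittag_leffler \<beta> q (\<mu> * u powr \<beta>)\<bar> \<le> C * exp (c * u)"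
    using mittag_leffler_exp_bound[OF assms] by blast
  have "\<bar>ml_kernel \<beta> \<mu> q u\<bar> \<le> C * exp (c * u) * u powr (q - 1)" if "u > 0" for u
    using mult_left_mono[OF C(3)[of u], of "u powr (q - 1)"] that
    by (simp add: ml_kernel_def abs_mult mult_ac)
  with C(1,2) show thesis by (rule that)
qed

text \<open>
  For \<open>q < 1\<close> the derivative has index \<open>q - 1 < 0\<close> and is not integrable at \<open>0\<close>: this is the
  singularity that the Hoelder continuity of the path has to compensate.
\<close>

lemma ml_kernel_deriv:
  assumes "\<beta> > 0" "q \<ge> 0" "u > 0"
  shows "(ml_kernel \<beta> \<mu> q has_real_derivative ml_kernel \<beta> \<mu> (q - 1) u) (at u)"
proof -
  obtain D where D: "(mittag_leffler \<beta> q has_real_derivative D) (at (\<mu> * u powr \<beta>))"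
    "(q - 1) * mittag_leffler \<beta> q (\<mu> * u powr \<beta>) + \<beta> * (\<mu> * u powr \<beta>) * D =
      mittag_leffler \<beta> (q - 1) (\<mu> * u powr \<beta>)"
    using mittag_leffler_deriv[of \<beta> q "\<mu> * u powr \<beta>"] assms by auto
  have "((\<lambda>u. mittag_leffler \<beta> q (\<mu> * u powr \<beta>)) has_real_derivative
      D * (\<mu> * (\<beta> * u powr (\<beta> - 1)))) (at u)"
    using assms
    by (intro DERIV_chain2[where f="mittag_leffler \<beta> q" and g="\<lambda>u. \<mu> * u powr \<beta>", OF D(1)] DERIV_cmult has_real_derivative_powr) auto
  then have "((\<lambda>u. u powr (q - 1) * mittag_leffler \<beta> q (\<mu> * u powr \<beta>)) has_real_derivative
      ((q - 1) * u powr (q - 1 - 1)) * mittag_leffler \<beta> q (\<mu> * u powr \<beta>) +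
      (D * (\<mu> * (\<beta> * u powr (\<beta> - 1)))) * u powr (q - 1)) (at u)"
    using assms
    by (intro DERIV_mult has_real_derivative_powr) auto
  also have "((q - 1) * u powr (q - 1 - 1)) * mittag_leffler \<beta> q (\<mu> * u powr \<beta>) +
      (D * (\<mu> * (\<beta> * u powr (\<beta> - 1)))) * u powr (q - 1) = ml_kernel \<beta> \<mu> (q - 1) u"
  proof -
    have "u powr (\<beta> - 1) * u powr (q - 1) = u powr (q - 1 - 1) * u powr \<beta>"
      by (subst (1 2) powr_add[symmetric]) (simp add: algebra_simps)
    then show ?thesis
      using assms by (simp add: ml_kernel_def D(2)[symmetric] algebra_simps)
  qed
  finally show ?thesis
    by (rule has_field_derivative_transform_within_open[where S="{0<..}"])
      (use assms in \<open>auto simp: ml_kernel_def\<close>)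
qed

section \<open>Causal convolution\<close>

definition conv :: "(real \<Rightarrow> real) \<Rightarrow> (real \<Rightarrow> real) \<Rightarrow> real \<Rightarrow> real" where
  "conv f g t = (LINT s|lborel. f (t - s) * g s)"

definition causal_kernel :: "(real \<Rightarrow> real) \<Rightarrow> bool" where
  "causal_kernel f \<longleftrightarrow> f \<in> borel_measurable borel \<and> (\<forall>x\<le>0. f x = 0) \<and>
     (\<forall>T. integrable lborel (\<lambda>x. indicator {..T} x * f x))"

definition causal_path :: "(real \<Rightarrow> real) \<Rightarrow> bool" where
  "causal_path \<phi> \<longleftrightarrow> continuous_on UNIV \<phi> \<and> (\<forall>x\<le>0. \<phi> x = 0)"

lemma causal_kernelD:
  assumes "causal_kernel f"
  shows "f \<in> borel_measurable borel" "x \<le> 0 \<Longrightarrow> f x = 0"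
    "integrable lborel (\<lambda>x. indicator {..T} x * f x)"
  using assms by (auto simp: causal_kernel_def)

lemma causal_pathD:
  assumes "causal_path \<phi>"
  shows "continuous_on A \<phi>" "isCont \<phi> x" "x \<le> 0 \<Longrightarrow> \<phi> x = 0" "\<phi> \<in> borel_measurable borel"
proof -
  have c: "continuous_on UNIV \<phi>" and 0: "\<forall>x\<le>0. \<phi> x = 0" using assms by (auto simp: causal_path_def)
  show "continuous_on A \<phi>" using c by (rule continuous_on_subset) simp
  show "isCont \<phi> x" using c by (simp add: continuous_on_eq_continuous_at)
  show "\<phi> \<in> borel_measurable borel" using c by (rule borel_measurable_continuous_onI)
  show "x \<le> 0 \<Longrightarrow> \<phi> x = 0" using 0 by simp
qed

lemma causal_path_bounded:
  assumes "causal_path \<phi>"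
  obtains B where "B \<ge> 0" "\<And>x. x \<le> T \<Longrightarrow> \<bar>\<phi> x\<bar> \<le> B"
proof -
  have "compact (\<phi> ` {0..T})"
    using assms by (intro compact_continuous_image causal_pathD) auto
  then obtain B where B: "\<And>x. x \<in> {0..T} \<Longrightarrow> \<bar>\<phi> x\<bar> \<le> B"
    by (metis compact_imp_bounded bounded_iff image_eqI real_norm_def)
  show thesis
  proof
    show "max 0 B \<ge> 0" by simp
    show "\<bar>\<phi> x\<bar> \<le> max 0 B" if "x \<le> T" for x
      using B[of x] causal_pathD(3)[OF assms, of x] that by (cases "x \<le> 0") auto
  qed
qed

lemma causal_path_lincomb:
  assumes "causal_path \<phi>" "causal_path \<psi>"
  shows "causal_path (\<lambda>x. a * \<phi> x + b * \<psi> x)"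
  using assms by (auto simp: causal_path_def intro!: continuous_intros)

lemma conv_commute: "conv f g t = conv g f t"
  unfolding conv_def by (subst lborel_integral_real_affine[of "-1" _ t]) (auto simp: mult.commute)

lemma conv_nonpos:
  assumes "\<And>x. x \<le> 0 \<Longrightarrow> f x = 0" "\<And>x. x \<le> 0 \<Longrightarrow> g x = 0" "t \<le> 0"
  shows "conv f g t = 0"
proof -
  have *: "f (t - s) * g s = 0" for s
    using assms(1)[of "t - s"] assms(2)[of s] assms(3) by (cases "s \<le> 0") auto
  show ?thesis unfolding conv_def * by simp
qed

lemma conv_integrable_path:
  assumes f: "causal_kernel f" and \<phi>: "causal_path \<phi>"
  shows "integrable lborel (\<lambda>s. f (t - s) * \<phi> s)"
proof -
  obtain B where B: "B \<ge> 0" "\<And>x. x \<le> t \<Longrightarrow> \<bar>\<phi> x\<bar> \<le> B"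
    using causal_path_bounded[OF \<phi>] by blast
  note [measurable] = causal_kernelD(1)[OF f] causal_pathD(4)[OF \<phi>]
  have "integrable lborel (\<lambda>s. B * (indicator {..t} (t + -1 * s) * f (t + -1 * s)))"
    by (intro integrable_mult_right lborel_integrable_real_affine[OF causal_kernelD(3)[OF f]]) auto
  then show ?thesis
  proof (rule Bochner_Integration.integrable_bound)
    show "AE s in lborel. norm (f (t - s) * \<phi> s) \<le> norm (B * (indicator {..t} (t + -1 * s) * f (t + -1 * s)))"
    proof (rule AE_I2)
      fix s
      consider "s \<le> 0" | "t \<le> s" | "0 < s" "s < t" by linarith
      then show "norm (f (t - s) * \<phi> s) \<le> norm (B * (indicator {..t} (t + -1 * s) * f (t + -1 * s)))"
      proof cases
        case 3
        then show ?thesis using B(2)[of s] B(1)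
          by (auto simp: abs_mult mult.commute intro!: mult_right_mono)
      qed (use causal_pathD(3)[OF \<phi>] causal_kernelD(2)[OF f] in auto)
    qed
  qed auto
qed

lemma conv_lincomb_left:
  assumes "causal_kernel f" "causal_kernel g" "causal_path \<phi>"
  shows "conv (\<lambda>x. a * f x + b * g x) \<phi> t = a * conv f \<phi> t + b * conv g \<phi> t"
proof -
  have "conv (\<lambda>x. a * f x + b * g x) \<phi> t =
      (LINT s|lborel. a * (f (t - s) * \<phi> s) + b * (g (t - s) * \<phi> s))"
    by (simp add: conv_def algebra_simps)
  also have "\<dots> = a * conv f \<phi> t + b * conv g \<phi> t"
    using assms by (simp add: conv_def conv_integrable_path)
  finally show ?thesis .
qed

lemma conv_lincomb_right:
  assumes "causal_kernel f" "causal_path \<phi>" "causal_path \<psi>"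
  shows "conv f (\<lambda>x. a * \<phi> x + b * \<psi> x) t = a * conv f \<phi> t + b * conv f \<psi> t"
proof -
  have "conv f (\<lambda>x. a * \<phi> x + b * \<psi> x) t =
      (LINT s|lborel. a * (f (t - s) * \<phi> s) + b * (f (t - s) * \<psi> s))"
    by (simp add: conv_def algebra_simps)
  also have "\<dots> = a * conv f \<phi> t + b * conv f \<psi> t"
    using assms by (simp add: conv_def conv_integrable_path)
  finally show ?thesis .
qed

text \<open>
  Fubini's theorem. Truncating both kernels at \<open>t\<close> does not change the value at \<open>t\<close> and makes them
  integrable, and the path is bounded up to time \<open>t\<close>, which provides the integrable majorant.
\<close>

lemma conv_assoc:
  assumes f: "causal_kernel f" and g: "causal_kernel g" and \<phi>: "causal_path \<phi>"
  shows "conv f (conv g \<phi>) t = conv (conv f g) \<phi> t"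
proof -
  obtain B where B: "B \<ge> 0" "\<And>x. x \<le> t \<Longrightarrow> \<bar>\<phi> x\<bar> \<le> B"
    using causal_path_bounded[OF \<phi>] by blast
  note [measurable] = causal_kernelD(1)[OF f] causal_kernelD(1)[OF g] causal_pathD(4)[OF \<phi>]
  define f' where "f' x = indicator {..t} x * f x" for x
  define g' where "g' x = indicator {..t} x * g x" for x
  have f': "integrable lborel f'" and g': "integrable lborel g'"
    using causal_kernelD(3)[OF f] causal_kernelD(3)[OF g] by (simp_all add: f'_def[abs_def] g'_def[abs_def])
  have [measurable]: "f' \<in> borel_measurable borel" "g' \<in> borel_measurable borel"
    by (simp_all add: f'_def[abs_def] g'_def[abs_def])
  define F where "F s r = f (t - s) * g (s - r) * \<phi> r" for s r
  have shift_int: "integrable lborel (\<lambda>r. h (s - r))" if "integrable lborel h" for h :: "real \<Rightarrow> real" and s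
    using lborel_integrable_real_affine[OF that, of "-1" s] by simp
  have shift_eq: "(LINT r|lborel. h (s - r)) = integral\<^sup>L lborel h" for h :: "real \<Rightarrow> real" and s
    using lborel_integral_real_affine[of "-1" h s] by simp
  have "integrable (lborel \<Otimes>\<^sub>M lborel) (\<lambda>(s, r). B * (f' (t - s) * g' (s - r)))"
  proof (rule lborel_pair.Fubini_integrable)
    have "integrable lborel (\<lambda>s. B * (\<bar>f' (t - s)\<bar> * (LINT r|lborel. \<bar>g' r\<bar>)))"
      by (intro integrable_mult_right integrable_mult_left integrable_abs shift_int f')
    also have "(\<lambda>s. B * (\<bar>f' (t - s)\<bar> * (LINT r|lborel. \<bar>g' r\<bar>))) =
        (\<lambda>s. LINT r|lborel. norm (case (s, r) of (s, r) \<Rightarrow> B * (f' (t - s) * g' (s - r))))"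
      using B shift_eq[of "\<lambda>x. \<bar>g' x\<bar>"] by (simp add: abs_mult)
    finally show "integrable lborel \<dots>" .
    show "AE s in lborel. integrable lborel (\<lambda>r. case (s, r) of (s, r) \<Rightarrow> B * (f' (t - s) * g' (s - r)))"
      by (auto intro!: shift_int g')
  qed measurable
  then have "integrable (lborel \<Otimes>\<^sub>M lborel) (case_prod F)"
  proof (rule Bochner_Integration.integrable_bound)
    have "\<bar>F s r\<bar> \<le> \<bar>B * (f' (t - s) * g' (s - r))\<bar>" for s r
    proof (cases "t - s \<le> 0 \<or> s - r \<le> 0 \<or> r \<le> 0")
      case True
      then have "F s r = 0"
        using causal_pathD(3)[OF \<phi>, of r] causal_kernelD(2)[OF f, of "t - s"] causal_kernelD(2)[OF g, of "s - r"]
        by (auto simp: F_def)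
      then show ?thesis by simp
    next
      case False
      have "\<bar>F s r\<bar> = \<bar>f (t - s) * g (s - r)\<bar> * \<bar>\<phi> r\<bar>" by (simp add: F_def abs_mult)
      also have "\<dots> \<le> \<bar>f (t - s) * g (s - r)\<bar> * B" using B False by (intro mult_left_mono) auto
      also have "\<dots> = \<bar>B * (f' (t - s) * g' (s - r))\<bar>"
        using False B by (simp add: f'_def g'_def abs_mult)
      finally show ?thesis .
    qed
    then show "AE x in lborel \<Otimes>\<^sub>M lborel. norm (case_prod F x) \<le>
        norm (case x of (s, r) \<Rightarrow> B * (f' (t - s) * g' (s - r)))"
      by (auto simp: split_beta)
  qed (unfold F_def, measurable)
  then have "(LINT r|lborel. LINT s|lborel. F s r) = (LINT s|lborel. LINT r|lborel. F s r)"
    by (rule lborel_pair.Fubini_integral)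
  also have "\<dots> = conv f (conv g \<phi>) t"
    by (simp add: conv_def F_def mult.assoc)
  finally have "conv f (conv g \<phi>) t = (LINT r|lborel. (LINT s|lborel. f (t - s) * g (s - r)) * \<phi> r)"
    by (simp add: F_def)
  moreover have "(LINT s|lborel. f (t - s) * g (s - r)) = conv f g (t - r)" for r
    unfolding conv_def
    using lborel_integral_real_affine[of 1 "\<lambda>v. f (t - r - v) * g v" "- r"] by (simp add: algebra_simps)
  ultimately show ?thesis by (simp add: conv_def)
qed

text \<open>
  Dominated convergence, after moving the translation to the path. The clipping by \<open>min\<close> only serves
  to have a bound for the path that holds for all arguments at once.
\<close>

lemma conv_causal_path:
  assumes f: "causal_kernel f" and \<phi>: "causal_path \<phi>"
  shows "causal_path (conv f \<phi>)"
  unfolding causal_path_def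
proof (intro conjI allI impI)
  note [measurable] = causal_kernelD(1)[OF f] causal_pathD(4)[OF \<phi>]
  have "isCont (conv f \<phi>) t" for t
  proof -
    define T where "T = t + 1"
    obtain B where B: "B \<ge> 0" "\<And>x. x \<le> T \<Longrightarrow> \<bar>\<phi> x\<bar> \<le> B"
      using causal_path_bounded[OF \<phi>] by blast
    define G where "G x = (LINT s|lborel. \<phi> (min (x - s) T) * (indicator {..T} s * f s))" for x
    have "isCont G t"
      unfolding continuous_at_sequentially comp_def G_def
    proof (intro allI impI)
      fix x :: "nat \<Rightarrow> real" assume x: "x \<longlonglongrightarrow> t"
      show "(\<lambda>n. LINT s|lborel. \<phi> (min (x n - s) T) * (indicator {..T} s * f s)) \<longlonglongrightarrow>
         (LINT s|lborel. \<phi> (min (t - s) T) * (indicator {..T} s * f s))"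
      proof (rule integral_dominated_convergence[where w="\<lambda>s. B * \<bar>indicator {..T} s * f s\<bar>"])
        show "integrable lborel (\<lambda>s. B * \<bar>indicator {..T} s * f s\<bar>)"
          by (intro integrable_mult_right integrable_abs causal_kernelD(3) f)
        show "AE s in lborel. (\<lambda>n. \<phi> (min (x n - s) T) * (indicator {..T} s * f s)) \<longlonglongrightarrow>
            \<phi> (min (t - s) T) * (indicator {..T} s * f s)"
          by (intro AE_I2 tendsto_mult isCont_tendsto_compose[OF causal_pathD(2)[OF \<phi>]]
               tendsto_min tendsto_diff x tendsto_const)
        show "AE s in lborel. norm (\<phi> (min (x n - s) T) * (indicator {..T} s * f s)) \<le>
            B * \<bar>indicator {..T} s * f s\<bar>" for n
          using B(2) by (auto simp: abs_mult intro!: mult_right_mono)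
      qed measurable
    qed
    moreover have "G x = conv f \<phi> x" if "x \<in> {..<T}" for x
    proof -
      have *: "\<phi> (min (x - s) T) * (indicator {..T} s * f s) = \<phi> (x - s) * f s" for s
        using that causal_pathD(3)[OF \<phi>, of "x - s"] causal_kernelD(2)[OF f, of s]
        by (cases "s \<le> 0"; cases "s \<le> T") (auto simp: min_def)
      have "G x = conv \<phi> f x" by (simp only: G_def conv_def *)
      then show ?thesis using conv_commute by metis
    qed
    then have "eventually (\<lambda>x. G x = conv f \<phi> x) (nhds t)"
      by (intro eventually_nhds_in_open[of "{..<T}", THEN eventually_mono]) (auto simp: T_def)
    ultimately show ?thesis
      by (subst (asm) isCont_cong) auto
  qed
  then show "continuous_on UNIV (conv f \<phi>)" by (simp add: continuous_on_eq_continuous_at)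
  show "conv f \<phi> x = 0" if "x \<le> 0" for x
    using that causal_kernelD(2)[OF f] causal_pathD(3)[OF \<phi>] by (intro conv_nonpos) auto
qed

lemma nonneg_has_bochner_integral:
  fixes f :: "real \<Rightarrow> real"
  assumes "f \<in> borel_measurable borel" "\<And>x. 0 \<le> f x" "(f has_integral I) UNIV"
  shows "has_bochner_integral lborel f I"
proof -
  have "I \<ge> 0" using assms(2) by (intro has_integral_nonneg[OF assms(3)]) auto
  then show ?thesis
    using assms nn_integral_has_integral_lborel[OF assms]
    by (intro has_bochner_integral_nn_integral) auto
qed

lemma integrable_powr_from_0:
  fixes p T :: real
  assumes "p > 0"
  shows "integrable lborel (\<lambda>u. indicator {0<..T} u * u powr (p - 1))"
    "(LINT u|lborel. indicator {0<..T} u * u powr (p - 1)) = (if T > 0 then T powr p / p else 0)"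
proof -
  have "has_bochner_integral lborel (\<lambda>u. indicator {0<..T} u * u powr (p - 1)) (T powr p / p)" if "T > 0"
  proof (rule nonneg_has_bochner_integral)
    have "((\<lambda>x. x powr (p - 1)) has_integral (T powr (p - 1 + 1) / (p - 1 + 1))) {0..T}"
      using that assms by (intro has_integral_powr_from_0) auto
    then have "((\<lambda>x. if x \<in> {0..T} then x powr (p - 1) else 0) has_integral T powr p / p) UNIV"
      by (subst has_integral_restrict_UNIV) simp
    moreover have "(\<lambda>x. if x \<in> {0..T} then x powr (p - 1) else 0) =
       (\<lambda>u. indicator {0<..T} u * u powr (p - 1))" by (auto simp: fun_eq_iff indicator_def)
    ultimately show "((\<lambda>u. indicator {0<..T} u * u powr (p - 1)) has_integral T powr p / p) UNIV" by simp
  qed auto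
  then show "integrable lborel (\<lambda>u. indicator {0<..T} u * u powr (p - 1))"
    "(LINT u|lborel. indicator {0<..T} u * u powr (p - 1)) = (if T > 0 then T powr p / p else 0)"
    by (cases "T > 0"; simp add: has_bochner_integral_iff)+
qed

lemma frac_kernel_causal:
  assumes "p > 0"
  shows "causal_kernel (frac_kernel p)"
  unfolding causal_kernel_def
proof (intro conjI allI impI)
  fix T
  have "integrable lborel (\<lambda>u. inverse (Gamma p) * (indicator {0<..T} u * u powr (p - 1)))"
    by (intro integrable_mult_right integrable_powr_from_0 assms)
  then show "integrable lborel (\<lambda>x. indicator {..T} x * frac_kernel p x)"
    by (rule Bochner_Integration.integrable_cong[THEN iffD1, rotated 2])
      (auto simp: indicator_def frac_kernel_def divide_inverse)
qed auto

lemma ml_kernel_causal: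
  assumes "\<beta> > 0" "p > 0"
  shows "causal_kernel (ml_kernel \<beta> \<mu> p)"
  unfolding causal_kernel_def
proof (intro conjI allI impI)
  fix T
  obtain C c where C: "C \<ge> 0" "c \<ge> 0"
    "\<And>u. u > 0 \<Longrightarrow> \<bar>ml_kernel \<beta> \<mu> p u\<bar> \<le> C * exp (c * u) * u powr (p - 1)"
    using ml_kernel_bound[of \<beta> p \<mu>] assms by auto
  have "integrable lborel (\<lambda>u. (C * exp (c * T)) * (indicator {0<..T} u * u powr (p - 1)))"
    by (intro integrable_mult_right integrable_powr_from_0 assms)
  then show "integrable lborel (\<lambda>x. indicator {..T} x * ml_kernel \<beta> \<mu> p x)"
  proof (rule Bochner_Integration.integrable_bound)
    have "\<bar>ml_kernel \<beta> \<mu> p x\<bar> \<le> C * exp (c * T) * x powr (p - 1)" if "0 < x" "x \<le> T" for x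
      using that C by (intro order_trans[OF C(3)] mult_right_mono mult_left_mono) (auto intro: mult_left_mono)
    then show "AE x in lborel. norm (indicator {..T} x * ml_kernel \<beta> \<mu> p x) \<le>
        norm ((C * exp (c * T)) * (indicator {0<..T} x * x powr (p - 1)))"
      using C by (auto simp: indicator_def)
  qed auto
qed auto

lemma frac_kernel_nonneg: "p > 0 \<Longrightarrow> frac_kernel p u \<ge> 0"
  by (simp add: frac_kernel_def Gamma_real_pos less_imp_le)

text \<open>
  Euler's Beta integral, rescaled from \<open>[0, 1]\<close> to \<open>[0, t]\<close>.
\<close>

lemma frac_kernel_conv:
  assumes "p > 0" "q > 0"
  shows "has_bochner_integral lborel (\<lambda>s. frac_kernel p (t - s) * frac_kernel q s) (frac_kernel (p + q) t)"
proof (cases "t > 0")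
  case False
  have "(\<lambda>s. frac_kernel p (t - s) * frac_kernel q s) = (\<lambda>_. 0)"
    using False by (auto simp: frac_kernel_def fun_eq_iff)
  then show ?thesis using False by (simp add: has_bochner_integral_zero)
next
  case t: True
  define H where "H = (\<lambda>s. frac_kernel p (t - s) * frac_kernel q s)"
  define b where "b x = indicator {0<..<1} x * (x powr (q - 1) * (1 - x) powr (p - 1))" for x :: real
  have "has_bochner_integral lborel b (Beta q p)"
  proof (rule nonneg_has_bochner_integral)
    have "((\<lambda>x. if x \<in> {0..1} then x powr (q - 1) * (1 - x) powr (p - 1) else 0) has_integral Beta q p) UNIV"
      using assms by (subst has_integral_restrict_UNIV) (intro has_integral_Beta_real)
    moreover have "(\<lambda>x. if x \<in> {0..1} then x powr (q - 1) * (1 - x) powr (p - 1) else 0) = b"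
      by (auto simp: fun_eq_iff b_def indicator_def)
    ultimately show "(b has_integral Beta q p) UNIV" by simp
  qed (auto simp: b_def[abs_def])
  then have "has_bochner_integral lborel (\<lambda>x. t powr (p + q - 2) / (Gamma p * Gamma q) * b x)
      (t powr (p + q - 2) / (Gamma p * Gamma q) * Beta q p)"
    by (rule has_bochner_integral_mult_right)
  moreover have "H (0 + t * x) = t powr (p + q - 2) / (Gamma p * Gamma q) * b x" for x
  proof (cases "x \<in> {0<..<1}")
    case True
    have "t powr (p - 1) * t powr (q - 1) = t powr (p + q - 2)"
      by (subst powr_add[symmetric]) (simp add: algebra_simps)
    moreover have "(t - t * x) powr (p - 1) = t powr (p - 1) * (1 - x) powr (p - 1)"
      using True t by (subst powr_mult[symmetric]) (auto simp: algebra_simps)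
    ultimately show ?thesis using True t
      by (simp add: H_def frac_kernel_def b_def powr_mult)
  next
    case False
    then show ?thesis using t
      by (auto simp: H_def frac_kernel_def b_def mult_less_0_iff zero_less_mult_iff)
  qed
  ultimately have "has_bochner_integral lborel (\<lambda>x. H (0 + t * x)) (t powr (p + q - 2) / (Gamma p * Gamma q) * Beta q p)"
    by simp
  moreover have "(t powr (p + q - 2) / (Gamma p * Gamma q) * Beta q p) = frac_kernel (p + q) t /\<^sub>R \<bar>t\<bar>"
  proof -
    have "t powr (p + q - 2) = t powr (p + q - 1) / t"
      using t powr_diff[of t "p + q - 1" 1] by (simp add: algebra_simps)
    moreover have "Gamma p \<noteq> 0" "Gamma q \<noteq> 0"
      using Gamma_real_pos[OF assms(1)] Gamma_real_pos[OF assms(2)] by auto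
    ultimately show ?thesis
      using t by (simp add: frac_kernel_def Beta_def add.commute divide_inverse) (simp add: field_simps)
  qed
  ultimately show ?thesis
    using lborel_has_bochner_integral_real_affine_iff[of t H "frac_kernel (p + q) t" 0] t
    by (simp add: H_def)
qed

lemma ml_kernel_sums:
  assumes "\<beta> > 0" "q \<ge> - 1"
  shows "(\<lambda>k. \<mu> ^ k * frac_kernel (\<beta> * real k + q) u) sums ml_kernel \<beta> \<mu> q u"
    and "summable (\<lambda>k. \<bar>\<mu> ^ k * frac_kernel (\<beta> * real k + q) u\<bar>)"
proof -
  have *: "\<mu> ^ k * frac_kernel (\<beta> * real k + q) u =
      u powr (q - 1) * (rGamma (\<beta> * real k + q) * (\<mu> * u powr \<beta>) ^ k)" if "u > 0" for k
  proof -
    have "u powr (\<beta> * real k + q - 1) = u powr (q - 1) * (u powr \<beta>) ^ k"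
      using that by (subst powr_power) (simp_all add: powr_add[symmetric] algebra_simps)
    then show ?thesis using that
      by (simp add: frac_kernel_def rGamma_inverse_Gamma divide_inverse power_mult_distrib)
  qed
  show "(\<lambda>k. \<mu> ^ k * frac_kernel (\<beta> * real k + q) u) sums ml_kernel \<beta> \<mu> q u"
  proof (cases "u > 0")
    case True
    have "(\<lambda>k. u powr (q - 1) * (rGamma (\<beta> * real k + q) * (\<mu> * u powr \<beta>) ^ k)) sums
        (u powr (q - 1) * mittag_leffler \<beta> q (\<mu> * u powr \<beta>))"
      unfolding mittag_leffler_rGamma by (intro sums_mult summable_sums summable_mittag_leffler assms)
    then show ?thesis using True by (simp add: * ml_kernel_def)
  qed auto
  show "summable (\<lambda>k. \<bar>\<mu> ^ k * frac_kernel (\<beta> * real k + q) u\<bar>)"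
  proof (cases "u > 0")
    case True
    show ?thesis
      using summable_mult[OF summable_mittag_leffler_abs[OF assms, of "\<mu> * u powr \<beta>"], of "u powr (q - 1)"]
      unfolding *[OF True] by (simp add: abs_mult power_abs)
  qed auto
qed

text \<open>
  Termwise application of the semigroup property of the fractional kernels. The interchange of sum and
  integral is justified by the same series with \<open>\<mu>\<close> replaced by \<open>\<bar>\<mu>\<bar>\<close>.
\<close>

lemma conv_frac_ml:
  assumes "\<beta> > 0" "p > 0" "q > 0"
  shows "conv (frac_kernel p) (ml_kernel \<beta> \<mu> q) t = ml_kernel \<beta> \<mu> (p + q) t"
    and "conv (ml_kernel \<beta> \<mu> q) (frac_kernel p) t = ml_kernel \<beta> \<mu> (p + q) t"
proof -
  define F where "F k s = frac_kernel p (t - s) * (\<mu> ^ k * frac_kernel (\<beta> * real k + q) s)" for k s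
  have pos: "\<beta> * real k + q > 0" for k using assms by (intro add_nonneg_pos) auto
  have F: "has_bochner_integral lborel (F k) (\<mu> ^ k * frac_kernel (\<beta> * real k + (p + q)) t)" for k
    using has_bochner_integral_mult_right[OF frac_kernel_conv[OF assms(2) pos[of k], of t], of "\<mu> ^ k"]
    by (simp add: F_def[abs_def] algebra_simps)
  have nF: "(LINT s|lborel. norm (F k s)) = \<bar>\<mu> ^ k * frac_kernel (\<beta> * real k + (p + q)) t\<bar>" for k
  proof -
    have "(LINT s|lborel. norm (F k s)) =
        (LINT s|lborel. \<bar>\<mu> ^ k\<bar> * (frac_kernel p (t - s) * frac_kernel (\<beta> * real k + q) s))"
      using assms pos[of k] by (simp add: F_def abs_mult frac_kernel_nonneg mult_ac)
    also have "\<dots> = \<bar>\<mu> ^ k\<bar> * frac_kernel (p + (\<beta> * real k + q)) t"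
      using frac_kernel_conv[OF assms(2) pos[of k], of t] by (simp add: has_bochner_integral_iff)
    also have "\<dots> = \<bar>\<mu> ^ k * frac_kernel (\<beta> * real k + (p + q)) t\<bar>"
      using assms pos[of k] by (simp add: abs_mult frac_kernel_nonneg algebra_simps)
    finally show ?thesis .
  qed
  have "(\<lambda>k. integral\<^sup>L lborel (F k)) sums (LINT s|lborel. (\<Sum>k. F k s))"
  proof (rule sums_integral)
    show "integrable lborel (F k)" for k using F[of k] by (simp add: has_bochner_integral_iff)
    show "AE s in lborel. summable (\<lambda>k. norm (F k s))"
      using assms by (auto simp: F_def abs_mult[of "frac_kernel p _"] intro!: summable_mult ml_kernel_sums(2))
    show "summable (\<lambda>k. LINT s|lborel. norm (F k s))"
      unfolding nF using assms by (intro ml_kernel_sums(2)) auto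
  qed
  moreover have "(\<Sum>k. F k s) = frac_kernel p (t - s) * ml_kernel \<beta> \<mu> q s" for s
    using assms unfolding F_def
    by (intro sums_unique[symmetric] sums_mult ml_kernel_sums(1)) auto
  moreover have "integral\<^sup>L lborel (F k) = \<mu> ^ k * frac_kernel (\<beta> * real k + (p + q)) t" for k
    using F[of k] by (simp add: has_bochner_integral_iff)
  moreover have "(\<lambda>k. \<mu> ^ k * frac_kernel (\<beta> * real k + (p + q)) t) sums ml_kernel \<beta> \<mu> (p + q) t"
    using assms by (intro ml_kernel_sums(1)) auto
  ultimately show "conv (frac_kernel p) (ml_kernel \<beta> \<mu> q) t = ml_kernel \<beta> \<mu> (p + q) t"
    by (simp add: conv_def sums_iff)
  then show "conv (ml_kernel \<beta> \<mu> q) (frac_kernel p) t = ml_kernel \<beta> \<mu> (p + q) t"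
    by (simp add: conv_commute[of "ml_kernel \<beta> \<mu> q"])
qed

lemma conv_frac_frac:
  assumes "p > 0" "q > 0"
  shows "conv (frac_kernel p) (frac_kernel q) t = frac_kernel (p + q) t"
  using frac_kernel_conv[OF assms, of t] by (simp add: conv_def has_bochner_integral_iff)

lemma conv_frac_one:
  assumes "causal_path \<phi>" "t \<ge> 0"
  shows "conv (frac_kernel 1) \<phi> t = integral {0..t} \<phi>"
    and "conv (frac_kernel 1) \<phi> t = (LINT s:{0..t}|lebesgue. \<phi> s)"
proof -
  note [measurable] = causal_pathD(4)[OF assms(1)]
  have "conv (frac_kernel 1) \<phi> t = (LINT s|lborel. indicator {0..t} s * \<phi> s)"
    unfolding conv_def
  proof (rule integral_cong_AE)
    show "AE s in lborel. frac_kernel 1 (t - s) * \<phi> s = indicator {0..t} s * \<phi> s"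
      by (rule eventually_mono[OF AE_lborel_singleton[of t]])
        (use causal_pathD(3)[OF assms(1)] in \<open>auto simp: frac_kernel_def indicator_def\<close>)
  qed auto
  then have *: "conv (frac_kernel 1) \<phi> t = (LINT s:{0..t}|lborel. \<phi> s)"
    by (simp add: set_lebesgue_integral_def)
  then show "conv (frac_kernel 1) \<phi> t = (LINT s:{0..t}|lebesgue. \<phi> s)"
    unfolding set_lebesgue_integral_def by (subst integral_completion) auto
  have "set_integrable lborel {0..t} \<phi>"
    by (intro borel_integrable_atLeastAtMost' causal_pathD assms)
  then show "conv (frac_kernel 1) \<phi> t = integral {0..t} \<phi>"
    using * set_borel_integral_eq_integral(2) by metis
qed

text \<open>
  Convolution with \<open>g\<^sub>1\<close> is integration from \<open>0\<close>, so a continuous function is recovered by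
  differentiation. This is the cancellation law by which convolution identities are simplified.
\<close>

lemma conv_frac_one_eq_0:
  assumes \<phi>: "causal_path \<phi>" and T: "T > 0" and z: "\<And>t. t \<in> {0..T} \<Longrightarrow> conv (frac_kernel 1) \<phi> t = 0"
    and t: "t \<in> {0..T}"
  shows "\<phi> t = 0"
proof -
  have "((\<lambda>x. integral {0..x} \<phi>) has_vector_derivative \<phi> t) (at t within {0..T})"
    by (intro integral_has_vector_derivative causal_pathD \<phi> t)
  moreover have "((\<lambda>x. integral {0..x} \<phi>) has_vector_derivative 0) (at t within {0..T})"
    by (rule has_vector_derivative_transform[OF t _ has_vector_derivative_const[of 0]])
      (use z conv_frac_one(1)[OF \<phi>] in auto)
  ultimately show ?thesis
    using t T by (intro vector_derivative_unique_within[of t "{0..T}"])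
      (auto simp: trivial_limit_within islimpt_Icc)
qed

lemma frac_int_eq_conv:
  assumes [measurable]: "\<phi> \<in> borel_measurable borel" and 0: "\<And>x. x \<le> 0 \<Longrightarrow> \<phi> x = 0"
    and eq: "\<And>s. s \<in> {0..t} \<Longrightarrow> f s - Lim (at_right 0) f = \<phi> s"
  shows "frac_int p f t = conv (frac_kernel p) \<phi> t"
proof -
  have *: "indicator {0..t} s *\<^sub>R ((t - s) powr (p - 1) * (f s - Lim (at_right 0) f)) =
      indicator {0<..<t} s * ((t - s) powr (p - 1) * \<phi> s)" for s
    using eq[of s] 0[of s] by (auto simp: indicator_def)
  then have "(LINT s:{0..t}|lebesgue. (t - s) powr (p - 1) * (f s - Lim (at_right 0) f)) =
      (LINT s|lborel. indicator {0<..<t} s * ((t - s) powr (p - 1) * \<phi> s))"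
    unfolding set_lebesgue_integral_def * by (subst integral_completion) auto
  then have "frac_int p f t = (LINT s|lborel. 1 / Gamma p * (indicator {0<..<t} s * ((t - s) powr (p - 1) * \<phi> s)))"
    unfolding frac_int_def by simp
  also have "(\<lambda>s. 1 / Gamma p * (indicator {0<..<t} s * ((t - s) powr (p - 1) * \<phi> s))) =
      (\<lambda>s. frac_kernel p (t - s) * \<phi> s)"
    using 0 by (auto simp: fun_eq_iff frac_kernel_def indicator_def)
  finally show ?thesis by (simp add: conv_def)
qed

section \<open>Integration of singular kernels against Hoelder paths\<close>

text \<open>
  Paths are extended by zero to negative times, which keeps Hoelder continuity because they start at
  zero. The weight \<open>exp (2 * t)\<close> lets one constant serve all times; it is what makes the growth of the
  solution at most exponential.
\<close>

definition hoelder_path :: "real \<Rightarrow> (real \<Rightarrow> real) \<Rightarrow> bool" where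
  "hoelder_path \<alpha> f \<longleftrightarrow> (\<forall>t\<le>0. f t = 0) \<and>
     (\<exists>K\<ge>0. \<forall>s t. s \<le> t \<longrightarrow> \<bar>f t - f s\<bar> \<le> K * exp (2 * t) * (t - s) powr \<alpha>)"

lemma hoelder_pathE:
  assumes "hoelder_path \<alpha> f"
  obtains K where "K \<ge> 0" "\<And>s t. s \<le> t \<Longrightarrow> \<bar>f t - f s\<bar> \<le> K * exp (2 * t) * (t - s) powr \<alpha>"
  using assms unfolding hoelder_path_def by blast

lemma hoelder_path_causal:
  assumes "hoelder_path \<alpha> f" "\<alpha> > 0"
  shows "causal_path f"
proof -
  obtain K where K: "K \<ge> 0" "\<And>s t. s \<le> t \<Longrightarrow> \<bar>f t - f s\<bar> \<le> K * exp (2 * t) * (t - s) powr \<alpha>"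
    using hoelder_pathE[OF assms(1)] by blast
  have "(f \<longlongrightarrow> f x) (at x)" for x
  proof -
    have "((\<lambda>y. f y - f x) \<longlongrightarrow> 0) (at x)"
    proof (rule Lim_null_comparison)
      show "\<forall>\<^sub>F y in at x. norm (f y - f x) \<le> K * exp (2 * (x + 1)) * \<bar>y - x\<bar> powr \<alpha>"
      proof (rule eventually_at_ball'[of 1, THEN eventually_mono])
        fix y assume "y \<in> ball x 1 \<and> y \<noteq> x \<and> y \<in> UNIV"
        then have y: "y \<le> x + 1" by (auto simp: dist_real_def)
        show "norm (f y - f x) \<le> K * exp (2 * (x + 1)) * \<bar>y - x\<bar> powr \<alpha>"
        proof (cases "x \<le> y")
          case True
          have "\<bar>f y - f x\<bar> \<le> K * exp (2 * y) * (y - x) powr \<alpha>" by (rule K(2)[OF True])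
          also have "\<dots> \<le> K * exp (2 * (x + 1)) * (y - x) powr \<alpha>"
            using y K(1) by (intro mult_right_mono mult_left_mono) auto
          finally show ?thesis using True by simp
        next
          case False
          then have "\<bar>f x - f y\<bar> \<le> K * exp (2 * x) * (x - y) powr \<alpha>" by (intro K(2)) auto
          also have "\<dots> \<le> K * exp (2 * (x + 1)) * (x - y) powr \<alpha>"
            using K(1) by (intro mult_right_mono mult_left_mono) auto
          finally show ?thesis using False by (simp add: abs_minus_commute)
        qed
      qed auto
      have "((\<lambda>y. K * exp (2 * (x + 1)) * \<bar>y - x\<bar> powr \<alpha>) \<longlongrightarrow> K * exp (2 * (x + 1)) * 0) (at x)"
      proof (intro tendsto_mult tendsto_const tendsto_zero_powrI)
        show "((\<lambda>y. \<bar>y - x\<bar>) \<longlongrightarrow> 0) (at x)"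
          by (auto intro!: tendsto_eq_intros)
        show "\<forall>\<^sub>F y in at x. 0 \<le> \<bar>y - x\<bar>" by simp
      qed (use assms in \<open>auto intro: tendsto_const\<close>)
      then show "((\<lambda>y. K * exp (2 * (x + 1)) * \<bar>y - x\<bar> powr \<alpha>) \<longlongrightarrow> 0) (at x)" by simp
    qed
    then show ?thesis by (simp add: LIM_zero_iff)
  qed
  then show ?thesis
    using assms by (auto simp: causal_path_def hoelder_path_def continuous_on_eq_continuous_at isCont_def)
qed

text \<open>
  The integral \<open>\<integral> h(t - s) df(s)\<close> over \<open>[0, t]\<close> after integration by parts, with \<open>h'\<close> the derivative
  of \<open>h\<close>. Subtracting \<open>f t\<close> makes the integrand integrable at the singularity \<open>u = 0\<close> of \<open>h'\<close>.
\<close>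

definition pathwise_integral :: "(real \<Rightarrow> real) \<Rightarrow> (real \<Rightarrow> real) \<Rightarrow> (real \<Rightarrow> real) \<Rightarrow> real \<Rightarrow> real" where
  "pathwise_integral h h' f t = h t * f t + (LINT u|lborel. indicator {0<..t} u * ((f (t - u) - f t) * h' u))"

locale singular_kernel =
  fixes h h' :: "real \<Rightarrow> real" and q C c :: real
  assumes deriv: "u > 0 \<Longrightarrow> (h has_real_derivative h' u) (at u)"
    and h_0: "u \<le> 0 \<Longrightarrow> h u = 0" and h'_0: "u \<le> 0 \<Longrightarrow> h' u = 0"
    and h_meas [measurable]: "h \<in> borel_measurable borel"
    and h'_meas [measurable]: "h' \<in> borel_measurable borel"
    and h_bound: "u > 0 \<Longrightarrow> \<bar>h u\<bar> \<le> C * exp (c * u) * u powr (q - 1)"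
    and h'_bound: "u > 0 \<Longrightarrow> \<bar>h' u\<bar> \<le> C * exp (c * u) * u powr (q - 2)"
    and C_nonneg: "C \<ge> 0" and c_nonneg: "c \<ge> 0" and q_pos: "q > 0"
begin

abbreviation "wint \<equiv> pathwise_integral h h'"

lemma h_le: "0 < u \<Longrightarrow> u \<le> T \<Longrightarrow> \<bar>h u\<bar> \<le> C * exp (c * T) * u powr (q - 1)"
  using C_nonneg c_nonneg
  by (intro order_trans[OF h_bound] mult_right_mono mult_left_mono) (auto intro: mult_left_mono)

lemma h'_le: "0 < u \<Longrightarrow> u \<le> T \<Longrightarrow> \<bar>h' u\<bar> \<le> C * exp (c * T) * u powr (q - 2)"
  using C_nonneg c_nonneg
  by (intro order_trans[OF h'_bound] mult_right_mono mult_left_mono) (auto intro: mult_left_mono)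

lemma h_cont: "u > 0 \<Longrightarrow> isCont h u"
  using deriv DERIV_isCont by blast

lemma kernel_causal: "causal_kernel h"
  unfolding causal_kernel_def
proof (intro conjI allI impI h_0 h_meas)
  fix T
  have "integrable lborel (\<lambda>u. (C * exp (c * T)) * (indicator {0<..T} u * u powr (q - 1)))"
    by (intro integrable_mult_right integrable_powr_from_0 q_pos)
  then show "integrable lborel (\<lambda>x. indicator {..T} x * h x)"
  proof (rule Bochner_Integration.integrable_bound)
    show "AE x in lborel. norm (indicator {..T} x * h x) \<le>
        norm ((C * exp (c * T)) * (indicator {0<..T} x * x powr (q - 1)))"
      using h_le[of _ T] C_nonneg h_0 by (auto simp: indicator_def)
  qed auto
qed

lemma integral_h':
  assumes "0 < s" "s \<le> t" "{s<..<t} \<subseteq> S" "S \<subseteq> {s..t}" and [measurable]: "S \<in> sets borel"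
  shows "has_bochner_integral lborel (\<lambda>u. indicator S u * h' u) (h t - h s)"
proof -
  have "integrable lborel (\<lambda>u. indicator {s..t} u *\<^sub>R (C * exp (c * t) * u powr (q - 2)))"
    using assms by (intro borel_integrable_compact continuous_intros) auto
  then have int: "set_integrable lborel {s..t} h'"
    unfolding set_integrable_def
  proof (rule Bochner_Integration.integrable_bound)
    show "AE x in lborel. norm (indicator {s..t} x *\<^sub>R h' x) \<le>
      norm (indicator {s..t} x *\<^sub>R (C * exp (c * t) * x powr (q - 2)))"
      using h'_le[of _ t] assms C_nonneg by (auto simp: indicator_def abs_mult)
  qed auto
  have "(h' has_integral (h t - h s)) {s..t}"
    using assms by (intro fundamental_theorem_of_calculus)
      (auto simp flip: has_real_derivative_iff_has_vector_derivative intro!: DERIV_subset[OF deriv])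
  with set_borel_integral_eq_integral[OF int] have "(LINT u:{s..t}|lborel. h' u) = h t - h s"
    by (simp add: integral_unique)
  with int have "has_bochner_integral lborel (\<lambda>u. indicator {s..t} u * h' u) (h t - h s)"
    by (simp add: has_bochner_integral_iff set_integrable_def set_lebesgue_integral_def)
  moreover have "AE u in lborel. indicator {s..t} u * h' u = indicator S u * h' u"
    using AE_lborel_singleton[of s] AE_lborel_singleton[of t]
  proof eventually_elim
    case (elim u)
    then have "u \<in> {s..t} \<longleftrightarrow> u \<in> S" using assms(3,4) by (auto simp: less_le)
    then show ?case by (simp add: indicator_def)
  qed
  ultimately show ?thesis
    by (subst (asm) has_bochner_integral_cong_AE) auto
qed

end

text \<open>
  The condition \<open>\<alpha> + q > 1\<close> says that the regularity of the path outweighs the singularity of the kernel: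
  \<open>u\<^sup>\<alpha>\<close> times the bound \<open>u\<^sup>q\<^sup>-\<^sup>2\<close> of \<open>h'\<close> is integrable at \<open>0\<close>.
\<close>

locale kernel_path = singular_kernel +
  fixes f :: "real \<Rightarrow> real" and \<alpha> K :: real
  assumes \<alpha>_pos: "\<alpha> > 0" and \<alpha>_q: "\<alpha> + q > 1"
    and f_0: "t \<le> 0 \<Longrightarrow> f t = 0"
    and K_nonneg: "K \<ge> 0"
    and f_hoelder: "s \<le> t \<Longrightarrow> \<bar>f t - f s\<bar> \<le> K * exp (2 * t) * (t - s) powr \<alpha>"
begin

lemma f_path: "causal_path f"
  using hoelder_path_causal[of \<alpha> f] \<alpha>_pos f_0 K_nonneg f_hoelder by (auto simp: hoelder_path_def)

lemma f_meas [measurable]: "f \<in> borel_measurable borel"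
  using causal_pathD[OF f_path] by auto

lemma increment_bound:
  assumes "0 < u" "u \<le> T" "t \<le> T"
  shows "\<bar>(f (t - u) - f t) * h' u\<bar> \<le> K * exp (2 * T) * (C * exp (c * T)) * u powr (\<alpha> + q - 1 - 1)"
proof -
  have "\<bar>f t - f (t - u)\<bar> \<le> K * exp (2 * t) * (t - (t - u)) powr \<alpha>"
    using assms by (intro f_hoelder) auto
  also have "\<dots> \<le> K * exp (2 * T) * u powr \<alpha>"
    using assms K_nonneg by (auto intro!: mult_right_mono mult_left_mono)
  finally have "\<bar>(f (t - u) - f t) * h' u\<bar> \<le> (K * exp (2 * T) * u powr \<alpha>) * (C * exp (c * T) * u powr (q - 2))"
    unfolding abs_mult using assms h'_le[of u T]
    by (intro mult_mono) (auto simp: abs_minus_commute)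
  also have "\<dots> = K * exp (2 * T) * (C * exp (c * T)) * (u powr \<alpha> * u powr (q - 2))" by simp
  also have "u powr \<alpha> * u powr (q - 2) = u powr (\<alpha> + q - 1 - 1)"
    by (subst powr_add[symmetric]) (simp add: algebra_simps)
  finally show ?thesis .
qed

lemma majorant_integrable:
  "integrable lborel (\<lambda>u. D * (indicator {0<..T} u * u powr (\<alpha> + q - 1 - 1)))"
  using \<alpha>_q by (intro integrable_mult_right integrable_powr_from_0) auto

lemma increment_bound_ind:
  assumes "t \<le> T"
  shows "norm (indicator {0<..T} u * ((f (t - u) - f t) * h' u)) \<le>
    (K * exp (2 * T) * (C * exp (c * T))) * (indicator {0<..T} u * u powr (\<alpha> + q - 1 - 1))"
  using increment_bound[of u T t] assms by (auto simp: indicator_def)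

lemma increment_integrable:
  assumes "t \<le> T"
  shows "integrable lborel (\<lambda>u. indicator {0<..T} u * ((f (t - u) - f t) * h' u))"
  by (rule Bochner_Integration.integrable_bound[OF majorant_integrable[of "K * exp (2 * T) * (C * exp (c * T))" T]])
     (use increment_bound_ind[OF assms] in \<open>auto intro!: AE_I2 order_trans[OF _ abs_ge_self]\<close>)

text \<open>
  For \<open>u > t\<close> the extended path vanishes at \<open>t - u\<close>, so enlarging the range of integration only adds
  \<open>- f t\<close> times an increment of \<open>h\<close>. In this form the range no longer depends on \<open>t\<close> and \<open>h\<close> is
  evaluated away from its singularity; continuity in \<open>t\<close> and Fubini's theorem become straightforward.
\<close>

lemma wint_extend:
  assumes "t \<le> T" "0 < T"
  shows "wint f t = h T * f t + (LINT u|lborel. indicator {0<..T} u * ((f (t - u) - f t) * h' u))"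
proof (cases "t \<le> 0")
  case True
  then have *: "indicator {0<..T} u * ((f (t - u) - f t) * h' u) = 0" for u
    using f_0 by (auto simp: indicator_def)
  show ?thesis unfolding pathwise_integral_def * using True f_0 by simp
next
  case False
  then have t: "0 < t" by simp
  have i1: "integrable lborel (\<lambda>u. indicator {0<..t} u * ((f (t - u) - f t) * h' u))"
    by (rule increment_integrable) simp
  have "has_bochner_integral lborel (\<lambda>u. indicator {t<..T} u * h' u) (h T - h t)"
    using t assms by (intro integral_h') auto
  then have i2: "has_bochner_integral lborel (\<lambda>u. - f t * (indicator {t<..T} u * h' u)) (- f t * (h T - h t))"
    by (rule has_bochner_integral_mult_right)
  have "indicator {0<..T} u * ((f (t - u) - f t) * h' u) =
      indicator {0<..t} u * ((f (t - u) - f t) * h' u) + - f t * (indicator {t<..T} u * h' u)" for u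
    using assms t f_0[of "t - u"] by (auto simp: indicator_def)
  then have "(LINT u|lborel. indicator {0<..T} u * ((f (t - u) - f t) * h' u)) =
      (LINT u|lborel. indicator {0<..t} u * ((f (t - u) - f t) * h' u)) + - f t * (h T - h t)"
    using i1 i2 by (simp add: has_bochner_integral_iff)
  then show ?thesis by (simp add: pathwise_integral_def algebra_simps)
qed

lemma wint_nonpos: "t \<le> 0 \<Longrightarrow> wint f t = 0"
  using f_0 by (simp add: pathwise_integral_def)

lemma wint_path: "causal_path (wint f)"
  unfolding causal_path_def
proof (intro conjI allI impI wint_nonpos)
  have "isCont (wint f) t" for t
  proof -
    define T where "T = max t 0 + 1"
    have T: "t < T" "0 < T" by (auto simp: T_def)
    define G where "G x = h T * f (min x T) +
      (LINT u|lborel. indicator {0<..T} u * ((f (min x T - u) - f (min x T)) * h' u))" for x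
    have "isCont G t"
      unfolding continuous_at_sequentially comp_def G_def
    proof (intro allI impI tendsto_add tendsto_mult tendsto_const)
      fix x :: "nat \<Rightarrow> real" assume x: "x \<longlonglongrightarrow> t"
      have f_tend: "y \<longlonglongrightarrow> z \<Longrightarrow> (\<lambda>n. f (y n)) \<longlonglongrightarrow> f z" for y z
        by (rule isCont_tendsto_compose[OF causal_pathD(2)[OF f_path]])
      show "(\<lambda>n. f (min (x n) T)) \<longlonglongrightarrow> f (min t T)"
        by (intro f_tend tendsto_min x tendsto_const)
      show "(\<lambda>n. LINT u|lborel. indicator {0<..T} u * ((f (min (x n) T - u) - f (min (x n) T)) * h' u)) \<longlonglongrightarrow>
         (LINT u|lborel. indicator {0<..T} u * ((f (min t T - u) - f (min t T)) * h' u))"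
      proof (rule integral_dominated_convergence)
        show "AE u in lborel. (\<lambda>n. indicator {0<..T} u * ((f (min (x n) T - u) - f (min (x n) T)) * h' u)) \<longlonglongrightarrow>
            indicator {0<..T} u * ((f (min t T - u) - f (min t T)) * h' u)"
          by (intro AE_I2 tendsto_mult tendsto_diff f_tend tendsto_min x tendsto_const)
        show "AE u in lborel. norm (indicator {0<..T} u * ((f (min (x n) T - u) - f (min (x n) T)) * h' u)) \<le>
            (K * exp (2 * T) * (C * exp (c * T))) * (indicator {0<..T} u * u powr (\<alpha> + q - 1 - 1))" for n
          by (intro AE_I2 increment_bound_ind) auto
        show "integrable lborel (\<lambda>u. (K * exp (2 * T) * (C * exp (c * T))) *
            (indicator {0<..T} u * u powr (\<alpha> + q - 1 - 1)))"
          by (rule majorant_integrable)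
      qed measurable
    qed
    moreover have "eventually (\<lambda>x. G x = wint f x) (nhds t)"
      using T by (intro eventually_nhds_in_open[of "{..<T}", THEN eventually_mono])
        (auto simp: G_def wint_extend[of _ T] min_def)
    ultimately show ?thesis
      by (subst (asm) isCont_cong) auto
  qed
  then show "continuous_on UNIV (wint f)" by (simp add: continuous_on_eq_continuous_at)
qed

text \<open>
  With \<open>F\<close> the primitive of \<open>f\<close>, Fubini's theorem turns the left-hand side into
  \<open>h(t) F(t)\<close> plus the integral of \<open>(F(t - u) - F(t)) h'(u)\<close>. The latter is integrated by parts: the
  boundary term at \<open>u = 0\<close> vanishes because \<open>F\<close> is Lipschitz and \<open>h(u)\<close> is \<open>O(u\<^sup>q\<^sup>-\<^sup>1)\<close> with
  \<open>q > 0\<close>.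
\<close>

lemma conv_one_wint: "conv (frac_kernel 1) (wint f) t = conv h f t"
proof (cases "t \<le> 0")
  case True
  then show ?thesis
    using f_0 h_0 wint_nonpos by (simp add: conv_nonpos)
next
  case False
  then have t: "t > 0" by simp
  define k where "k = frac_kernel 1"
  have k: "causal_kernel k" by (simp add: k_def frac_kernel_causal)
  have k_eq: "k x = (if x > 0 then 1 else 0)" for x by (simp add: k_def frac_kernel_def)
  have [measurable]: "k \<in> borel_measurable borel" by (simp add: k_def)
  define F where "F = conv k f"
  have F_path: "causal_path F" unfolding F_def by (rule conv_causal_path[OF k f_path])
  note [measurable] = causal_pathD(4)[OF F_path]
  have shift: "has_bochner_integral lborel (\<lambda>r. k (t - r) * f (r - u)) (F (t - u))" for u
  proof -
    have "has_bochner_integral lborel (\<lambda>s. k (t - u - s) * f s) (F (t - u))"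
      using conv_integrable_path[OF k f_path] by (simp add: has_bochner_integral_iff F_def conv_def)
    then show ?thesis
      using lborel_has_bochner_integral_real_affine_iff[of 1 "\<lambda>s. k (t - u - s) * f s" "F (t - u)" "- u"]
      by (simp add: algebra_simps)
  qed
  define D where "D = K * exp (2 * t) * (C * exp (c * t))"
  have D0: "D \<ge> 0" using K_nonneg C_nonneg by (simp add: D_def)
  define \<Phi> where "\<Phi> r u = k (t - r) * (indicator {0<..t} u * ((f (r - u) - f r) * h' u))" for r u
  have int: "integrable (lborel \<Otimes>\<^sub>M lborel) (case_prod \<Phi>)"
  proof (rule Bochner_Integration.integrable_bound)
    show "integrable (lborel \<Otimes>\<^sub>M lborel) (\<lambda>(r, u). indicator {0..t} r * (D * (indicator {0<..t} u * u powr (\<alpha> + q - 1 - 1))))"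
    proof (rule lborel_pair.Fubini_integrable)
      have "integrable lborel (\<lambda>r. indicator {0..t} r * (LINT u|lborel. \<bar>D * (indicator {0<..t} u * u powr (\<alpha> + q - 1 - 1))\<bar>))"
        using t by (intro integrable_mult_left integrable_real_indicator) simp_all
      then show "integrable lborel (\<lambda>r. LINT u|lborel. norm (case (r, u) of (r, u) \<Rightarrow>
          indicator {0..t} r * (D * (indicator {0<..t} u * u powr (\<alpha> + q - 1 - 1)))))"
        by (simp add: abs_mult)
      show "AE r in lborel. integrable lborel (\<lambda>u. case (r, u) of (r, u) \<Rightarrow>
          indicator {0..t} r * (D * (indicator {0<..t} u * u powr (\<alpha> + q - 1 - 1))))"
        unfolding prod.case by (intro AE_I2 integrable_mult_right majorant_integrable)
    qed measurable
    have "\<bar>\<Phi> r u\<bar> \<le> indicator {0..t} r * (D * (indicator {0<..t} u * u powr (\<alpha> + q - 1 - 1)))" for r u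
    proof (cases "u \<in> {0<..t}")
      case True
      then have u: "0 < u" "u \<le> t" by auto
      consider "r \<le> 0" | "0 < r" "r < t" | "t \<le> r" by linarith
      then show ?thesis
      proof cases
        case 1
        then show ?thesis using f_0 u D0 by (simp add: \<Phi>_def)
      next
        case 2
        then show ?thesis
          using increment_bound[OF u, of r] u by (simp add: \<Phi>_def D_def k_eq abs_mult mult_ac)
      next
        case 3
        then show ?thesis using D0 by (simp add: \<Phi>_def k_eq)
      qed
    qed (simp add: \<Phi>_def)
    then show "AE x in lborel \<Otimes>\<^sub>M lborel. norm (case_prod \<Phi> x) \<le>
      norm (case x of (r, u) \<Rightarrow> indicator {0..t} r * (D * (indicator {0<..t} u * u powr (\<alpha> + q - 1 - 1))))"
      by (auto simp: split_beta intro!: AE_I2 order_trans[OF _ abs_ge_self])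
  qed (unfold \<Phi>_def, measurable)
  have inner: "(LINT r|lborel. \<Phi> r u) = indicator {0<..t} u * ((F (t - u) - F t) * h' u)" for u
  proof -
    have "(LINT r|lborel. \<Phi> r u) =
        (LINT r|lborel. (indicator {0<..t} u * h' u) * (k (t - r) * f (r - u) - k (t - r) * f r))"
      by (simp add: \<Phi>_def algebra_simps)
    also have "\<dots> = (indicator {0<..t} u * h' u) * (F (t - u) - F t)"
      using shift[of u] shift[of 0] by (simp add: has_bochner_integral_iff)
    finally show ?thesis by (simp add: mult_ac)
  qed
  have int_u: "integrable lborel (\<lambda>u. indicator {0<..t} u * ((F (t - u) - F t) * h' u))"
    using lborel_pair.integrable_snd[OF int] by (simp add: inner)
  have "conv k (wint f) t = (LINT r|lborel. h t * (k (t - r) * f r) + (LINT u|lborel. \<Phi> r u))"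
    unfolding conv_def
  proof (intro Bochner_Integration.integral_cong refl)
    fix r
    show "k (t - r) * wint f r = h t * (k (t - r) * f r) + (LINT u|lborel. \<Phi> r u)"
    proof (cases "r < t")
      case True
      then show ?thesis
        using wint_extend[of r t] t by (simp add: \<Phi>_def k_eq)
    qed (simp add: k_eq \<Phi>_def)
  qed
  also have "\<dots> = h t * F t + (LINT r|lborel. LINT u|lborel. \<Phi> r u)"
    using shift[of 0] lborel_pair.integrable_fst[OF int] by (simp add: has_bochner_integral_iff)
  also have "(LINT r|lborel. LINT u|lborel. \<Phi> r u) = (LINT u|lborel. indicator {0<..t} u * ((F (t - u) - F t) * h' u))"
    using lborel_pair.Fubini_integral[OF int] by (simp add: inner)
  also have "\<dots> = - F t * h t + conv h f t"
  proof -
    have int_h: "integrable lborel (\<lambda>u. h u * f (t - u))"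
      using lborel_integrable_real_affine[OF conv_integrable_path[OF kernel_causal f_path, of t], of "-1" t] by simp
    have conv_h: "conv h f t = (LINT u|lborel. h u * f (t - u))"
      by (subst conv_commute) (simp add: conv_def mult.commute)
    \<comment> \<open>\<open>\<phi>'\<close> is the derivative of \<open>\<phi>\<close> on \<open>(0, t)\<close>, cut off outside.\<close>
    define \<phi> where "\<phi> u = (F (t - u) - F t) * h u" for u
    define \<phi>' where "\<phi>' u = indicator {0<..t} u * ((F (t - u) - F t) * h' u) - h u * f (t - u)" for u
    have int_\<phi>': "integrable lborel \<phi>'" unfolding \<phi>'_def by (intro Bochner_Integration.integrable_diff int_u int_h)
    have dF: "(F has_real_derivative f x) (at x)" if "0 < x" "x < t" for x
    proof -
      have "((\<lambda>x. integral {0..x} f) has_real_derivative f x) (at x within {0..t})"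
        using that by (intro integral_has_real_derivative causal_pathD f_path) auto
      then have "((\<lambda>x. integral {0..x} f) has_real_derivative f x) (at x)"
        using that by (simp add: at_within_Icc_at)
      then show ?thesis
        by (rule has_field_derivative_transform_within_open[where S="{0<..}"])
          (use that conv_frac_one(1)[OF f_path] in \<open>auto simp: F_def k_def\<close>)
    qed
    have d\<phi>: "(\<phi> has_real_derivative \<phi>' u) (at u)" if u: "0 < u" "u < t" for u
    proof -
      have "((\<lambda>u. F (t - u)) has_real_derivative f (t - u) * (0 - 1)) (at u)"
        using u by (intro DERIV_chain2[where f=F and g="\<lambda>u. t - u"] dF) (auto intro!: derivative_eq_intros)
      then have "(\<phi> has_real_derivative ((f (t - u) * (0 - 1) - 0) * h u + h' u * (F (t - u) - F t))) (at u)"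
        unfolding \<phi>_def using u by (intro DERIV_mult DERIV_diff DERIV_const deriv) auto
      then show ?thesis using u by (simp add: \<phi>'_def algebra_simps)
    qed
    obtain B where B: "B \<ge> 0" "\<And>x. x \<le> t \<Longrightarrow> \<bar>f x\<bar> \<le> B"
      using causal_path_bounded[OF f_path] by blast
    have F_lip: "\<bar>F (t - u) - F t\<bar> \<le> B * u" if "0 \<le> u" "u \<le> t" for u
    proof -
      have eq: "F x = integral {0..x} f" if "0 \<le> x" for x
        using conv_frac_one(1)[OF f_path that] by (simp add: F_def k_def)
      have "integral {0..t - u} f + integral {t - u..t} f = integral {0..t} f"
        using that by (intro Henstock_Kurzweil_Integration.integral_combine integrable_continuous_real causal_pathD f_path) auto
      then have "\<bar>F (t - u) - F t\<bar> = norm (integral {t - u..t} f)"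
        using that by (simp add: eq)
      also have "\<dots> \<le> B * (t - (t - u))"
        using that B by (intro integral_bound causal_pathD f_path) auto
      finally show ?thesis by simp
    qed
    have "continuous (at u within {0..t}) \<phi>" if u: "u \<in> {0..t}" for u
    proof (cases "u = 0")
      case False
      have "isCont (\<lambda>u. F (t - u)) u"
        by (rule isCont_o2[where g=F, OF _ causal_pathD(2)[OF F_path]]) (intro continuous_intros)
      moreover have "isCont h u" using u False by (intro h_cont) auto
      ultimately have "isCont \<phi> u"
        unfolding \<phi>_def by (intro isCont_mult isCont_diff continuous_const)
      then show ?thesis by (rule continuous_at_imp_continuous_within)
    next
      case True
      have "(\<phi> \<longlongrightarrow> 0) (at 0 within {0..t})"
      proof (rule Lim_null_comparison)
        show "\<forall>\<^sub>F u in at 0 within {0..t}. norm (\<phi> u) \<le> B * (C * exp (c * t)) * u powr q"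
          unfolding eventually_at
        proof (intro exI[of _ 1] conjI ballI impI)
          fix u assume "u \<in> {0..t}" "u \<noteq> 0 \<and> dist u 0 < 1"
          then have u: "0 < u" "u \<le> t" by auto
          have "norm (\<phi> u) \<le> (B * u) * (C * exp (c * t) * u powr (q - 1))"
            unfolding \<phi>_def real_norm_def abs_mult using u F_lip[of u] h_le[of u t] B
            by (intro mult_mono) auto
          also have "\<dots> = B * (C * exp (c * t)) * u powr q"
            using u by (simp add: powr_diff)
          finally show "norm (\<phi> u) \<le> B * (C * exp (c * t)) * u powr q" .
        qed auto
        have "((\<lambda>u. B * (C * exp (c * t)) * u powr q) \<longlongrightarrow> B * (C * exp (c * t)) * 0) (at 0 within {0..t})"
          using q_pos by (intro tendsto_mult tendsto_const tendsto_zero_powrI[where b=q] tendsto_ident_at)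
            (auto simp: eventually_at intro!: exI[of _ 1])
        then show "((\<lambda>u. B * (C * exp (c * t)) * u powr q) \<longlongrightarrow> 0) (at 0 within {0..t})" by simp
      qed
      then show ?thesis using True by (simp add: continuous_within \<phi>_def h_0)
    qed
    then have "continuous_on {0..t} \<phi>" by (simp add: continuous_on_eq_continuous_within)
    then have "(\<phi>' has_integral (\<phi> t - \<phi> 0)) {0..t}"
      using t d\<phi> by (intro fundamental_theorem_of_calculus_interior)
        (auto simp flip: has_real_derivative_iff_has_vector_derivative)
    moreover have "set_integrable lborel {0..t} \<phi>'"
      unfolding set_integrable_def using int_\<phi>' by (intro integrable_mult_indicator) auto
    ultimately have "(LINT u:{0..t}|lborel. \<phi>' u) = \<phi> t - \<phi> 0"
      using set_borel_integral_eq_integral(2) by (metis integral_unique)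
    moreover have "(\<lambda>u. indicator {0..t} u *\<^sub>R \<phi>' u) = \<phi>'"
      using f_0 h_0 by (fastforce simp: \<phi>'_def indicator_def fun_eq_iff)
    ultimately have "integral\<^sup>L lborel \<phi>' = \<phi> t - \<phi> 0"
      by (simp only: set_lebesgue_integral_def)
    also have "\<dots> = - F t * h t"
      using causal_pathD(3)[OF F_path, of 0] by (simp add: \<phi>_def h_0)
    finally show ?thesis
      using int_u int_h by (simp add: \<phi>'_def[abs_def] conv_h)
  qed
  finally show ?thesis by (simp add: k_def)
qed

lemma wint_growth:
  obtains D d where "\<And>t. t > 0 \<Longrightarrow> \<bar>wint f t\<bar> \<le> D * exp (d * t)"
proof -
  define p where "p = \<alpha> + q - 1"
  have p: "p > 0" using \<alpha>_q by (simp add: p_def)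
  have "\<bar>wint f t\<bar> \<le> (K * C * (1 + 1 / p)) * exp ((2 + c + p) * t)" if t: "t > 0" for t
  proof -
    define E where "E = K * exp (2 * t) * (C * exp (c * t))"
    have E: "E \<ge> 0" using K_nonneg C_nonneg by (simp add: E_def)
    have "\<bar>f t - f 0\<bar> \<le> K * exp (2 * t) * (t - 0) powr \<alpha>" using t by (intro f_hoelder) auto
    then have "\<bar>h t * f t\<bar> \<le> (C * exp (c * t) * t powr (q - 1)) * (K * exp (2 * t) * t powr \<alpha>)"
      unfolding abs_mult using f_0[of 0] h_bound[OF t] by (intro mult_mono) auto
    also have "\<dots> = E * t powr p"
    proof -
      have "t powr p = t powr (q - 1) * t powr \<alpha>"
        by (subst powr_add[symmetric]) (simp add: p_def algebra_simps)
      then show ?thesis by (simp add: E_def)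
    qed
    finally have 1: "\<bar>h t * f t\<bar> \<le> E * t powr p" .
    have "\<bar>LINT u|lborel. indicator {0<..t} u * ((f (t - u) - f t) * h' u)\<bar> \<le>
        (LINT u|lborel. norm (indicator {0<..t} u * ((f (t - u) - f t) * h' u)))"
      unfolding real_norm_def[symmetric] by (rule integral_norm_bound)
    also have "\<dots> \<le> (LINT u|lborel. E * (indicator {0<..t} u * u powr (\<alpha> + q - 1 - 1)))"
      using increment_bound_ind[of t t]
      by (intro integral_mono integrable_norm increment_integrable majorant_integrable) (auto simp: E_def)
    also have "\<dots> = E * (t powr p / p)"
      using integrable_powr_from_0(2)[OF p, of t] t by (simp add: p_def)
    finally have "\<bar>wint f t\<bar> \<le> E * t powr p * (1 + 1 / p)"
      using 1 unfolding pathwise_integral_def by (simp add: algebra_simps)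
    also have "t powr p \<le> exp (p * t)"
    proof -
      have "t powr p \<le> exp t powr p"
        using t p exp_ge_add_one_self[of t] by (intro powr_mono2) linarith+
      then show ?thesis by (simp add: powr_def)
    qed
    then have "E * t powr p * (1 + 1 / p) \<le> E * exp (p * t) * (1 + 1 / p)"
      using E p by (intro mult_right_mono mult_left_mono) auto
    also have "\<dots> = (K * C * (1 + 1 / p)) * exp ((2 + c + p) * t)"
      by (simp add: E_def algebra_simps exp_add)
    finally show ?thesis .
  qed
  then show thesis by (rule that)
qed

end

section \<open>Riemann sums over equidistant partitions\<close>

definition grid :: "real \<Rightarrow> nat \<Rightarrow> nat \<Rightarrow> real" where
  "grid t n i = real i * t / real (Suc n)"

lemma grid_0 [simp]: "grid t n 0 = 0" and grid_end [simp]: "grid t n (Suc n) = t"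
  by (simp_all add: grid_def)

lemma grid_step: "grid t n (Suc i) = grid t n i + t / real (Suc n)"
  unfolding grid_def of_nat_Suc[of i] distrib_right add_divide_distrib by (simp del: of_nat_Suc)

lemma grid_less: "t > 0 \<Longrightarrow> i < j \<Longrightarrow> grid t n i < grid t n j"
  by (simp add: grid_def divide_strict_right_mono)

lemma grid_mono: "t > 0 \<Longrightarrow> i \<le> j \<Longrightarrow> grid t n i \<le> grid t n j"
  using grid_less[of t i j n] by (cases "i = j") auto

lemma grid_locate:
  assumes "0 < s" "s \<le> t"
  obtains i where "i < Suc n" "grid t n i < s" "s \<le> grid t n (Suc i)"
proof -
  have ex: "s \<le> grid t n (Suc n)" using assms by simp
  define j where "j = (LEAST j. s \<le> grid t n j)"
  have j: "s \<le> grid t n j" unfolding j_def using ex by (rule LeastI)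
  have jn: "j \<le> Suc n" unfolding j_def using ex by (rule Least_le)
  have "j \<noteq> 0" using j assms by (cases j) auto
  then obtain i where i: "j = Suc i" by (cases j) auto
  have "\<not> s \<le> grid t n i" using not_less_Least[of i "\<lambda>j. s \<le> grid t n j"] i by (simp add: j_def)
  then show thesis using that[of i] i j jn by auto
qed

lemma step_fun_grid:
  assumes "t > 0" "i < N" "grid t n i < s" "s \<le> grid t n (Suc i)"
  shows "step_fun N (grid t n) c s = c i"
proof -
  have "c j * indicator {grid t n j<..grid t n (Suc j)} s = (if j = i then c j else 0)" for j
    using assms grid_mono[of t "Suc j" i n] grid_mono[of t "Suc i" j n]
    by (cases j i rule: linorder_cases) (auto simp: indicator_def)
  then show ?thesis using assms by (simp add: step_fun_def)
qed

lemma step_fun_nonpos: "t > 0 \<Longrightarrow> s \<le> 0 \<Longrightarrow> step_fun N (grid t n) c s = 0"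
  using grid_mono[of t 0 _ n] by (auto simp: step_fun_def indicator_def intro!: sum.neutral dest: order.trans leD)

lemma step_fun_measurable [measurable]: "step_fun N u c \<in> borel_measurable borel"
  unfolding step_fun_def by measurable

text \<open>
  The grid points that enclose a fixed point \<open>s\<close> converge to it. This yields the pointwise convergence
  of all step functions used below.
\<close>

lemma grid_approx:
  assumes "0 < s" "s \<le> t"
  shows "\<exists>i. (\<forall>n. i n < Suc n \<and> grid t n (i n) < s \<and> s \<le> grid t n (Suc (i n))) \<and>
    (\<lambda>n. grid t n (i n)) \<longlonglongrightarrow> s \<and> (\<lambda>n. grid t n (Suc (i n))) \<longlonglongrightarrow> s"
proof -
  have "\<forall>n. \<exists>i. i < Suc n \<and> grid t n i < s \<and> s \<le> grid t n (Suc i)"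
  proof
    show "\<exists>i. i < Suc n \<and> grid t n i < s \<and> s \<le> grid t n (Suc i)" for n
      by (rule grid_locate[OF assms, of n]) blast
  qed
  from choice[OF this] obtain i where
    i: "\<And>n. i n < Suc n" "\<And>n. grid t n (i n) < s" "\<And>n. s \<le> grid t n (Suc (i n))"
    by blast
  have lim: "(\<lambda>n. t / real (Suc n)) \<longlonglongrightarrow> 0" by (rule lim_const_over_n[THEN LIMSEQ_Suc])
  have lo: "s - t / real (Suc n) \<le> grid t n (i n)" for n
    using i(3)[of n] unfolding grid_step by linarith
  have hi: "grid t n (Suc (i n)) \<le> s + t / real (Suc n)" for n
    using i(2)[of n] unfolding grid_step by linarith
  have "(\<lambda>n. s - t / real (Suc n)) \<longlonglongrightarrow> s - 0" by (intro tendsto_diff tendsto_const lim)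
  then have "(\<lambda>n. s - t / real (Suc n)) \<longlonglongrightarrow> s" by simp
  then have 1: "(\<lambda>n. grid t n (i n)) \<longlonglongrightarrow> s"
  proof (rule real_tendsto_sandwich[rotated 2])
    show "\<forall>\<^sub>F n in sequentially. s - t / real (Suc n) \<le> grid t n (i n)"
      by (rule always_eventually) (rule allI, rule lo)
    show "\<forall>\<^sub>F n in sequentially. grid t n (i n) \<le> s"
      by (rule always_eventually) (rule allI, rule less_imp_le, rule i(2))
  qed (rule tendsto_const)
  have "(\<lambda>n. s + t / real (Suc n)) \<longlonglongrightarrow> s + 0" by (intro tendsto_add tendsto_const lim)
  then have "(\<lambda>n. s + t / real (Suc n)) \<longlonglongrightarrow> s" by simp
  then have "(\<lambda>n. grid t n (Suc (i n))) \<longlonglongrightarrow> s"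
  proof (rule real_tendsto_sandwich[OF _ _ tendsto_const[of s], rotated 2])
    show "\<forall>\<^sub>F n in sequentially. s \<le> grid t n (Suc (i n))"
      by (rule always_eventually) (rule allI, rule i(3))
    show "\<forall>\<^sub>F n in sequentially. grid t n (Suc (i n)) \<le> s + t / real (Suc n)"
      by (rule always_eventually) (rule allI, rule hi)
  qed
  with i 1 show ?thesis by blast
qed

lemma summation_by_parts:
  fixes a W :: "nat \<Rightarrow> real"
  shows "(\<Sum>i<Suc m. a i * (W (Suc i) - W i)) =
    a m * W (Suc m) - a 0 * W 0 + (\<Sum>i<m. W (Suc i) * (a i - a (Suc i)))"
  by (induction m) (auto simp: algebra_simps)

context kernel_path begin

text \<open>
  Summation by parts moves the differences from the path to the kernel, where they become integrals of
  \<open>h'\<close>. The sum is then the integral of \<open>h'\<close> against a step approximation \<open>G\<close> of the path increment.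
  Since the right end point of each subinterval is closer to \<open>t\<close> than any point of it, the Hoelder
  majorant of the limit also dominates the approximations.
\<close>

lemma riemann_sum_tendsto_wint:
  assumes t: "t > 0"
  shows "(\<lambda>n. \<Sum>i<Suc n. h (t - grid t n i) * (f (grid t n (Suc i)) - f (grid t n i))) \<longlonglongrightarrow> wint f t"
proof -
  define W where "W s = f s - f t" for s
  define G where "G n u = step_fun (Suc n) (grid t n) (\<lambda>i. W (grid t n (Suc i))) (t - u) * h' u" for n u
  have [measurable]: "G n \<in> borel_measurable borel" for n unfolding G_def by measurable
  have eq: "(\<Sum>i<Suc n. h (t - grid t n i) * (f (grid t n (Suc i)) - f (grid t n i))) =
      h t * f t + integral\<^sup>L lborel (G n)" for n
  proof -
    define S where "S i = {t - grid t n (Suc i)..<t - grid t n i}" for i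
    \<comment> \<open>The last term of the step function vanishes because \<open>W t = 0\<close>; this avoids the subinterval
      at the singularity.\<close>
    have G_eq: "G n u = (\<Sum>i<n. W (grid t n (Suc i)) * (indicator (S i) u * h' u))" for u
    proof -
      have "G n u = (\<Sum>i<Suc n. W (grid t n (Suc i)) * (indicator (S i) u * h' u))"
        unfolding G_def step_fun_def sum_distrib_right S_def
        by (intro sum.cong refl) (auto simp: indicator_def)
      then show ?thesis by (simp add: W_def)
    qed
    have hb: "has_bochner_integral lborel (\<lambda>u. W (grid t n (Suc i)) * (indicator (S i) u * h' u))
        (W (grid t n (Suc i)) * (h (t - grid t n i) - h (t - grid t n (Suc i))))" if "i < n" for i
      unfolding S_def using grid_less[OF t, of "Suc i" "Suc n" n] grid_less[OF t, of i "Suc i" n] that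
      by (intro has_bochner_integral_mult_right integral_h') auto
    have "has_bochner_integral lborel (G n)
        (\<Sum>i<n. W (grid t n (Suc i)) * (h (t - grid t n i) - h (t - grid t n (Suc i))))"
      unfolding G_eq using hb by (intro has_bochner_integral_sum) auto
    moreover have "(\<Sum>i<Suc n. h (t - grid t n i) * (W (grid t n (Suc i)) - W (grid t n i))) =
        h t * f t + (\<Sum>i<n. W (grid t n (Suc i)) * (h (t - grid t n i) - h (t - grid t n (Suc i))))"
      unfolding summation_by_parts[of "\<lambda>i. h (t - grid t n i)" "\<lambda>i. W (grid t n i)" n] using f_0[of 0] by (simp add: W_def)
    ultimately show ?thesis by (simp add: has_bochner_integral_iff W_def)
  qed
  have "(\<lambda>n. integral\<^sup>L lborel (G n)) \<longlonglongrightarrow> (LINT u|lborel. indicator {0<..t} u * ((f (t - u) - f t) * h' u))"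
  proof (rule integral_dominated_convergence)
    show "integrable lborel (\<lambda>u. (K * exp (2 * t) * (C * exp (c * t))) * (indicator {0<..t} u * u powr (\<alpha> + q - 1 - 1)))"
      by (rule majorant_integrable)
    have "(\<lambda>n. G n u) \<longlonglongrightarrow> indicator {0<..t} u * ((f (t - u) - f t) * h' u)" if ut: "u \<noteq> t" for u
    proof -
      consider "u \<le> 0" | "u > t" | "0 < u" "u < t" using ut by linarith
      then show ?thesis
      proof cases
        case 1
        then show ?thesis by (simp add: G_def h'_0)
      next
        case 2
        then show ?thesis using t by (simp add: G_def step_fun_nonpos)
      next
        case 3
        obtain i where i: "\<And>n. i n < Suc n" "\<And>n. grid t n (i n) < t - u"
          "\<And>n. t - u \<le> grid t n (Suc (i n))"
          "(\<lambda>n. grid t n (i n)) \<longlonglongrightarrow> t - u" "(\<lambda>n. grid t n (Suc (i n))) \<longlonglongrightarrow> t - u"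
        proof -
          have "0 < t - u" "t - u \<le> t" using 3 by auto
          from grid_approx[OF this] show thesis using that by blast
        qed
        have "(\<lambda>n. (f (grid t n (Suc (i n))) - f t) * h' u) \<longlonglongrightarrow> (f (t - u) - f t) * h' u"
          by (intro tendsto_mult tendsto_diff tendsto_const
              isCont_tendsto_compose[OF causal_pathD(2)[OF f_path]] i(5))
        moreover have "G n u = (f (grid t n (Suc (i n))) - f t) * h' u" for n
          using step_fun_grid[OF t i(1) i(2) i(3)] by (simp add: G_def W_def)
        ultimately show ?thesis using 3 by simp
      qed
    qed
    then show "AE u in lborel. (\<lambda>n. G n u) \<longlonglongrightarrow> indicator {0<..t} u * ((f (t - u) - f t) * h' u)"
      by (intro eventually_mono[OF AE_lborel_singleton[of t]])
    show "AE u in lborel. norm (G n u) \<le>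
        (K * exp (2 * t) * (C * exp (c * t))) * (indicator {0<..t} u * u powr (\<alpha> + q - 1 - 1))" for n
    proof (rule AE_I2)
      fix u
      consider "u \<le> 0" | "u \<ge> t" | "0 < u" "u < t" by linarith
      then show "norm (G n u) \<le> (K * exp (2 * t) * (C * exp (c * t))) * (indicator {0<..t} u * u powr (\<alpha> + q - 1 - 1))"
      proof cases
        case 1
        then show ?thesis by (simp add: G_def h'_0)
      next
        case 2
        then show ?thesis using t K_nonneg C_nonneg by (simp add: G_def step_fun_nonpos)
      next
        case 3
        then obtain i where i: "i < Suc n" "grid t n i < t - u" "t - u \<le> grid t n (Suc i)"
          using grid_locate[of "t - u" t n] by auto
        define r where "r = grid t n (Suc i)"
        have r: "t - u \<le> r" "r \<le> t" using i grid_mono[OF t, of "Suc i" "Suc n" n] by (auto simp: r_def)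
        have "\<bar>f t - f r\<bar> \<le> K * exp (2 * t) * (t - r) powr \<alpha>" by (rule f_hoelder[OF r(2)])
        also have "\<dots> \<le> K * exp (2 * t) * u powr \<alpha>"
          using r K_nonneg \<alpha>_pos by (intro mult_left_mono powr_mono2) auto
        finally have "\<bar>G n u\<bar> \<le> (K * exp (2 * t) * u powr \<alpha>) * (C * exp (c * t) * u powr (q - 2))"
          unfolding G_def step_fun_grid[OF t i] abs_mult using 3 h'_le[of u t]
          by (intro mult_mono) (auto simp: W_def r_def abs_minus_commute)
        also have "\<dots> = K * exp (2 * t) * (C * exp (c * t)) * (u powr \<alpha> * u powr (q - 2))" by simp
        also have "u powr \<alpha> * u powr (q - 2) = u powr (\<alpha> + q - 1 - 1)"
          by (subst powr_add[symmetric]) (simp add: algebra_simps)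
        finally show ?thesis using 3 by simp
      qed
    qed
  qed measurable
  then show ?thesis unfolding eq pathwise_integral_def by (intro tendsto_add tendsto_const)
qed

end

lemma square_sum_bound: "(a - b)\<^sup>2 \<le> 2 * a\<^sup>2 + 2 * (b::real)\<^sup>2"
  using sum_squares_ge_zero[of "a + b" 0] by (simp add: power2_eq_square algebra_simps)

context singular_kernel begin

lemma kernel_square_majorant:
  assumes "q > 1/2" "t > 0"
  shows "integrable lborel (\<lambda>s. indicator {0..<t} s * (t - s) powr (2 * q - 2))"
proof -
  have "integrable lborel (\<lambda>s. indicator {0<..t} (t + -1 * s) * (t + -1 * s) powr ((2 * q - 1) - 1))"
    using assms by (intro lborel_integrable_real_affine integrable_powr_from_0) auto
  then show ?thesis
    by (rule Bochner_Integration.integrable_cong[THEN iffD1, rotated 2]) (auto simp: indicator_def)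
qed

lemma kernel_square_le:
  assumes "0 < u" "u \<le> t"
  shows "(h u)\<^sup>2 \<le> (C * exp (c * t))\<^sup>2 * u powr (2 * q - 2)"
proof -
  have "\<bar>h u\<bar>\<^sup>2 \<le> (C * exp (c * t) * u powr (q - 1))\<^sup>2"
    using h_le[OF assms] by (intro power_mono) auto
  also have "\<dots> = (C * exp (c * t))\<^sup>2 * u powr (2 * q - 2)"
    by (simp add: power_mult_distrib power2_eq_square[of "u powr _"] powr_add[symmetric])
  finally show ?thesis by simp
qed

lemma kernel_square_integrable:
  assumes "q > 1/2" "t > 0"
  shows "set_integrable lborel {0..t} (\<lambda>s. (h (t - s))\<^sup>2)"
  unfolding set_integrable_def
proof (rule Bochner_Integration.integrable_bound)
  show "integrable lborel (\<lambda>s. (C * exp (c * t))\<^sup>2 * (indicator {0..<t} s * (t - s) powr (2 * q - 2)))"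
    using assms by (intro integrable_mult_right kernel_square_majorant) auto
  show "AE s in lborel. norm (indicator {0..t} s *\<^sub>R (h (t - s))\<^sup>2) \<le>
      norm ((C * exp (c * t))\<^sup>2 * (indicator {0..<t} s * (t - s) powr (2 * q - 2)))"
    using kernel_square_le[of _ t] h_0 by (intro AE_I2) (auto simp: indicator_def)
qed auto

text \<open>
  Evaluating at the left end points keeps the step functions away from the singularity at \<open>s = t\<close>:
  their values are bounded by the singular power at \<open>s\<close> itself or by the one at \<open>0\<close>, according to the
  sign of \<open>q - 1\<close>. The square of this majorant is integrable for \<open>q > 1/2\<close>.
\<close>

lemma step_approx_L2:
  assumes q: "q > 1/2" and t: "t > 0"
  shows "(\<lambda>n. \<integral>\<^sup>+s\<in>{0..t}. ennreal ((h (t - s) - step_fun (Suc n) (grid t n) (\<lambda>i. h (t - grid t n i)) s)\<^sup>2) \<partial>lborel)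
    \<longlonglongrightarrow> 0"
proof -
  define D where "D n s = (h (t - s) - step_fun (Suc n) (grid t n) (\<lambda>i. h (t - grid t n i)) s)\<^sup>2" for n s
  define E where "E = (C * exp (c * t))\<^sup>2"
  define m where "m s = 4 * E * (indicator {0..<t} s * (t - s) powr (2 * q - 2)) +
     (2 * E * t powr (2 * q - 2)) * indicator {0..t} s + 4 * E * 0" for s
  have E: "E \<ge> 0" by (simp add: E_def)
  have [measurable]: "D n \<in> borel_measurable borel" for n unfolding D_def by measurable
  have m_int: "integrable lborel m"
    unfolding m_def using t
    by (intro Bochner_Integration.integrable_add integrable_mult_right kernel_square_majorant q
        integrable_real_indicator) auto
  have m0: "m s \<ge> 0" for s using E by (simp add: m_def)
  have bound: "D n s \<le> m s" if s: "0 < s" "s < t" for n s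
  proof -
    obtain i where i: "i < Suc n" "grid t n i < s" "s \<le> grid t n (Suc i)"
      using grid_locate[of s t n] s by auto
    have g: "0 \<le> grid t n i" using grid_mono[OF t, of 0 i n] by simp
    have "D n s = (h (t - s) - h (t - grid t n i))\<^sup>2"
      by (simp add: D_def step_fun_grid[OF t i])
    also have "\<dots> \<le> 2 * (h (t - s))\<^sup>2 + 2 * (h (t - grid t n i))\<^sup>2" by (rule square_sum_bound)
    also have "\<dots> \<le> 2 * (E * (t - s) powr (2 * q - 2)) + 2 * (E * (t - grid t n i) powr (2 * q - 2))"
      unfolding E_def using s i g by (intro add_mono mult_left_mono kernel_square_le) auto
    also have "(t - grid t n i) powr (2 * q - 2) \<le> (t - s) powr (2 * q - 2) + t powr (2 * q - 2)"
    proof (cases "2 * q - 2 \<ge> 0")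
      case True
      then have "(t - grid t n i) powr (2 * q - 2) \<le> t powr (2 * q - 2)"
        using s i g by (intro powr_mono2) auto
      then show ?thesis by (simp add: add_increasing)
    next
      case False
      then have "(t - grid t n i) powr (2 * q - 2) \<le> (t - s) powr (2 * q - 2)"
        using s i g by (intro powr_mono2') auto
      then show ?thesis by (simp add: add_increasing2)
    qed
    finally have "D n s \<le> 2 * (E * (t - s) powr (2 * q - 2)) +
        2 * (E * ((t - s) powr (2 * q - 2) + t powr (2 * q - 2)))"
      using E by (simp add: mult_left_mono)
    then show ?thesis using s by (simp add: m_def algebra_simps)
  qed
  have lim: "(\<lambda>n. D n s) \<longlonglongrightarrow> 0" if s: "0 < s" "s < t" for s
  proof -
    obtain i where i: "\<And>n. i n < Suc n" "\<And>n. grid t n (i n) < s"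
      "\<And>n. s \<le> grid t n (Suc (i n))" "(\<lambda>n. grid t n (i n)) \<longlonglongrightarrow> s"
      "(\<lambda>n. grid t n (Suc (i n))) \<longlonglongrightarrow> s"
      using grid_approx[OF s(1) less_imp_le[OF s(2)]] by blast
    have "(\<lambda>n. (h (t - s) - h (t - grid t n (i n)))\<^sup>2) \<longlonglongrightarrow> (h (t - s) - h (t - s))\<^sup>2"
      by (intro tendsto_power tendsto_diff tendsto_const isCont_tendsto_compose[OF h_cont] i(4)) (use s in auto)
    then show ?thesis by (simp add: D_def step_fun_grid[OF t i(1) i(2) i(3)])
  qed
  have "(\<lambda>n. \<integral>\<^sup>+s. ennreal (indicator {0..t} s * D n s) \<partial>lborel) \<longlonglongrightarrow> (\<integral>\<^sup>+s. ennreal 0 \<partial>(lborel::real measure))"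
  proof (rule nn_integral_dominated_convergence[where w="\<lambda>s. ennreal (m s)"])
    show "AE s in lborel. ennreal (indicator {0..t} s * D n s) \<le> ennreal (m s)" for n
      using AE_lborel_singleton[of 0] AE_lborel_singleton[of t]
    proof eventually_elim
      case (elim s)
      then show ?case using bound[of s n] m0[of s] by (auto simp: indicator_def intro!: ennreal_leI)
    qed
    show "AE s in lborel. (\<lambda>n. ennreal (indicator {0..t} s * D n s)) \<longlonglongrightarrow> ennreal 0"
      using AE_lborel_singleton[of 0] AE_lborel_singleton[of t]
    proof eventually_elim
      case (elim s)
      then show ?case
      proof (cases "s \<in> {0..t}")
        case True
        then have "(\<lambda>n. D n s) \<longlonglongrightarrow> 0" using elim by (intro lim) auto
        then show ?thesis using True by (intro tendsto_ennrealI) auto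
      qed auto
    qed
    show "(\<integral>\<^sup>+s. ennreal (m s) \<partial>lborel) < \<infinity>"
      using m_int m0 by (simp add: nn_integral_eq_integral)
  qed (use m_int in measurable)
  moreover have "ennreal (indicator {0..t} s * D n s) = ennreal (D n s) * indicator {0..t} s" for n s
    by (auto simp: indicator_def)
  ultimately show ?thesis by (simp add: D_def)
qed

end

section \<open>The fractional equation along a single path\<close>

lemma ml_kernel_singular:
  assumes "\<beta> > 0" "q > 0"
  obtains C c where "singular_kernel (ml_kernel \<beta> \<mu> q) (ml_kernel \<beta> \<mu> (q - 1)) q C c"
proof -
  obtain C1 c1 where 1: "C1 \<ge> 0" "c1 \<ge> 0"
    "\<And>u. u > 0 \<Longrightarrow> \<bar>ml_kernel \<beta> \<mu> q u\<bar> \<le> C1 * exp (c1 * u) * u powr (q - 1)"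
    using ml_kernel_bound[of \<beta> q \<mu>] assms by auto
  obtain C2 c2 where 2: "C2 \<ge> 0" "c2 \<ge> 0"
    "\<And>u. u > 0 \<Longrightarrow> \<bar>ml_kernel \<beta> \<mu> (q - 1) u\<bar> \<le> C2 * exp (c2 * u) * u powr (q - 1 - 1)"
    using ml_kernel_bound[of \<beta> "q - 1" \<mu>] assms by auto
  have mono: "C' * exp (c' * u) * v \<le> max C1 C2 * exp (max c1 c2 * u) * v"
    if "C' \<le> max C1 C2" "c' \<le> max c1 c2" "0 \<le> C'" "0 < u" "0 \<le> v" for C' c' u v
    using that by (intro mult_right_mono mult_mono) auto
  have "singular_kernel (ml_kernel \<beta> \<mu> q) (ml_kernel \<beta> \<mu> (q - 1)) q (max C1 C2) (max c1 c2)"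
  proof
    show "\<bar>ml_kernel \<beta> \<mu> q u\<bar> \<le> max C1 C2 * exp (max c1 c2 * u) * u powr (q - 1)" if "u > 0" for u
      by (rule order_trans[OF 1(3) mono]) (use that 1 in auto)
    show "\<bar>ml_kernel \<beta> \<mu> (q - 1) u\<bar> \<le> max C1 C2 * exp (max c1 c2 * u) * u powr (q - 2)" if "u > 0" for u
    proof -
      have "q - 2 = q - 1 - 1" by simp
      then show ?thesis
        by (simp only:) (rule order_trans[OF 2(3) mono], use that 2 in auto)
    qed
  qed (use assms 1 in \<open>auto intro!: ml_kernel_deriv simp: le_max_iff_disj\<close>)
  then show thesis by (rule that)
qed

lemma ml_kernel_path:
  assumes "\<beta> > 0" "q > 1"
  shows "causal_path (ml_kernel \<beta> \<mu> q)"
  unfolding causal_path_def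
proof (intro conjI allI impI)
  have "isCont (ml_kernel \<beta> \<mu> q) u" for u
  proof (cases u "0::real" rule: linorder_cases)
    case less
    have "eventually (\<lambda>x. ml_kernel \<beta> \<mu> q x = 0) (nhds u)"
      using less by (intro eventually_nhds_in_open[of "{..<0}", THEN eventually_mono]) auto
    then show ?thesis by (subst isCont_cong) auto
  next
    case greater
    then show ?thesis using DERIV_isCont[OF ml_kernel_deriv] assms by auto
  next
    case equal
    obtain C c where C: "C \<ge> 0" "c \<ge> 0"
      "\<And>u. u > 0 \<Longrightarrow> \<bar>ml_kernel \<beta> \<mu> q u\<bar> \<le> C * exp (c * u) * u powr (q - 1)"
      using ml_kernel_bound[of \<beta> q \<mu>] assms by auto
    have "(ml_kernel \<beta> \<mu> q \<longlongrightarrow> 0) (at 0)"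
    proof (rule Lim_null_comparison)
      show "\<forall>\<^sub>F u in at 0. norm (ml_kernel \<beta> \<mu> q u) \<le> C * exp (c * \<bar>u\<bar>) * \<bar>u\<bar> powr (q - 1)"
      proof (intro always_eventually allI)
        fix u show "norm (ml_kernel \<beta> \<mu> q u) \<le> C * exp (c * \<bar>u\<bar>) * \<bar>u\<bar> powr (q - 1)"
          using C by (cases "u > 0") auto
      qed
      have "((\<lambda>u. \<bar>u\<bar> powr (q - 1)) \<longlongrightarrow> 0) (at (0::real))"
        using assms by (intro tendsto_zero_powrI[where b="q - 1"] tendsto_const) (auto intro!: tendsto_eq_intros)
      then have "((\<lambda>u. C * exp (c * \<bar>u\<bar>) * \<bar>u\<bar> powr (q - 1)) \<longlongrightarrow> C * exp (c * \<bar>0\<bar>) * 0) (at (0::real))"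
        by (intro tendsto_mult tendsto_const tendsto_exp tendsto_rabs tendsto_ident_at)
      then show "((\<lambda>u. C * exp (c * \<bar>u\<bar>) * \<bar>u\<bar> powr (q - 1)) \<longlongrightarrow> 0) (at 0)" by simp
    qed
    then show ?thesis using equal by (simp add: isCont_def)
  qed
  then show "continuous_on UNIV (ml_kernel \<beta> \<mu> q)" by (simp add: continuous_on_eq_continuous_at)
qed auto

text \<open>
  The recursion of the kernels, read as an identity between convolution operators.
\<close>

lemma resolvent_identity:
  assumes "\<beta> > 0" "q > 0" "causal_path \<phi>"
  shows "conv (ml_kernel \<beta> (- a) q) \<phi> t + a * conv (ml_kernel \<beta> (- a) (q + \<beta>)) \<phi> t = conv (frac_kernel q) \<phi> t"
proof -
  have "(\<lambda>u. 1 * ml_kernel \<beta> (- a) q u + a * ml_kernel \<beta> (- a) (q + \<beta>) u) = frac_kernel q"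
    using assms by (simp add: fun_eq_iff ml_kernel_rec[of \<beta> q "- a"])
  then show ?thesis
    using conv_lincomb_left[of "ml_kernel \<beta> (- a) q" "ml_kernel \<beta> (- a) (q + \<beta>)" \<phi> 1 a t] assms
    by (simp add: ml_kernel_causal)
qed

text \<open>
  Convolution with \<open>h\<^sub>\<beta>\<close> inverts the operator up to one integration, and by causality it only sees the
  equation on \<open>[0, t]\<close>.
\<close>

lemma fractional_homogeneous_unique:
  assumes \<beta>: "0 < \<beta>" "\<beta> < 1" and D: "causal_path D" and T: "T > 0"
    and eq: "\<And>t. t \<in> {0..T} \<Longrightarrow> conv (frac_kernel (1 - \<beta>)) D t = - a * conv (frac_kernel 1) D t"
    and t: "t \<in> {0..T}"
  shows "D t = 0"
proof (rule conv_frac_one_eq_0[OF D T _ t])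
  fix t assume t: "t \<in> {0..T}"
  let ?h = "ml_kernel \<beta> (- a) \<beta>"
  have h: "causal_kernel ?h" using \<beta> by (intro ml_kernel_causal)
  have k: "causal_kernel (frac_kernel (1 - \<beta>))" "causal_kernel (frac_kernel 1)"
    using \<beta> by (auto intro: frac_kernel_causal)
  define R where "R t = 1 * conv (frac_kernel (1 - \<beta>)) D t + a * conv (frac_kernel 1) D t" for t
  note paths = conv_causal_path[OF k(1) D] conv_causal_path[OF k(2) D]
  have "?h (t - s) * R s = 0" for s
  proof (cases "s \<le> 0 \<or> t \<le> s")
    case True
    then show ?thesis using causal_pathD(3)[OF causal_path_lincomb[OF paths, of 1 a], of s]
      by (auto simp: R_def)
  next
    case False
    then show ?thesis using eq[of s] t by (simp add: R_def)
  qed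
  then have "conv ?h R t = 0" by (simp only: conv_def integral_zero)
  moreover have "conv ?h R t = conv ?h (conv (frac_kernel (1 - \<beta>)) D) t + a * conv ?h (conv (frac_kernel 1) D) t"
    unfolding R_def[abs_def] using conv_lincomb_right[OF h paths, of 1 a t] by simp
  moreover have "conv ?h (conv (frac_kernel (1 - \<beta>)) D) t = conv (ml_kernel \<beta> (- a) 1) D t"
  proof -
    have "conv ?h (frac_kernel (1 - \<beta>)) = ml_kernel \<beta> (- a) 1"
      using \<beta> by (simp add: fun_eq_iff conv_frac_ml(2))
    then show ?thesis unfolding conv_assoc[OF h k(1) D] by simp
  qed
  moreover have "conv ?h (conv (frac_kernel 1) D) t = conv (ml_kernel \<beta> (- a) (1 + \<beta>)) D t"
  proof -
    have "conv ?h (frac_kernel 1) = ml_kernel \<beta> (- a) (1 + \<beta>)"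
      using \<beta> by (simp add: fun_eq_iff conv_frac_ml(2))
    then show ?thesis unfolding conv_assoc[OF h k(2) D] by simp
  qed
  ultimately show "conv (frac_kernel 1) D t = 0"
    using resolvent_identity[OF \<beta>(1) zero_less_one D, of a t] by simp
qed

text \<open>
  The two sides are compared after one integration, where the primitive of \<open>V\<close> can be replaced by
  \<open>h\<^sub>q * f\<close>. Both then become convolutions of \<open>f\<close> with kernels of indices \<open>2 - \<gamma>\<close> and \<open>2 - \<gamma> + \<beta>\<close>,
  and the resolvent identity applies.
\<close>

lemma fractional_inhomogeneous:
  assumes \<beta>: "0 < \<beta>" "\<beta> < 1" and \<gamma>: "0 < \<gamma>" "\<gamma> < 1" and q: "q = 1 + \<beta> - \<gamma>"
    and V: "causal_path V" and f: "causal_path f"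
    and eq: "conv (frac_kernel 1) V = conv (ml_kernel \<beta> (- a) q) f"
    and t: "t \<ge> 0"
  shows "conv (frac_kernel (1 - \<beta>)) V t + a * conv (frac_kernel 1) V t = conv (frac_kernel (1 - \<gamma>)) f t"
proof -
  let ?h = "ml_kernel \<beta> (- a) q"
  have h: "causal_kernel ?h" using \<beta> \<gamma> q by (intro ml_kernel_causal) auto
  have k: "causal_kernel (frac_kernel (1 - \<beta>))" "causal_kernel (frac_kernel 1)" "causal_kernel (frac_kernel (1 - \<gamma>))"
    using \<beta> \<gamma> by (auto intro: frac_kernel_causal)
  define L where "L t = 1 * (1 * conv (frac_kernel (1 - \<beta>)) V t + a * conv (frac_kernel 1) V t) +
      (- 1) * conv (frac_kernel (1 - \<gamma>)) f t" for t
  note paths = conv_causal_path[OF k(1) V] conv_causal_path[OF k(2) V] conv_causal_path[OF k(3) f]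
  note path12 = causal_path_lincomb[OF paths(1,2), of 1 a]
  have L: "causal_path L" unfolding L_def[abs_def] by (rule causal_path_lincomb[OF path12 paths(3)])
  have "conv (frac_kernel 1) L s = 0" for s
  proof -
    have "conv (frac_kernel 1) L s = conv (frac_kernel 1) (conv (frac_kernel (1 - \<beta>)) V) s +
        a * conv (frac_kernel 1) (conv (frac_kernel 1) V) s - conv (frac_kernel 1) (conv (frac_kernel (1 - \<gamma>)) f) s"
      unfolding L_def[abs_def]
      using conv_lincomb_right[OF k(2) path12 paths(3), of 1 "-1" s] conv_lincomb_right[OF k(2) paths(1,2), of 1 a s]
      by simp
    also have "conv (frac_kernel 1) (conv (frac_kernel (1 - \<beta>)) V) s = conv (ml_kernel \<beta> (- a) (2 - \<gamma>)) f s"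
    proof -
      have "conv (frac_kernel 1) (conv (frac_kernel (1 - \<beta>)) V) s =
          conv (frac_kernel (1 - \<beta>)) (conv (frac_kernel 1) V) s"
        unfolding conv_assoc[OF k(2,1) V] conv_assoc[OF k(1,2) V]
        by (simp add: conv_commute[of "frac_kernel 1" "frac_kernel (1 - \<beta>)", abs_def])
      also have "\<dots> = conv (conv (frac_kernel (1 - \<beta>)) ?h) f s"
        unfolding eq by (rule conv_assoc[OF k(1) h f])
      also have "conv (frac_kernel (1 - \<beta>)) ?h = ml_kernel \<beta> (- a) (2 - \<gamma>)"
      proof (rule ext)
        fix x
        have "1 - \<beta> + q = 2 - \<gamma>" using q by simp
        then show "conv (frac_kernel (1 - \<beta>)) ?h x = ml_kernel \<beta> (- a) (2 - \<gamma>) x"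
          using conv_frac_ml(1)[OF \<beta>(1), of "1 - \<beta>" q "- a" x] \<beta> \<gamma> q by simp
      qed
      finally show ?thesis .
    qed
    also have "conv (frac_kernel 1) (conv (frac_kernel 1) V) s = conv (ml_kernel \<beta> (- a) (2 - \<gamma> + \<beta>)) f s"
    proof -
      have "conv (frac_kernel 1) ?h = ml_kernel \<beta> (- a) (2 - \<gamma> + \<beta>)"
      proof (rule ext)
        fix x
        have e: "2 - \<gamma> + \<beta> = 1 + q" using q by simp
        show "conv (frac_kernel 1) ?h x = ml_kernel \<beta> (- a) (2 - \<gamma> + \<beta>) x"
          unfolding e by (rule conv_frac_ml(1)) (use \<beta> \<gamma> q in auto)
      qed
      then show ?thesis unfolding eq conv_assoc[OF k(2) h f] by simp
    qed
    also have "conv (frac_kernel 1) (conv (frac_kernel (1 - \<gamma>)) f) s = conv (frac_kernel (2 - \<gamma>)) f s"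
    proof -
      have "conv (frac_kernel 1) (frac_kernel (1 - \<gamma>)) = frac_kernel (2 - \<gamma>)"
        using \<gamma> by (simp add: fun_eq_iff conv_frac_frac algebra_simps)
      then show ?thesis unfolding conv_assoc[OF k(2,3) f] by simp
    qed
    finally show ?thesis
      using resolvent_identity[OF \<beta>(1) _ f, of "2 - \<gamma>" a s] \<gamma> by simp
  qed
  then have "L t = 0" using t by (intro conv_frac_one_eq_0[OF L, of "t + 1"]) auto
  then show ?thesis by (simp add: L_def)
qed

text \<open>
  Extends a function on \<open>[0, T]\<close> by its boundary values. This makes a path out of a solution that is
  only known to be continuous on \<open>[0, T]\<close>.
\<close>

definition clamp :: "real \<Rightarrow> (real \<Rightarrow> real) \<Rightarrow> real \<Rightarrow> real" where
  "clamp T g x = g (max 0 (min x T))"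

lemma clamp_path:
  assumes "continuous_on {0..T} g" "g 0 = 0" "T > 0"
  shows "causal_path (clamp T g)"
proof -
  have "continuous_on UNIV (\<lambda>x. g (max 0 (min x T)))"
    by (intro continuous_on_compose2[OF assms(1)] continuous_intros) (use assms in auto)
  then show ?thesis using assms by (auto simp: causal_path_def clamp_def)
qed

lemma clamp_eq: "x \<in> {0..T} \<Longrightarrow> clamp T g x = g x"
  by (simp add: clamp_def)

lemma Lim_at_right_eq:
  fixes f :: "real \<Rightarrow> real"
  assumes "continuous_on {0..T} f" "T > 0"
  shows "Lim (at_right 0) f = f 0"
proof -
  have "(f \<longlongrightarrow> f 0) (at 0 within {0..T})"
    using assms by (auto simp: continuous_on_def)
  then have "(f \<longlongrightarrow> f 0) (at_right 0)"
    using assms by (simp add: at_within_Icc_at_right)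
  then show ?thesis by (intro tendsto_Lim) auto
qed

lemma fractional_equation_unique:
  assumes \<beta>: "0 < \<beta>" "\<beta> < 1" and T: "T > 0"
    and X: "continuous_on {0..T} X" and Y: "continuous_on {0..T} Y" and "X 0 = Y 0"
    and Xeq: "\<And>t. t \<in> {0..T} \<Longrightarrow> frac_int (1 - \<beta>) X t = - a * (LINT s:{0..t}|lebesgue. X s) + R t"
    and Yeq: "\<And>t. t \<in> {0..T} \<Longrightarrow> frac_int (1 - \<beta>) Y t = - a * (LINT s:{0..t}|lebesgue. Y s) + R t"
    and t: "t \<in> {0..T}"
  shows "Y t = X t"
proof -
  define DX where "DX = clamp T (\<lambda>s. X s - X 0)"
  define DY where "DY = clamp T (\<lambda>s. Y s - X 0)"
  have DX: "causal_path DX" unfolding DX_def using X T by (intro clamp_path continuous_intros) auto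
  have DY: "causal_path DY" unfolding DY_def using Y T \<open>X 0 = Y 0\<close> by (intro clamp_path continuous_intros) auto
  define D where "D t = 1 * DY t + (- 1) * DX t" for t
  have D: "causal_path D" unfolding D_def by (rule causal_path_lincomb[OF DY DX])
  have k: "causal_kernel (frac_kernel (1 - \<beta>))" "causal_kernel (frac_kernel 1)"
    using \<beta> by (auto intro: frac_kernel_causal)
  have eqD: "conv (frac_kernel (1 - \<beta>)) D t = - a * conv (frac_kernel 1) D t" if t: "t \<in> {0..T}" for t
  proof -
    have 1: "frac_int (1 - \<beta>) X t = conv (frac_kernel (1 - \<beta>)) DX t"
      using t Lim_at_right_eq[OF X T] causal_pathD[OF DX]
      by (intro frac_int_eq_conv) (auto simp: DX_def clamp_eq)
    have 2: "frac_int (1 - \<beta>) Y t = conv (frac_kernel (1 - \<beta>)) DY t"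
      using t Lim_at_right_eq[OF Y T] causal_pathD[OF DY] \<open>X 0 = Y 0\<close>
      by (intro frac_int_eq_conv) (auto simp: DY_def clamp_eq)
    have int: "(LINT s:{0..t}|lebesgue. Z s) = integral {0..t} Z" if "continuous_on {0..T} Z" for Z :: "real \<Rightarrow> real"
      using that t by (intro set_lebesgue_integral_eq_integral absolutely_integrable_continuous_real)
        (auto intro: continuous_on_subset)
    have "integral {0..t} D = integral {0..t} (\<lambda>s. Y s - X s)"
      using t by (intro integral_cong) (simp add: D_def DX_def DY_def clamp_eq)
    also have "\<dots> = integral {0..t} Y - integral {0..t} X"
      using t by (intro integral_diff integrable_continuous_real) (auto intro: continuous_on_subset X Y)
    finally have 3: "conv (frac_kernel 1) D t = (LINT s:{0..t}|lebesgue. Y s) - (LINT s:{0..t}|lebesgue. X s)"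
      using t conv_frac_one(1)[OF D, of t] by (simp add: int X Y)
    have 4: "conv (frac_kernel (1 - \<beta>)) D t = conv (frac_kernel (1 - \<beta>)) DY t - conv (frac_kernel (1 - \<beta>)) DX t"
      unfolding D_def[abs_def] using conv_lincomb_right[OF k(1) DY DX, of 1 "-1" t] by simp
    show ?thesis
      unfolding 3 4 1[symmetric] 2[symmetric] Xeq[OF t] Yeq[OF t] by (simp add: algebra_simps)
  qed
  have "D t = 0" by (rule fractional_homogeneous_unique[OF \<beta> D T eqD t])
  then show ?thesis using t by (simp add: D_def DX_def DY_def clamp_eq)
qed

definition frac_solution :: "real \<Rightarrow> real \<Rightarrow> real \<Rightarrow> real \<Rightarrow> (real \<Rightarrow> real) \<Rightarrow> real \<Rightarrow> real" where
  "frac_solution \<beta> q a X0 f t = X0 * mittag_leffler1 \<beta> (- a * t powr \<beta>) +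
     pathwise_integral (ml_kernel \<beta> (- a) q) (ml_kernel \<beta> (- a) (q - 1)) f t"

context
  fixes \<beta> \<gamma> a X0 q \<alpha> :: real and f :: "real \<Rightarrow> real"
  assumes \<beta>: "0 < \<beta>" "\<beta> < 1" and \<gamma>: "0 < \<gamma>" "\<gamma> < 1" and q: "q = 1 + \<beta> - \<gamma>"
    and \<alpha>: "\<alpha> > 0" "\<alpha> + q > 1" and f: "hoelder_path \<alpha> f"
begin

lemma ml_kernel_kernel_path:
  obtains C c K where "kernel_path (ml_kernel \<beta> (- a) q) (ml_kernel \<beta> (- a) (q - 1)) q C c f \<alpha> K"
proof -
  have "q > 0" using \<beta> \<gamma> q by auto
  then obtain C c where "singular_kernel (ml_kernel \<beta> (- a) q) (ml_kernel \<beta> (- a) (q - 1)) q C c"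
    using ml_kernel_singular[OF \<beta>(1)] by blast
  moreover obtain K where "K \<ge> 0" "\<And>s t. s \<le> t \<Longrightarrow> \<bar>f t - f s\<bar> \<le> K * exp (2 * t) * (t - s) powr \<alpha>"
    using hoelder_pathE[OF f] by blast
  ultimately have "kernel_path (ml_kernel \<beta> (- a) q) (ml_kernel \<beta> (- a) (q - 1)) q C c f \<alpha> K"
    using \<alpha> f by (auto simp: kernel_path_def kernel_path_axioms_def hoelder_path_def)
  then show thesis by (rule that)
qed

text \<open>
  The solution minus its initial value, extended by zero to negative times. By the recursion of the
  Mittag-Leffler function, \<open>E\<^sub>\<beta>(- a t\<^sup>\<beta>) - 1\<close> is itself a multiple of a kernel.
\<close>

definition frac_deviation :: "real \<Rightarrow> real" where
  "frac_deviation t = (- a * X0) * ml_kernel \<beta> (- a) (1 + \<beta>) t +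
     1 * pathwise_integral (ml_kernel \<beta> (- a) q) (ml_kernel \<beta> (- a) (q - 1)) f t"

lemma pathwise_integral_path: "causal_path (pathwise_integral (ml_kernel \<beta> (- a) q) (ml_kernel \<beta> (- a) (q - 1)) f)"
proof -
  obtain C c K where "kernel_path (ml_kernel \<beta> (- a) q) (ml_kernel \<beta> (- a) (q - 1)) q C c f \<alpha> K"
    by (rule ml_kernel_kernel_path)
  then show ?thesis by (rule kernel_path.wint_path)
qed

lemma frac_deviation_path: "causal_path frac_deviation"
  unfolding frac_deviation_def[abs_def] using \<beta>
  by (intro causal_path_lincomb pathwise_integral_path ml_kernel_path) auto

lemma frac_solution_eq:
  assumes "t \<ge> 0"
  shows "frac_solution \<beta> q a X0 f t = X0 + frac_deviation t"
proof -
  have "mittag_leffler1 \<beta> (- a * t powr \<beta>) =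
      1 + (- a * t powr \<beta>) * mittag_leffler \<beta> (1 + \<beta>) (- a * t powr \<beta>)"
    using \<beta> mittag_leffler_rec[of \<beta> 1 "- a * t powr \<beta>"] by (simp add: rGamma_inverse_Gamma)
  also have "\<dots> = 1 + - a * ml_kernel \<beta> (- a) (1 + \<beta>) t"
    using assms by (cases "t = 0") (auto simp: ml_kernel_def)
  finally have m: "mittag_leffler1 \<beta> (- a * t powr \<beta>) = 1 + - a * ml_kernel \<beta> (- a) (1 + \<beta>) t" .
  show ?thesis unfolding frac_solution_def frac_deviation_def m by (simp add: algebra_simps)
qed

lemma frac_solution_0: "frac_solution \<beta> q a X0 f 0 = X0"
  using frac_solution_eq[of 0] causal_pathD(3)[OF frac_deviation_path, of 0] by simp

lemma frac_solution_continuous: "continuous_on {0..} (frac_solution \<beta> q a X0 f)"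
proof -
  have "continuous_on {0..} (\<lambda>t. X0 + frac_deviation t)"
    by (intro continuous_intros causal_pathD(1) frac_deviation_path)
  then show ?thesis by (rule continuous_on_cong[THEN iffD1, rotated 2]) (auto simp: frac_solution_eq)
qed

lemma frac_solution_equation:
  assumes t: "t \<ge> 0" and g: "\<And>s. s \<ge> 0 \<Longrightarrow> g s = f s"
  shows "frac_int (1 - \<beta>) (frac_solution \<beta> q a X0 f) t =
    - a * (LINT s:{0..t}|lebesgue. frac_solution \<beta> q a X0 f s) + frac_int (1 - \<gamma>) g t"
proof -
  let ?X = "frac_solution \<beta> q a X0 f" and ?D = "frac_deviation"
    and ?P = "ml_kernel \<beta> (- a) (1 + \<beta>)" and ?V = "pathwise_integral (ml_kernel \<beta> (- a) q) (ml_kernel \<beta> (- a) (q - 1)) f"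
  have k: "causal_kernel (frac_kernel (1 - \<beta>))" "causal_kernel (frac_kernel 1)"
    using \<beta> by (auto intro: frac_kernel_causal)
  have P: "causal_path ?P" using \<beta> by (intro ml_kernel_path) auto
  have f_path: "causal_path f" using hoelder_path_causal[OF f \<alpha>(1)] .
  have X1: "continuous_on {0..1} ?X" using frac_solution_continuous by (rule continuous_on_subset) auto
  have frX: "frac_int (1 - \<beta>) ?X t = conv (frac_kernel (1 - \<beta>)) ?D t"
    using causal_pathD[OF frac_deviation_path] Lim_at_right_eq[OF X1]
    by (intro frac_int_eq_conv) (auto simp: frac_solution_eq frac_solution_0)
  have "continuous_on {0..1} g"
    by (rule continuous_on_cong[THEN iffD1, OF refl _ causal_pathD(1)[OF f_path]]) (auto simp: g)
  then have frg: "frac_int (1 - \<gamma>) g t = conv (frac_kernel (1 - \<gamma>)) f t"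
    using causal_pathD[OF f_path] Lim_at_right_eq[of 1 g]
    by (intro frac_int_eq_conv) (auto simp: g)
  have "(LINT s:{0..t}|lebesgue. ?X s) = integral {0..t} ?X"
    using frac_solution_continuous
    by (intro set_lebesgue_integral_eq_integral absolutely_integrable_continuous_real)
      (auto intro: continuous_on_subset)
  also have "\<dots> = integral {0..t} (\<lambda>s. X0 + ?D s)"
    by (intro integral_cong) (simp add: frac_solution_eq)
  also have "\<dots> = X0 * t + integral {0..t} ?D"
    using t by (subst Henstock_Kurzweil_Integration.integral_add)
      (auto intro!: integrable_continuous_real continuous_on_const causal_pathD(1)[OF frac_deviation_path])
  also have "\<dots> = X0 * frac_kernel 2 t + conv (frac_kernel 1) ?D t"
    using conv_frac_one(1)[OF frac_deviation_path t] t by (simp add: frac_kernel_def Gamma_numeral)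
  finally have intX: "(LINT s:{0..t}|lebesgue. ?X s) = X0 * frac_kernel 2 t + conv (frac_kernel 1) ?D t" .
  have D: "conv k ?D t = - a * X0 * conv k ?P t + conv k ?V t" if "causal_kernel k" for k
    unfolding frac_deviation_def[abs_def] using conv_lincomb_right[OF that P pathwise_integral_path, of "- a * X0" 1 t] by simp
  obtain C c K where "kernel_path (ml_kernel \<beta> (- a) q) (ml_kernel \<beta> (- a) (q - 1)) q C c f \<alpha> K"
    by (rule ml_kernel_kernel_path)
  then have "conv (frac_kernel 1) ?V = conv (ml_kernel \<beta> (- a) q) f"
    by (intro ext kernel_path.conv_one_wint)
  then have V: "conv (frac_kernel (1 - \<beta>)) ?V t + a * conv (frac_kernel 1) ?V t = conv (frac_kernel (1 - \<gamma>)) f t"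
    by (intro fractional_inhomogeneous[OF \<beta> \<gamma> q pathwise_integral_path f_path _ t])
  then have V: "conv (frac_kernel (1 - \<beta>)) ?V t = conv (frac_kernel (1 - \<gamma>)) f t - a * conv (frac_kernel 1) ?V t"
    by simp
  have P': "conv (frac_kernel (1 - \<beta>)) ?P t = ml_kernel \<beta> (- a) 2 t"
    "conv (frac_kernel 1) ?P t = ml_kernel \<beta> (- a) (2 + \<beta>) t"
    using \<beta> by (simp_all add: conv_frac_ml(1))
  have N: "ml_kernel \<beta> (- a) 2 t = frac_kernel 2 t + - a * ml_kernel \<beta> (- a) (2 + \<beta>) t"
    using \<beta> by (intro ml_kernel_rec) auto
  show ?thesis
    unfolding frX frg intX D[OF k(1)] D[OF k(2)] P' N V by (simp add: algebra_simps)
qed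

lemma frac_solution_class_E: "frac_solution \<beta> q a X0 f \<in> class_E"
proof -
  obtain C c K where "kernel_path (ml_kernel \<beta> (- a) q) (ml_kernel \<beta> (- a) (q - 1)) q C c f \<alpha> K"
    by (rule ml_kernel_kernel_path)
  then obtain D d where D: "\<And>t. t > 0 \<Longrightarrow>
      \<bar>pathwise_integral (ml_kernel \<beta> (- a) q) (ml_kernel \<beta> (- a) (q - 1)) f t\<bar> \<le> D * exp (d * t)"
    using kernel_path.wint_growth by blast
  obtain C1 c1 where C1: "C1 \<ge> 0" "c1 \<ge> 0"
    "\<And>u. u \<ge> 0 \<Longrightarrow> \<bar>mittag_leffler \<beta> 1 ((- a) * u powr \<beta>)\<bar> \<le> C1 * exp (c1 * u)"
    using mittag_leffler_exp_bound[of \<beta> 1 "- a"] \<beta> by auto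
  define e where "e = max c1 d"
  have "\<bar>frac_solution \<beta> q a X0 f t\<bar> * exp (- e * t) \<le> \<bar>X0\<bar> * C1 + \<bar>D\<bar>" if t: "t > 0" for t
  proof -
    have "\<bar>X0 * mittag_leffler1 \<beta> (- a * t powr \<beta>)\<bar> \<le> \<bar>X0\<bar> * (C1 * exp (e * t))"
    proof -
      have "\<bar>mittag_leffler1 \<beta> (- a * t powr \<beta>)\<bar> \<le> C1 * exp (c1 * t)" using C1(3)[of t] t by simp
      also have "\<dots> \<le> C1 * exp (e * t)" using C1(1) t by (intro mult_left_mono) (auto simp: e_def)
      finally show ?thesis unfolding abs_mult by (intro mult_left_mono) auto
    qed
    moreover have "D * exp (d * t) \<le> \<bar>D\<bar> * exp (e * t)"
      using t by (intro mult_mono) (auto simp: e_def)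
    ultimately have "\<bar>frac_solution \<beta> q a X0 f t\<bar> \<le> (\<bar>X0\<bar> * C1 + \<bar>D\<bar>) * exp (e * t)"
      using D[OF t] unfolding frac_solution_def by (simp add: algebra_simps)
    then have "\<bar>frac_solution \<beta> q a X0 f t\<bar> * exp (- e * t) \<le> (\<bar>X0\<bar> * C1 + \<bar>D\<bar>) * exp (e * t) * exp (- e * t)"
      by (intro mult_right_mono) auto
    then show ?thesis by (simp add: mult.assoc flip: exp_add)
  qed
  then have "bdd_above ((\<lambda>t. \<bar>frac_solution \<beta> q a X0 f t\<bar> * exp (- e * t)) ` {0<..})"
    by (intro bdd_aboveI[of _ "\<bar>X0\<bar> * C1 + \<bar>D\<bar>"]) auto
  moreover have "frac_solution \<beta> q a X0 f absolutely_integrable_on K" if "compact K" "K \<subseteq> {0<..}" for K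
  proof -
    have cont: "continuous_on K (frac_solution \<beta> q a X0 f)"
      using that by (intro continuous_on_subset[OF frac_solution_continuous]) auto
    have "integrable lborel (\<lambda>x. indicator K x *\<^sub>R frac_solution \<beta> q a X0 f x)"
      by (rule borel_integrable_compact[OF that(1) cont])
    then show ?thesis
      unfolding set_integrable_def
      by (subst integrable_completion) (auto dest: borel_measurable_integrable)
  qed
  ultimately show ?thesis unfolding class_E_def by blast
qed

end

section \<open>Hoelder continuity and growth of Brownian paths\<close>

definition dyadic_floor :: "nat \<Rightarrow> real \<Rightarrow> nat" where
  "dyadic_floor n t = nat \<lfloor>2 ^ n * t\<rfloor>"

lemma dyadic_floor_bounds:
  assumes "t \<ge> 0"
  shows "real (dyadic_floor n t) / 2 ^ n \<le> t" "2 ^ n * t < real (dyadic_floor n t) + 1" "real (dyadic_floor n t) \<le> 2 ^ n * t"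
proof -
  have "real (dyadic_floor n t) = of_int \<lfloor>2 ^ n * t\<rfloor>" using assms by (simp add: dyadic_floor_def)
  then show "real (dyadic_floor n t) \<le> 2 ^ n * t" "2 ^ n * t < real (dyadic_floor n t) + 1" by linarith+
  then show "real (dyadic_floor n t) / 2 ^ n \<le> t" by (simp add: field_simps)
qed

context
  fixes g :: "real \<Rightarrow> real" and \<alpha> L :: real
  assumes cont: "continuous_on {0..} g" and \<alpha>: "\<alpha> > 0" and L: "L \<ge> 0"
    and dyadic: "\<And>n j. \<bar>g (real (Suc j) / 2 ^ n) - g (real j / 2 ^ n)\<bar> \<le> L * exp (real j / 2 ^ n) * (2 powr (- \<alpha>)) ^ n"
begin

lemma dyadic_step:
  assumes "t \<ge> 0" "real j / 2 ^ n \<le> t" "i = j \<or> i = Suc j"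
  shows "\<bar>g (real i / 2 ^ n) - g (real j / 2 ^ n)\<bar> \<le> L * exp t * (2 powr (- \<alpha>)) ^ n"
proof -
  have "L * exp (real j / 2 ^ n) * (2 powr (- \<alpha>)) ^ n \<le> L * exp t * (2 powr (- \<alpha>)) ^ n"
    using assms L by (intro mult_right_mono mult_left_mono) auto
  with dyadic[of j n] L assms(3) show ?thesis by auto
qed

text \<open>
  Passing to the next dyadic level moves the approximation of \<open>t\<close> by at most one dyadic step; the
  resulting increments form a geometric series, summed here in telescoping form.
\<close>

lemma dyadic_refine:
  assumes t: "t \<ge> 0"
  shows "\<bar>g (real (dyadic_floor (n + m) t) / 2 ^ (n + m)) - g (real (dyadic_floor n t) / 2 ^ n)\<bar> \<le>
    L / (1 - 2 powr (- \<alpha>)) * exp t * ((2 powr (- \<alpha>)) ^ n - (2 powr (- \<alpha>)) ^ (n + m))"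
proof (induction m)
  case (Suc m)
  define \<rho> :: real where "\<rho> = 2 powr (- \<alpha>)"
  have \<rho>: "0 < \<rho>" "\<rho> < 1" using \<alpha> powr_less_mono[of "- \<alpha>" 0 2] by (auto simp: \<rho>_def)
  define k where "k = n + m"
  have "dyadic_floor (Suc k) t = 2 * dyadic_floor k t \<or> dyadic_floor (Suc k) t = Suc (2 * dyadic_floor k t)"
    using dyadic_floor_bounds[OF t, of k] dyadic_floor_bounds[OF t, of "Suc k"] by auto
  moreover have "real (2 * dyadic_floor k t) / 2 ^ Suc k \<le> t" using dyadic_floor_bounds(1)[OF t, of k] by simp
  ultimately have "\<bar>g (real (dyadic_floor (Suc k) t) / 2 ^ Suc k) - g (real (2 * dyadic_floor k t) / 2 ^ Suc k)\<bar> \<le> L * exp t * \<rho> ^ Suc k"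
    unfolding \<rho>_def by (intro dyadic_step t)
  also have "L * exp t * \<rho> ^ Suc k \<le> L * exp t * \<rho> ^ k"
    using L \<rho> by (intro mult_left_mono power_decreasing) auto
  also have "\<dots> = L / (1 - \<rho>) * exp t * (\<rho> ^ k - \<rho> ^ Suc k)"
    using \<rho> by (simp add: field_simps)
  finally have "\<bar>g (real (dyadic_floor (Suc k) t) / 2 ^ Suc k) - g (real (dyadic_floor k t) / 2 ^ k)\<bar> \<le>
      L / (1 - \<rho>) * exp t * (\<rho> ^ k - \<rho> ^ Suc k)" by simp
  with Suc.IH have "\<bar>g (real (dyadic_floor (Suc k) t) / 2 ^ Suc k) - g (real (dyadic_floor n t) / 2 ^ n)\<bar> \<le>
      L / (1 - \<rho>) * exp t * (\<rho> ^ k - \<rho> ^ Suc k) + L / (1 - \<rho>) * exp t * (\<rho> ^ n - \<rho> ^ k)"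
    unfolding k_def[symmetric] \<rho>_def[symmetric] by linarith
  then show ?case unfolding k_def[symmetric] \<rho>_def[symmetric] add_Suc_right right_diff_distrib by linarith
qed simp

lemma dyadic_approx:
  assumes t: "t \<ge> 0"
  shows "\<bar>g t - g (real (dyadic_floor n t) / 2 ^ n)\<bar> \<le> L / (1 - 2 powr (- \<alpha>)) * exp t * (2 powr (- \<alpha>)) ^ n"
proof -
  have \<rho>: "2 powr (- \<alpha>) < (1::real)" using \<alpha> powr_less_mono[of "- \<alpha>" 0 2] by auto
  have "(\<lambda>m. real (dyadic_floor m t) / 2 ^ m) \<longlonglongrightarrow> t"
  proof (rule real_tendsto_sandwich[OF _ _ _ tendsto_const[of t]])
    show "\<forall>\<^sub>F m in sequentially. t - (1/2) ^ m \<le> real (dyadic_floor m t) / 2 ^ m"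
    proof (rule always_eventually, rule allI)
      fix m
      show "t - (1/2) ^ m \<le> real (dyadic_floor m t) / 2 ^ m"
      proof -
        have "t < (real (dyadic_floor m t) + 1) / 2 ^ m" using dyadic_floor_bounds(2)[OF t, of m] by (simp add: field_simps)
        then show ?thesis by (simp add: add_divide_distrib power_divide)
      qed
    qed
    show "\<forall>\<^sub>F m in sequentially. real (dyadic_floor m t) / 2 ^ m \<le> t"
      by (rule always_eventually, rule allI, rule dyadic_floor_bounds(1)[OF t])
    have "(\<lambda>m. t - (1/2::real) ^ m) \<longlonglongrightarrow> t - 0"
      by (intro tendsto_diff tendsto_const LIMSEQ_power_zero) auto
    then show "(\<lambda>m. t - (1/2) ^ m) \<longlonglongrightarrow> t" by simp
  qed
  then have "(\<lambda>m. g (real (dyadic_floor m t) / 2 ^ m)) \<longlonglongrightarrow> g t"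
    using continuous_on_tendsto_compose[OF cont, of "\<lambda>m. real (dyadic_floor m t) / 2 ^ m" t sequentially] t by simp
  then have "(\<lambda>m. g (real (dyadic_floor (m + n) t) / 2 ^ (m + n))) \<longlonglongrightarrow> g t"
    by (rule LIMSEQ_ignore_initial_segment)
  then have "(\<lambda>m. \<bar>g (real (dyadic_floor (m + n) t) / 2 ^ (m + n)) - g (real (dyadic_floor n t) / 2 ^ n)\<bar>) \<longlonglongrightarrow>
      \<bar>g t - g (real (dyadic_floor n t) / 2 ^ n)\<bar>"
    by (intro tendsto_rabs tendsto_diff tendsto_const)
  then show ?thesis
  proof (rule LIMSEQ_le_const2, intro exI allI impI)
    fix m :: nat
    have "L / (1 - 2 powr (- \<alpha>)) * exp t * ((2 powr (- \<alpha>)) ^ n - (2 powr (- \<alpha>)) ^ (n + m)) \<le>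
        L / (1 - 2 powr (- \<alpha>)) * exp t * (2 powr (- \<alpha>)) ^ n"
      using L \<rho> by (intro mult_left_mono) auto
    with dyadic_refine[OF t, of n m]
    show "\<bar>g (real (dyadic_floor (m + n) t) / 2 ^ (m + n)) - g (real (dyadic_floor n t) / 2 ^ n)\<bar> \<le>
        L / (1 - 2 powr (- \<alpha>)) * exp t * (2 powr (- \<alpha>)) ^ n"
      by (simp add: add.commute[of m n])
  qed
qed

text \<open>
  For \<open>t - s \<le> 2\<^sup>-\<^sup>n\<close> the level \<open>n\<close> approximations of \<open>s\<close> and \<open>t\<close> are equal or adjacent. Larger
  distances are covered by unit steps, whose number is absorbed by doubling the exponent of the weight.
\<close>

lemma hoelder_of_dyadic:
  obtains K where "K \<ge> 0"
    "\<And>s t. 0 \<le> s \<Longrightarrow> s \<le> t \<Longrightarrow> \<bar>g t - g s\<bar> \<le> K * exp (2 * t) * (t - s) powr \<alpha>"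
proof -
  define \<rho> :: real where "\<rho> = 2 powr (- \<alpha>)"
  have \<rho>: "0 < \<rho>" "\<rho> < 1" using \<alpha> powr_less_mono[of "- \<alpha>" 0 2] by (auto simp: \<rho>_def)
  define A where "A = L / (1 - \<rho>)"
  define B where "B = 2 * A + L"
  have A: "A \<ge> 0" using L \<rho> by (simp add: A_def)
  have B: "B \<ge> 0" using A L by (simp add: B_def)
  have short: "\<bar>g t - g s\<bar> \<le> B * exp t * \<rho> ^ n" if st: "0 \<le> s" "s \<le> t" "t - s \<le> 1 / 2 ^ n" for s t n
  proof -
    have t: "t \<ge> 0" using st by simp
    have "2 ^ n * (t - s) \<le> 1" using st by (simp add: field_simps)
    then have "2 ^ n * t \<le> 2 ^ n * s + 1" by (simp add: algebra_simps)
    moreover have "2 ^ n * s \<le> 2 ^ n * t" using st by simp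
    ultimately have "dyadic_floor n t = dyadic_floor n s \<or> dyadic_floor n t = Suc (dyadic_floor n s)"
      using dyadic_floor_bounds(2,3)[OF t, of n] dyadic_floor_bounds(2,3)[OF st(1), of n] by linarith
    then have "\<bar>g (real (dyadic_floor n t) / 2 ^ n) - g (real (dyadic_floor n s) / 2 ^ n)\<bar> \<le> L * exp s * \<rho> ^ n"
      unfolding \<rho>_def by (intro dyadic_step st dyadic_floor_bounds(1))
    moreover have "L * exp s * \<rho> ^ n \<le> L * exp t * \<rho> ^ n"
      using L st \<rho> by (intro mult_right_mono mult_left_mono) auto
    moreover have "\<bar>g t - g (real (dyadic_floor n t) / 2 ^ n)\<bar> \<le> A * exp t * \<rho> ^ n"
      unfolding A_def \<rho>_def by (rule dyadic_approx[OF t])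
    moreover have "\<bar>g s - g (real (dyadic_floor n s) / 2 ^ n)\<bar> \<le> A * exp s * \<rho> ^ n"
      unfolding A_def \<rho>_def by (rule dyadic_approx[OF st(1)])
    moreover have "A * exp s * \<rho> ^ n \<le> A * exp t * \<rho> ^ n"
      using A st \<rho> by (intro mult_right_mono mult_left_mono) auto
    moreover have "B * exp t * \<rho> ^ n = A * exp t * \<rho> ^ n + A * exp t * \<rho> ^ n + L * exp t * \<rho> ^ n"
      by (simp add: B_def algebra_simps)
    ultimately show ?thesis by linarith
  qed
  have long: "\<bar>g t - g s\<bar> \<le> real N * (B * exp t)" if "0 \<le> s" "s \<le> t" "t - s \<le> real N" for s t N
    using that
  proof (induction N arbitrary: t)
    case (Suc N)
    \<comment> \<open>One step of length at most one back from \<open>t\<close>.\<close>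
    define r where "r = max s (t - 1)"
    have r: "0 \<le> r" "s \<le> r" "r \<le> t" "r - s \<le> real N" "t - r \<le> 1"
      using Suc.prems by (auto simp: r_def max_def)
    have "\<bar>g r - g s\<bar> \<le> real N * (B * exp r)" using Suc.prems r by (intro Suc.IH) auto
    also have "\<dots> \<le> real N * (B * exp t)" using r B by (intro mult_left_mono) auto
    finally have "\<bar>g r - g s\<bar> \<le> real N * (B * exp t)" .
    moreover have "\<bar>g t - g r\<bar> \<le> B * exp t" using short[of r t 0] r by simp
    ultimately show ?case by (simp add: algebra_simps)
  qed simp
  show thesis
  proof
    show "B / \<rho> \<ge> 0" using B \<rho> by simp
    fix s t :: real assume st: "0 \<le> s" "s \<le> t"
    have B\<rho>: "B \<le> B / \<rho>" using B \<rho> by (simp add: field_simps mult_left_le)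
    have exp2: "exp t \<le> exp (2 * t)" using st by simp
    consider "s = t" | "0 < t - s" "t - s \<le> 1" | "t - s > 1" using st by linarith
    then show "\<bar>g t - g s\<bar> \<le> B / \<rho> * exp (2 * t) * (t - s) powr \<alpha>"
    proof cases
      case 1
      then show ?thesis by simp
    next
      case 2
      define d where "d = t - s"
      have d: "0 < d" "d \<le> 1" using 2 by (auto simp: d_def)
      obtain m0 where m0: "(1/2::real) ^ m0 < d" using real_arch_pow_inv[OF d(1), of "1/2"] by auto
      define m where "m = (LEAST m. (1/2::real) ^ m < d)"
      have m: "(1/2::real) ^ m < d" unfolding m_def using m0 by (rule LeastI)
      have "m \<noteq> 0" using m d by (cases m) auto
      then obtain n where n: "m = Suc n" by (cases m) auto
      have "\<not> (1/2::real) ^ n < d" using not_less_Least[of n "\<lambda>m. (1/2::real) ^ m < d"] n by (simp add: m_def)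
      then have "t - s \<le> 1 / 2 ^ n" by (simp add: d_def power_divide)
      then have "\<bar>g t - g s\<bar> \<le> B * exp t * \<rho> ^ n" using st by (intro short) auto
      also have "\<rho> ^ m \<le> d powr \<alpha>"
      proof -
        have "\<rho> ^ m = ((1/2::real) ^ m) powr \<alpha>"
          by (simp add: \<rho>_def powr_minus powr_divide power_divide powr_power powr_powr mult.commute field_simps flip: powr_realpow)
        also have "\<dots> \<le> d powr \<alpha>" using m \<alpha> by (intro powr_mono2) auto
        finally show ?thesis .
      qed
      then have "\<rho> ^ n \<le> d powr \<alpha> / \<rho>" using \<rho> by (simp add: n field_simps)
      then have "B * exp t * \<rho> ^ n \<le> B * exp (2 * t) * (d powr \<alpha> / \<rho>)"
        using B exp2 \<rho> by (intro mult_mono) auto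
      finally show ?thesis by (simp add: d_def)
    next
      case 3
      define N where "N = nat \<lceil>t - s\<rceil>"
      have N: "t - s \<le> real N" "real N \<le> t - s + 1" using 3 unfolding N_def by linarith+
      have "\<bar>g t - g s\<bar> \<le> real N * (B * exp t)" by (rule long[OF st N(1)])
      also have "real N \<le> exp t" using N(2) st exp_ge_add_one_self[of t] by linarith
      then have "real N * (B * exp t) \<le> exp t * (B * exp t)" using B by (intro mult_right_mono) auto
      also have "\<dots> = B * exp (2 * t) * 1" by (simp add: exp_double power2_eq_square)
      also have "\<dots> \<le> B / \<rho> * exp (2 * t) * (t - s) powr \<alpha>"
        using 3 \<alpha> B B\<rho> \<rho> by (intro mult_mono ge_one_powr_ge_zero) auto
      finally show ?thesis .
    qed
  qed
qed

end

context
  fixes M :: "'a measure" and w :: "real \<Rightarrow> 'a \<Rightarrow> real"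
  assumes bm: "standard_brownian_motion M w"
begin

lemma bm_measurable: "t \<ge> 0 \<Longrightarrow> w t \<in> borel_measurable M"
  using bm by (simp add: standard_brownian_motion_def)

lemma bm_increment_moment:
  assumes st: "0 \<le> s" "s < t"
  shows "(\<integral>\<^sup>+\<omega>. ennreal ((w t \<omega> - w s \<omega>) ^ (2 * k)) \<partial>M) =
    ennreal (fact (2 * k) / (2 ^ k * fact k) * (t - s) ^ k)"
proof -
  define \<sigma> where "\<sigma> = sqrt (t - s)"
  have \<sigma>: "\<sigma> > 0" "\<sigma>\<^sup>2 = t - s" using st by (auto simp: \<sigma>_def)
  have D: "distributed M lborel (\<lambda>\<omega>. w t \<omega> - w s \<omega>) (normal_density 0 \<sigma>)"
    using bm st by (simp add: standard_brownian_motion_def \<sigma>_def)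
  have "(\<integral>\<^sup>+\<omega>. ennreal ((w t \<omega> - w s \<omega>) ^ (2 * k)) \<partial>M) =
      (\<integral>\<^sup>+x. ennreal (normal_density 0 \<sigma> x) * ennreal (x ^ (2 * k)) \<partial>lborel)"
    by (rule distributed_nn_integral[OF D, symmetric]) auto
  also have "\<dots> = (\<integral>\<^sup>+x. ennreal (normal_density 0 \<sigma> x * (x - 0) ^ (2 * k)) \<partial>lborel)"
    by (intro nn_integral_cong) (simp add: ennreal_mult')
  also have "\<dots> = ennreal (fact (2 * k) / ((2 / \<sigma>\<^sup>2)^k * fact k))"
    using normal_moment_even[OF \<sigma>(1), of 0 k]
    by (intro nn_integral_eq_integral[THEN trans]) (auto simp: has_bochner_integral_iff)
  also have "fact (2 * k) / ((2 / \<sigma>\<^sup>2)^k * fact k) = fact (2 * k) / (2 ^ k * fact k) * (t - s) ^ k"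
    using \<sigma> st by (simp add: power_divide)
  finally show ?thesis .
qed

text \<open>
  Sum the \<open>2k\<close>-th powers of all dyadic increments with weights \<open>W\<close> that grow like \<open>2\<^sup>n\<^sup>(\<^sup>k\<^sup>-\<^sup>1\<^sup>)\<close> in
  the level \<open>n\<close> and decay like \<open>(1 + j)\<^sup>-\<^sup>2\<close> in the position \<open>j\<close>. The sum has finite expectation, so it
  is almost surely finite, and then it bounds every single increment simultaneously. The position weight
  costs a factor \<open>4\<^sup>n\<close> and the exponential of time, so that every order \<open>\<alpha> \<le> (k - 3) / (2k)\<close> is
  reached; this is the choice of \<open>k\<close>.
\<close>

lemma bm_dyadic_bound:
  assumes "\<alpha> < 1/2"
  shows "AE \<omega> in M. \<exists>L\<ge>0. \<forall>n j. \<bar>w (real (Suc j) / 2 ^ n) \<omega> - w (real j / 2 ^ n) \<omega>\<bar> \<le>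
    L * exp (real j / 2 ^ n) * (2 powr (- \<alpha>)) ^ n"
proof -
  define k where "k = nat \<lceil>3 / (1 - 2 * \<alpha>)\<rceil>"
  have "3 / (1 - 2 * \<alpha>) \<le> real k" unfolding k_def by (rule real_nat_ceiling_ge)
  then have k: "3 \<le> real k * (1 - 2 * \<alpha>)" using assms by (simp add: field_simps)
  have k1: "k \<ge> 1" using k by (cases k) auto
  define Ck :: real where "Ck = fact (2 * k) / (2 ^ k * fact k)"
  define \<Delta> where "\<Delta> n j \<omega> = w (real (Suc j) / 2 ^ n) \<omega> - w (real j / 2 ^ n) \<omega>" for n j \<omega>
  have [measurable]: "\<Delta> n j \<in> borel_measurable M" for n j
    unfolding \<Delta>_def by (intro borel_measurable_diff bm_measurable) auto
  define W :: "nat \<Rightarrow> nat \<Rightarrow> real" where "W n j = inverse (real (Suc j) ^ 2) * 2 ^ (n * (k - 1))" for n j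
  have W: "W n j > 0" for n j by (simp add: W_def)
  define S where "S \<omega> = (\<Sum>n. \<Sum>j. ennreal (W n j * \<Delta> n j \<omega> ^ (2 * k)))" for \<omega>
  have [measurable]: "S \<in> borel_measurable M" unfolding S_def by measurable
  have term_int: "(\<integral>\<^sup>+\<omega>. ennreal (W n j * \<Delta> n j \<omega> ^ (2 * k)) \<partial>M) =
      ennreal (Ck * (1/2) ^ n * inverse (real (Suc j) ^ 2))" for n j
  proof -
    have lt: "real j / 2 ^ n < real (Suc j) / 2 ^ n" by (simp add: divide_strict_right_mono)
    have "(\<integral>\<^sup>+\<omega>. ennreal (W n j * \<Delta> n j \<omega> ^ (2 * k)) \<partial>M) =
        ennreal (W n j) * (\<integral>\<^sup>+\<omega>. ennreal (\<Delta> n j \<omega> ^ (2 * k)) \<partial>M)"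
      using W[of n j] by (subst nn_integral_cmult[symmetric]) (auto simp: ennreal_mult' less_imp_le)
    also have "\<dots> = ennreal (W n j) * ennreal (Ck * (1 / 2 ^ n) ^ k)"
      unfolding \<Delta>_def Ck_def using bm_increment_moment[OF _ lt, of k]
      by (simp add: diff_divide_distrib[symmetric])
    also have "\<dots> = ennreal (W n j * (Ck * (1 / 2 ^ n) ^ k))"
      using W[of n j] by (intro ennreal_mult'[symmetric]) simp
    also have "W n j * (Ck * (1 / 2 ^ n) ^ k) = Ck * (1/2) ^ n * inverse (real (Suc j) ^ 2)"
    proof -
      have "(2::real) ^ (n * (k - 1)) * 2 ^ n = 2 ^ (n * k)"
        using k1 by (cases k) (simp_all add: power_add[symmetric] algebra_simps)
      then have "(2::real) ^ (n * (k - 1)) * (1 / 2 ^ n) ^ k = (1/2) ^ n"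
        by (simp add: power_divide power_mult[symmetric] field_simps)
      then show ?thesis unfolding W_def by (simp add: mult_ac)
    qed
    finally show ?thesis .
  qed
  have Ck: "Ck \<ge> 0" by (simp add: Ck_def)
  have sum_j: "summable (\<lambda>j. inverse (real (Suc j) ^ 2))"
    using inverse_power_summable[of 2, where ?'a=real] by (subst summable_Suc_iff) auto
  define J where "J = (\<Sum>j. inverse (real (Suc j) ^ 2))"
  have J: "J \<ge> 0" unfolding J_def by (intro suminf_nonneg sum_j) auto
  have "(\<integral>\<^sup>+\<omega>. S \<omega> \<partial>M) = (\<Sum>n. \<Sum>j. ennreal (Ck * (1/2) ^ n * inverse (real (Suc j) ^ 2)))"
    unfolding S_def by (simp add: nn_integral_suminf term_int)
  also have "\<dots> = (\<Sum>n. ennreal (Ck * (1/2) ^ n * J))"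
  proof (intro suminf_cong)
    fix n
    have "(\<Sum>j. ennreal (Ck * (1/2) ^ n * inverse (real (Suc j) ^ 2))) =
        ennreal (\<Sum>j. Ck * (1/2) ^ n * inverse (real (Suc j) ^ 2))"
      using Ck by (intro suminf_ennreal2 summable_mult sum_j) auto
    also have "(\<Sum>j. Ck * (1/2) ^ n * inverse (real (Suc j) ^ 2)) = Ck * (1/2) ^ n * J"
      unfolding J_def by (rule suminf_mult[OF sum_j])
    finally show "(\<Sum>j. ennreal (Ck * (1/2) ^ n * inverse (real (Suc j) ^ 2))) = ennreal (Ck * (1/2) ^ n * J)" .
  qed
  also have "\<dots> = ennreal (\<Sum>n. Ck * (1/2) ^ n * J)"
    using Ck J by (intro suminf_ennreal2 summable_mult2 summable_mult summable_geometric) auto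
  finally have "(\<integral>\<^sup>+\<omega>. S \<omega> \<partial>M) \<noteq> \<infinity>" by simp
  then have "AE \<omega> in M. S \<omega> \<noteq> \<infinity>" by (intro nn_integral_PInf_AE) auto
  then show ?thesis
  proof eventually_elim
    case (elim \<omega>)
    then obtain K where K: "S \<omega> = ennreal K" "K \<ge> 0" by (cases "S \<omega>") auto
    have term_le: "W n j * \<Delta> n j \<omega> ^ (2 * k) \<le> K" for n j
    proof -
      have "ennreal (W n j * \<Delta> n j \<omega> ^ (2 * k)) \<le> (\<Sum>j. ennreal (W n j * \<Delta> n j \<omega> ^ (2 * k)))"
        using sum_le_suminf[of "\<lambda>j. ennreal (W n j * \<Delta> n j \<omega> ^ (2 * k))" "{j}"] by simp
      also have "\<dots> \<le> S \<omega>"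
        unfolding S_def using sum_le_suminf[of "\<lambda>n. \<Sum>j. ennreal (W n j * \<Delta> n j \<omega> ^ (2 * k))" "{n}"] by simp
      finally show ?thesis using K by simp
    qed
    define L where "L = max 1 K"
    have "\<bar>\<Delta> n j \<omega>\<bar> \<le> L * exp (real j / 2 ^ n) * (2 powr (- \<alpha>)) ^ n" for n j
    proof -
      define \<tau> where "\<tau> = real j / 2 ^ n"
      have \<tau>: "\<tau> \<ge> 0" by (simp add: \<tau>_def)
      have "real (Suc j) \<le> 2 ^ n * (1 + \<tau>)" by (simp add: \<tau>_def algebra_simps)
      also have "\<dots> \<le> 2 ^ n * exp \<tau>" using exp_ge_add_one_self[of \<tau>] by (intro mult_left_mono) auto
      finally have sj: "real (Suc j) ^ 2 \<le> (2 ^ n * exp \<tau>) ^ 2" by (intro power_mono) auto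
      have "\<bar>\<Delta> n j \<omega>\<bar> ^ (2 * k) = \<Delta> n j \<omega> ^ (2 * k)" by (simp add: power_mult)
      also have "\<dots> \<le> K / W n j" using term_le[of n j] W[of n j] by (simp add: field_simps)
      also have "\<dots> = K * real (Suc j) ^ 2 * (1/2) ^ (n * (k - 1))"
        by (simp add: W_def field_simps power_divide)
      also have "\<dots> \<le> K * (2 ^ n * exp \<tau>) ^ 2 * (1/2) ^ (n * (k - 1))"
        using K sj by (intro mult_right_mono mult_left_mono) auto
      also have "\<dots> = K * exp \<tau> ^ 2 * (2 powr (2 * real n) * 2 powr (- (real n * real (k - 1))))"
      proof -
        have "(1/2::real) ^ (n * (k - 1)) = 2 powr (- (real n * real (k - 1)))"
          using powr_realpow[of 2 "n * (k - 1)"] by (simp add: powr_minus power_one_over inverse_eq_divide)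
        moreover have "((2::real) ^ n) ^ 2 = 2 powr (2 * real n)"
          using powr_realpow[of 2 "2 * n"] power_mult[of "2::real" n 2] by (simp add: mult.commute)
        ultimately show ?thesis by (simp add: power_mult_distrib)
      qed
      also have "2 powr (2 * real n) * 2 powr (- (real n * real (k - 1))) = 2 powr (- (real n * (real k - 3)))"
        using k1 by (subst powr_add[symmetric]) (simp add: of_nat_diff algebra_simps)
      also have "\<dots> \<le> 2 powr (- (\<alpha> * real n * (2 * real k)))"
      proof -
        have "real n * (2 * \<alpha> * real k) \<le> real n * (real k - 3)"
          using k by (intro mult_left_mono) (auto simp: algebra_simps)
        then show ?thesis by (intro powr_mono) (auto simp: mult_ac)
      qed
      also have "\<dots> = ((2 powr (- \<alpha>)) ^ n) ^ (2 * k)"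
        by (simp add: powr_power algebra_simps)
      also have "K * exp \<tau> ^ 2 * ((2 powr (- \<alpha>)) ^ n) ^ (2 * k) \<le>
          L ^ (2 * k) * exp \<tau> ^ (2 * k) * ((2 powr (- \<alpha>)) ^ n) ^ (2 * k)"
      proof (intro mult_right_mono mult_mono)
        have "L ^ 1 \<le> L ^ (2 * k)" using k1 by (intro power_increasing) (auto simp: L_def)
        then show "K \<le> L ^ (2 * k)" by (simp add: L_def)
        show "exp \<tau> ^ 2 \<le> exp \<tau> ^ (2 * k)" using \<tau> k1 by (intro power_increasing) auto
      qed (use K in \<open>auto simp: L_def\<close>)
      also have "\<dots> = (L * exp \<tau> * (2 powr (- \<alpha>)) ^ n) ^ (2 * k)"
        by (simp add: power_mult_distrib)
      finally have "\<bar>\<Delta> n j \<omega>\<bar> ^ (2 * k) \<le> (L * exp \<tau> * (2 powr (- \<alpha>)) ^ n) ^ (2 * k)"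
        using K by (simp add: mult_left_mono)
      then show ?thesis unfolding \<tau>_def[symmetric]
        using k1 by (subst (asm) power_mono_iff) (auto simp: L_def)
    qed
    then show ?case unfolding \<Delta>_def by (intro exI[of _ L]) (auto simp: L_def)
  qed
qed

lemma bm_paths_hoelder:
  assumes "0 < \<alpha>" "\<alpha> < 1/2"
  shows "AE \<omega> in M. hoelder_path \<alpha> (\<lambda>t. if t \<le> 0 then 0 else w t \<omega>)"
proof -
  have "AE \<omega> in M. w 0 \<omega> = 0" "AE \<omega> in M. continuous_on {0..} (\<lambda>t. w t \<omega>)"
    using bm by (auto simp: standard_brownian_motion_def)
  with bm_dyadic_bound[OF assms(2)] show ?thesis
  proof eventually_elim
    case (elim \<omega>)
    then obtain L where L: "L \<ge> 0"
      "\<And>n j. \<bar>w (real (Suc j) / 2 ^ n) \<omega> - w (real j / 2 ^ n) \<omega>\<bar> \<le>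
        L * exp (real j / 2 ^ n) * (2 powr (- \<alpha>)) ^ n" by blast
    obtain K where K: "K \<ge> 0"
      "\<And>s t. 0 \<le> s \<Longrightarrow> s \<le> t \<Longrightarrow> \<bar>w t \<omega> - w s \<omega>\<bar> \<le> K * exp (2 * t) * (t - s) powr \<alpha>"
      using hoelder_of_dyadic[OF elim(3) assms(1) L] by blast
    have H: "\<bar>(if t \<le> 0 then 0 else w t \<omega>) - (if s \<le> 0 then 0 else w s \<omega>)\<bar> \<le> K * exp (2 * t) * (t - s) powr \<alpha>"
      if st: "s \<le> t" for s t
    proof (cases "s \<le> 0")
      case True
      show ?thesis
      proof (cases "t \<le> 0")
        case False
        have "\<bar>w t \<omega> - w 0 \<omega>\<bar> \<le> K * exp (2 * t) * (t - 0) powr \<alpha>" using False by (intro K) auto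
        also have "\<dots> \<le> K * exp (2 * t) * (t - s) powr \<alpha>"
          using True False K(1) assms by (intro mult_left_mono powr_mono2) auto
        finally show ?thesis using True False elim(2) by simp
      qed (use True K(1) in auto)
    qed (use st K(2)[of s t] in auto)
    then show ?case unfolding hoelder_path_def
      by (intro conjI exI[of _ K] allI impI H K(1)) auto
  qed
qed

section \<open>Wiener integrals as limits of step integrals\<close>

lemma bm_square_increment:
  assumes "0 \<le> s" "0 \<le> t"
  shows "has_bochner_integral M (\<lambda>\<omega>. (w t \<omega> - w s \<omega>)\<^sup>2) \<bar>t - s\<bar>"
proof -
  have *: "has_bochner_integral M (\<lambda>\<omega>. (w t \<omega> - w s \<omega>)\<^sup>2) (t - s)" if "0 \<le> s" "s \<le> t" for s t
  proof (cases "s = t")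
    case False
    then show ?thesis
      using bm_increment_moment[of s t 1] that
      by (intro has_bochner_integral_nn_integral borel_measurable_power borel_measurable_diff bm_measurable)
        (auto simp: numeral_2_eq_2)
  qed (simp add: has_bochner_integral_zero)
  show ?thesis
    using *[of s t] *[of t s] assms
    by (cases "s \<le> t") (simp_all add: power2_commute[of "w t _" "w s _"] abs_if)
qed

text \<open>
  Polarization: as \<open>w\<close> starts at zero, \<open>w s\<close>, \<open>w t\<close> and \<open>w t - w s\<close> are all increments, with
  variances \<open>s\<close>, \<open>t\<close> and \<open>\<bar>t - s\<bar>\<close>.
\<close>

lemma bm_covariance:
  assumes "0 \<le> s" "0 \<le> t"
  shows "has_bochner_integral M (\<lambda>\<omega>. w s \<omega> * w t \<omega>) (min s t)"
proof -
  have w0: "AE \<omega> in M. w 0 \<omega> = 0" using bm by (simp add: standard_brownian_motion_def)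
  have sq: "has_bochner_integral M (\<lambda>\<omega>. (w r \<omega>)\<^sup>2) r" if r: "r \<ge> 0" for r
  proof -
    have "AE \<omega> in M. (w r \<omega> - w 0 \<omega>)\<^sup>2 = (w r \<omega>)\<^sup>2" using w0 by eventually_elim simp
    moreover have "(\<lambda>\<omega>. (w r \<omega> - w 0 \<omega>)\<^sup>2) \<in> borel_measurable M" "(\<lambda>\<omega>. (w r \<omega>)\<^sup>2) \<in> borel_measurable M"
      using r by (intro borel_measurable_power borel_measurable_diff bm_measurable; simp)+
    moreover have "has_bochner_integral M (\<lambda>\<omega>. (w r \<omega> - w 0 \<omega>)\<^sup>2) r"
      using bm_square_increment[of 0 r] r by simp
    ultimately show ?thesis by (subst (asm) has_bochner_integral_cong_AE) assumption+
  qed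
  have "has_bochner_integral M (\<lambda>\<omega>. ((w s \<omega>)\<^sup>2 + (w t \<omega>)\<^sup>2 - (w t \<omega> - w s \<omega>)\<^sup>2) * (1/2)) ((s + t - \<bar>t - s\<bar>) * (1/2))"
    using assms by (intro has_bochner_integral_mult_left has_bochner_integral_diff has_bochner_integral_add sq
        bm_square_increment)
  moreover have "((w s \<omega>)\<^sup>2 + (w t \<omega>)\<^sup>2 - (w t \<omega> - w s \<omega>)\<^sup>2) * (1/2) = w s \<omega> * w t \<omega>" for \<omega>
    by (simp add: power2_eq_square algebra_simps)
  moreover have "(s + t - \<bar>t - s\<bar>) * (1/2) = min s t" by (simp add: min_def)
  ultimately show ?thesis by simp
qed

lemma bm_increment_isometry:
  assumes "0 \<le> a" "a \<le> b" "0 \<le> c" "c \<le> d"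
  defines "I \<equiv> min b d - min b c - min a d + min a c"
  shows "has_bochner_integral M (\<lambda>\<omega>. (w b \<omega> - w a \<omega>) * (w d \<omega> - w c \<omega>)) I"
    and "has_bochner_integral lborel (\<lambda>x. indicator {a<..b} x * indicator {c<..d} x :: real) I"
proof -
  have "has_bochner_integral M (\<lambda>\<omega>. w b \<omega> * w d \<omega> - w b \<omega> * w c \<omega> - w a \<omega> * w d \<omega> + w a \<omega> * w c \<omega>) I"
    unfolding I_def using assms
    by (intro has_bochner_integral_add has_bochner_integral_diff bm_covariance) auto
  then show "has_bochner_integral M (\<lambda>\<omega>. (w b \<omega> - w a \<omega>) * (w d \<omega> - w c \<omega>)) I"
    by (simp add: algebra_simps)
  have ind: "has_bochner_integral lborel (\<lambda>x. indicator {0<..x1} x * indicator {0<..x2} x :: real) (min x1 x2)"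
    if "0 \<le> x1" "0 \<le> x2" for x1 x2
  proof -
    have "has_bochner_integral lborel (indicator {0<..min x1 x2} :: real \<Rightarrow> real) (measure lborel {0<..min x1 x2})"
      by (rule has_bochner_integral_real_indicator) (use that in auto)
    moreover have "(\<lambda>x. indicator {0<..x1} x * indicator {0<..x2} x :: real) = indicator {0<..min x1 x2}"
      by (auto simp: indicator_def fun_eq_iff)
    ultimately show ?thesis using that by simp
  qed
  define u where "u x y = (indicator {0<..x} y :: real)" for x y :: real
  have "has_bochner_integral lborel (\<lambda>x. u b x * u d x - u b x * u c x - u a x * u d x + u a x * u c x) I"
    unfolding I_def u_def using assms
    by (intro has_bochner_integral_add has_bochner_integral_diff ind) auto
  moreover have "indicator {x<..y} z = u y z - u x z" if "0 \<le> x" "x \<le> y" for x y z :: real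
    using that by (auto simp: u_def indicator_def)
  then have "(\<lambda>x. indicator {a<..b} x * indicator {c<..d} x :: real) =
      (\<lambda>x. u b x * u d x - u b x * u c x - u a x * u d x + u a x * u c x)"
    using assms(1-4) by (simp add: fun_eq_iff left_diff_distrib right_diff_distrib)
  ultimately show "has_bochner_integral lborel (\<lambda>x. indicator {a<..b} x * indicator {c<..d} x :: real) I"
    by simp
qed

text \<open>
  The covariance of two increments is the length of the overlap of their time intervals, so both sides are
  the same quadratic form in \<open>c\<close>. The intervals may overlap, so that step integrals over two different
  partitions can be subtracted from each other.
\<close>

lemma bm_isometry:
  fixes x y c :: "'i \<Rightarrow> real"
  assumes "finite I" "\<And>i. i \<in> I \<Longrightarrow> 0 \<le> x i \<and> x i \<le> y i"
  shows "(\<integral>\<^sup>+\<omega>. ennreal ((\<Sum>i\<in>I. c i * (w (y i) \<omega> - w (x i) \<omega>))\<^sup>2) \<partial>M) =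
    (\<integral>\<^sup>+s. ennreal ((\<Sum>i\<in>I. c i * indicator {x i<..y i} s)\<^sup>2) \<partial>lborel)"
proof -
  define J where "J i j = min (y i) (y j) - min (y i) (x j) - min (x i) (y j) + min (x i) (x j)" for i j
  have sq: "(\<Sum>i\<in>I. c i * z i)\<^sup>2 = (\<Sum>i\<in>I. \<Sum>j\<in>I. (c i * c j) * (z i * z j))" for z :: "'i \<Rightarrow> real"
    unfolding power2_eq_square sum_product by (intro sum.cong refl) (rule mult.assoc[THEN trans], simp)
  have "has_bochner_integral M (\<lambda>\<omega>. (\<Sum>i\<in>I. c i * (w (y i) \<omega> - w (x i) \<omega>))\<^sup>2)
      (\<Sum>i\<in>I. \<Sum>j\<in>I. (c i * c j) * J i j)"
    unfolding sq J_def using assms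
    by (intro has_bochner_integral_sum has_bochner_integral_mult_right bm_increment_isometry(1)) auto
  moreover have "has_bochner_integral lborel (\<lambda>s. (\<Sum>i\<in>I. c i * indicator {x i<..y i} s)\<^sup>2)
      (\<Sum>i\<in>I. \<Sum>j\<in>I. (c i * c j) * J i j)"
    unfolding sq J_def using assms
    by (intro has_bochner_integral_sum has_bochner_integral_mult_right bm_increment_isometry(2)) auto
  ultimately show ?thesis
    by (simp add: has_bochner_integral_iff nn_integral_eq_integral)
qed

text \<open>
  The difference of two step integrals is a single linear combination indexed by the disjoint sum of the
  two index sets.
\<close>

lemma step_isometry:
  assumes "u 0 = 0" "\<forall>i<n. u i < u (Suc i)" "u' 0 = 0" "\<forall>i<m. u' i < u' (Suc i)"
  shows "(\<integral>\<^sup>+\<omega>. ennreal ((step_integral w n u c \<omega> - step_integral w m u' c' \<omega>)\<^sup>2) \<partial>M) =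
    (\<integral>\<^sup>+s. ennreal ((step_fun n u c s - step_fun m u' c' s)\<^sup>2) \<partial>lborel)"
proof -
  have nonneg: "0 \<le> v i" if "v 0 = 0" "\<forall>i<n. v i < v (Suc i)" "i \<le> n" for v :: "nat \<Rightarrow> real" and i n
    using that(3)
  proof (induction i)
    case (Suc i)
    then show ?case using that(2)[rule_format, of i] by simp
  qed (simp add: that)
  let ?I = "{..<n} <+> {..<m}"
  let ?x = "case_sum u u'" and ?y = "case_sum (\<lambda>i. u (Suc i)) (\<lambda>i. u' (Suc i))"
    and ?c = "case_sum c (\<lambda>i. - c' i)"
  have "(\<integral>\<^sup>+\<omega>. ennreal ((\<Sum>i\<in>?I. ?c i * (w (?y i) \<omega> - w (?x i) \<omega>))\<^sup>2) \<partial>M) =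
    (\<integral>\<^sup>+s. ennreal ((\<Sum>i\<in>?I. ?c i * indicator {?x i<..?y i} s)\<^sup>2) \<partial>lborel)"
    using assms nonneg[of u n] nonneg[of u' m] by (intro bm_isometry) (auto simp: less_imp_le)
  moreover have "(\<Sum>i\<in>?I. ?c i * (w (?y i) \<omega> - w (?x i) \<omega>)) =
      step_integral w n u c \<omega> - step_integral w m u' c' \<omega>" for \<omega>
    unfolding sum.Plus[OF finite_lessThan finite_lessThan] step_integral_def comp_def sum.case
    by (simp only: mult_minus_left sum_negf add_uminus_conv_diff)
  moreover have "(\<Sum>i\<in>?I. ?c i * indicator {?x i<..?y i} s) = step_fun n u c s - step_fun m u' c' s" for s
    unfolding sum.Plus[OF finite_lessThan finite_lessThan] step_fun_def comp_def sum.case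
    by (simp only: mult_minus_left sum_negf add_uminus_conv_diff)
  ultimately show ?thesis by simp
qed

text \<open>
  By the isometry the step integrals form a Cauchy sequence in \<open>L\<^sup>2\<close>. Fatou's lemma turns their almost
  sure convergence to \<open>Y\<close> into convergence in \<open>L\<^sup>2\<close>: the distance of \<open>Y\<close> to a step integral is at most
  the lower limit of the distances between step integrals.
\<close>

lemma wiener_integral_limit:
  assumes t: "t > 0"
    and h_meas: "set_borel_measurable lborel {0..t} h"
    and h_int: "set_integrable lborel {0..t} (\<lambda>s. (h s)\<^sup>2)"
    and Y: "Y \<in> borel_measurable M"
    and u: "\<And>k. u k 0 = 0" "\<And>k. u k (n k) = t" "\<And>k. \<forall>i<n k. u k i < u k (Suc i)"
    and L2: "(\<lambda>k::nat. \<integral>\<^sup>+s\<in>{0..t}. ennreal ((h s - step_fun (n k) (u k) (c k) s)\<^sup>2) \<partial>lborel) \<longlonglongrightarrow> 0"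
    and lim: "AE \<omega> in M. (\<lambda>k. step_integral w (n k) (u k) (c k) \<omega>) \<longlonglongrightarrow> Y \<omega>"
  shows "has_wiener_integral M w h t Y"
proof -
  define e where "e k = (\<integral>\<^sup>+s\<in>{0..t}. ennreal ((h s - step_fun (n k) (u k) (c k) s)\<^sup>2) \<partial>lborel)" for k
  define S where "S k = step_integral w (n k) (u k) (c k)" for k
  have e: "e \<longlonglongrightarrow> 0" using L2 by (simp add: e_def[abs_def])
  have mono: "u k i \<le> u k j" if "i \<le> j" "j \<le> n k" for k i j
    using that(1,2)
  proof (induction j rule: dec_induct)
    case (step j)
    then show ?case using u(3)[rule_format, where k=k and i=j] by simp
  qed simp
  have nonneg: "0 \<le> u k i" if "i \<le> n k" for k i using mono[of 0 i k] u(1)[of k] that by simp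
  have [measurable]: "S k \<in> borel_measurable M" for k
    unfolding S_def step_integral_def
    by (intro borel_measurable_sum borel_measurable_times borel_measurable_const borel_measurable_diff bm_measurable)
      (auto intro!: nonneg)
  have supp: "step_fun (n k) (u k) (c k) s = 0" if "s \<notin> {0..t}" for k s
    unfolding step_fun_def
  proof (intro sum.neutral ballI)
    fix i assume "i \<in> {..<n k}"
    then have "0 \<le> u k i" "u k (Suc i) \<le> t" using nonneg[of i k] mono[of "Suc i" "n k" k] u(2)[of k] by auto
    then show "c k i * indicator {u k i<..u k (Suc i)} s = 0" using that by (auto simp: indicator_def)
  qed
  define h0 where "h0 s = indicator {0..t} s * h s" for s
  have [measurable]: "h0 \<in> borel_measurable borel"
    using h_meas by (simp add: set_borel_measurable_def h0_def[abs_def])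
  have e_eq: "e k = (\<integral>\<^sup>+s. ennreal ((h0 s - step_fun (n k) (u k) (c k) s)\<^sup>2) \<partial>lborel)" for k
    unfolding e_def by (intro nn_integral_cong) (auto simp: h0_def supp indicator_def)
  have diff: "(\<integral>\<^sup>+\<omega>. ennreal ((S m \<omega> - S k \<omega>)\<^sup>2) \<partial>M) \<le> 2 * e m + 2 * e k" for m k
  proof -
    let ?f = "\<lambda>k. step_fun (n k) (u k) (c k)"
    have "(\<integral>\<^sup>+\<omega>. ennreal ((S m \<omega> - S k \<omega>)\<^sup>2) \<partial>M) = (\<integral>\<^sup>+s. ennreal ((?f m s - ?f k s)\<^sup>2) \<partial>lborel)"
      unfolding S_def by (rule step_isometry) (use u in auto)
    also have "\<dots> \<le> (\<integral>\<^sup>+s. 2 * ennreal ((h0 s - ?f m s)\<^sup>2) + 2 * ennreal ((h0 s - ?f k s)\<^sup>2) \<partial>lborel)"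
    proof (rule nn_integral_mono)
      fix s
      have "(?f m s - ?f k s)\<^sup>2 = ((h0 s - ?f k s) - (h0 s - ?f m s))\<^sup>2" by simp
      also have "\<dots> \<le> 2 * (h0 s - ?f k s)\<^sup>2 + 2 * (h0 s - ?f m s)\<^sup>2" by (rule square_sum_bound)
      finally have "ennreal ((?f m s - ?f k s)\<^sup>2) \<le> ennreal (2 * (h0 s - ?f m s)\<^sup>2 + 2 * (h0 s - ?f k s)\<^sup>2)"
        by (intro ennreal_leI) simp
      then show "ennreal ((?f m s - ?f k s)\<^sup>2) \<le> 2 * ennreal ((h0 s - ?f m s)\<^sup>2) + 2 * ennreal ((h0 s - ?f k s)\<^sup>2)"
        by (simp add: ennreal_mult)
    qed
    also have "\<dots> = 2 * e m + 2 * e k"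
      by (simp add: nn_integral_add nn_integral_cmult e_eq)
    finally show ?thesis .
  qed
  have bound: "(\<integral>\<^sup>+\<omega>. ennreal ((Y \<omega> - S k \<omega>)\<^sup>2) \<partial>M) \<le> 2 * e k" for k
  proof -
    have "(\<integral>\<^sup>+\<omega>. ennreal ((Y \<omega> - S k \<omega>)\<^sup>2) \<partial>M) = (\<integral>\<^sup>+\<omega>. liminf (\<lambda>m. ennreal ((S m \<omega> - S k \<omega>)\<^sup>2)) \<partial>M)"
    proof (rule nn_integral_cong_AE)
      show "AE \<omega> in M. ennreal ((Y \<omega> - S k \<omega>)\<^sup>2) = liminf (\<lambda>m. ennreal ((S m \<omega> - S k \<omega>)\<^sup>2))"
        using lim
      proof eventually_elim
        case (elim \<omega>)
        then have "(\<lambda>m. ennreal ((S m \<omega> - S k \<omega>)\<^sup>2)) \<longlonglongrightarrow> ennreal ((Y \<omega> - S k \<omega>)\<^sup>2)"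
          unfolding S_def by (intro tendsto_ennrealI tendsto_power tendsto_diff tendsto_const)
        then show ?case by (intro lim_imp_Liminf[symmetric]) auto
      qed
    qed
    also have "\<dots> \<le> liminf (\<lambda>m. \<integral>\<^sup>+\<omega>. ennreal ((S m \<omega> - S k \<omega>)\<^sup>2) \<partial>M)"
      by (rule nn_integral_liminf) measurable
    also have "\<dots> \<le> liminf (\<lambda>m. 2 * e m + 2 * e k)"
      by (intro Liminf_mono always_eventually allI diff)
    also have "\<dots> = 2 * e k"
    proof (intro lim_imp_Liminf)
      have "(\<lambda>m. 2 * e m + 2 * e k) \<longlonglongrightarrow> 2 * 0 + 2 * e k"
        by (intro tendsto_add tendsto_const ennreal_tendsto_cmult e) auto
      then show "(\<lambda>m. 2 * e m + 2 * e k) \<longlonglongrightarrow> 2 * e k" by simp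
    qed auto
    finally show ?thesis .
  qed
  have "(\<lambda>k. \<integral>\<^sup>+\<omega>. ennreal ((Y \<omega> - S k \<omega>)\<^sup>2) \<partial>M) \<longlonglongrightarrow> 0"
  proof (rule tendsto_sandwich[OF _ _ tendsto_const])
    show "\<forall>\<^sub>F k in sequentially. 0 \<le> (\<integral>\<^sup>+\<omega>. ennreal ((Y \<omega> - S k \<omega>)\<^sup>2) \<partial>M)" by simp
    show "\<forall>\<^sub>F k in sequentially. (\<integral>\<^sup>+\<omega>. ennreal ((Y \<omega> - S k \<omega>)\<^sup>2) \<partial>M) \<le> 2 * e k"
      by (intro always_eventually allI bound)
    have "(\<lambda>k. 2 * e k) \<longlonglongrightarrow> 2 * 0" by (intro ennreal_tendsto_cmult e) auto
    then show "(\<lambda>k. 2 * e k) \<longlonglongrightarrow> 0" by simp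
  qed
  then show ?thesis
    unfolding has_wiener_integral_def using h_meas h_int Y u L2
    by (intro conjI exI[of _ n] exI[of _ u] exI[of _ c] allI) (auto simp: S_def)
qed

end

section \<open>The stochastic fractional equation\<close>

lemma has_wiener_integral_cong:
  assumes "\<And>s. s \<in> {0..t} \<Longrightarrow> h s = g s" "has_wiener_integral M w g t Y"
  shows "has_wiener_integral M w h t Y"
proof -
  have 1: "(\<lambda>s. indicator {0..t} s *\<^sub>R h s) = (\<lambda>s. indicator {0..t} s *\<^sub>R g s)"
    "(\<lambda>s. indicator {0..t} s *\<^sub>R (h s)\<^sup>2) = (\<lambda>s. indicator {0..t} s *\<^sub>R (g s)\<^sup>2)"
    using assms(1) by (auto simp: fun_eq_iff indicator_def)
  have 2: "(\<integral>\<^sup>+s\<in>{0..t}. ennreal ((h s - \<phi> s)\<^sup>2) \<partial>lborel) = (\<integral>\<^sup>+s\<in>{0..t}. ennreal ((g s - \<phi> s)\<^sup>2) \<partial>lborel)" for \<phi>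
    by (intro nn_integral_cong) (auto simp: assms(1) indicator_def)
  show ?thesis
    using assms(2) unfolding has_wiener_integral_def set_borel_measurable_def set_integrable_def 1 2 .
qed

lemma has_wiener_integral_0: "has_wiener_integral M w h 0 (\<lambda>_. 0)"
proof -
  have *: "(\<integral>\<^sup>+s\<in>{0..0}. f s \<partial>lborel) = 0" for f :: "real \<Rightarrow> ennreal"
  proof -
    have "(\<integral>\<^sup>+s\<in>{0..0}. f s \<partial>lborel) = (\<integral>\<^sup>+s. 0 \<partial>(lborel::real measure))"
      by (intro nn_integral_cong_AE eventually_mono[OF AE_lborel_singleton[of 0]]) auto
    then show ?thesis by simp
  qed
  have m: "(\<lambda>s. indicator {0..0} s *\<^sub>R k s) \<in> borel_measurable lborel" for k :: "real \<Rightarrow> real"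
  proof -
    have "(\<lambda>s. indicator {0..0} s *\<^sub>R k s) = (\<lambda>s. k 0 * indicator {0..0} s)"
      by (auto simp: indicator_def fun_eq_iff)
    then show ?thesis by simp
  qed
  have "integrable lborel (\<lambda>s. indicator {0..0} s *\<^sub>R (h s)\<^sup>2)"
    by (rule integrable_cong_AE_imp[OF integrable_zero m])
      (intro eventually_mono[OF AE_lborel_singleton[of 0]], auto)
  then show ?thesis
    unfolding has_wiener_integral_def set_borel_measurable_def set_integrable_def
    by (intro conjI m exI[of _ "\<lambda>_. 0"] exI[of _ "\<lambda>_ _. 0"])
      (simp_all add: * step_integral_def del: atLeastAtMost_singleton)
qed

lemma hoelder_path_zero: "hoelder_path \<alpha> (\<lambda>_. 0)"
  by (auto simp: hoelder_path_def intro!: exI[of _ 0])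

theorem theorem4p1:
  fixes M :: "'a measure"
    and w :: "real \<Rightarrow> 'a \<Rightarrow> real"
    and \<beta> \<gamma> a X0 :: real
  assumes "prob_space M"
    and "standard_brownian_motion M w"
    and "0 < \<beta>" "\<beta> < 1"
    and "0 < \<gamma>" "\<gamma> < 1"
    and "\<beta> - \<gamma> > - 1 / 2"
  shows "\<exists>X. process_in_E M X \<and>
           (\<forall>T>0. classical_solution M w \<beta> \<gamma> a X0 T X) \<and>
           (\<forall>T>0. \<forall>Y. process_in_E M Y \<and> classical_solution M w \<beta> \<gamma> a X0 T Y \<longrightarrow>
              (AE \<omega> in M. \<forall>t\<in>{0..T}. Y t \<omega> = X t \<omega>)) \<and>
           (\<forall>t\<ge>0. \<exists>I.
              has_wiener_integral M w
                (\<lambda>s. (t - s) powr (\<beta> - \<gamma>) *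
                     mittag_leffler \<beta> (\<beta> - \<gamma> + 1) (- a * (t - s) powr \<beta>)) t I \<and>
              (AE \<omega> in M. X t \<omega> = X0 * mittag_leffler1 \<beta> (- a * t powr \<beta>) + I \<omega>))"
proof -
  note \<beta> = assms(3,4) and \<gamma> = assms(5,6)
  define q where "q = 1 + \<beta> - \<gamma>"
  have q: "q > 1/2" "q > 0" using assms by (auto simp: q_def)
  \<comment> \<open>The midpoint between \<open>max 0 (\<gamma> - \<beta>)\<close>, which is less than \<open>1/2\<close>, and \<open>1/2\<close>.\<close>
  define \<alpha> where "\<alpha> = (1/2 + max 0 (\<gamma> - \<beta>)) / 2"
  have \<alpha>: "\<alpha> > 0" "\<alpha> < 1/2" "\<alpha> + q > 1"
    using assms(7) by (auto simp: \<alpha>_def q_def max_def field_simps)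
  let ?h = "ml_kernel \<beta> (- a) q" and ?h' = "ml_kernel \<beta> (- a) (q - 1)"
  obtain C c where sk: "singular_kernel ?h ?h' q C c"
    by (rule ml_kernel_singular[OF \<beta>(1) q(2)])
  interpret singular_kernel ?h ?h' q C c by (rule sk)
  have "AE \<omega> in M. w 0 \<omega> = 0" using assms(2) by (simp add: standard_brownian_motion_def)
  then have "AE \<omega> in M. w 0 \<omega> = 0 \<and> hoelder_path \<alpha> (\<lambda>t. if t \<le> 0 then 0 else w t \<omega>)"
    using bm_paths_hoelder[OF assms(2) \<alpha>(1,2)] by eventually_elim simp
  then obtain N where N: "{\<omega> \<in> space M. \<not> (w 0 \<omega> = 0 \<and> hoelder_path \<alpha> (\<lambda>t. if t \<le> 0 then 0 else w t \<omega>))} \<subseteq> N"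
    "emeasure M N = 0" "N \<in> sets M"
    by (rule AE_E)
  define G where "G = space M - N"
  have G: "G \<in> sets M" using N(3) by (auto simp: G_def)
  have AE_G: "AE \<omega> in M. \<omega> \<in> G"
    by (rule AE_I'[of N]) (use N in \<open>auto simp: G_def null_sets_def\<close>)
  \<comment> \<open>On the exceptional null set the path is replaced by zero. The solution is then defined on every path, and
    its measurability can be read off from everywhere convergent Riemann sums.\<close>
  define v where "v \<omega> t = (if \<omega> \<in> G \<and> t > 0 then w t \<omega> else 0)" for \<omega> t
  have v_path: "hoelder_path \<alpha> (v \<omega>)" for \<omega>
  proof (cases "\<omega> \<in> G")
    case True
    then have "hoelder_path \<alpha> (\<lambda>t. if t \<le> 0 then 0 else w t \<omega>)" using N(1) by (auto simp: G_def)
    moreover have "v \<omega> = (\<lambda>t. if t \<le> 0 then 0 else w t \<omega>)" using True by (auto simp: v_def fun_eq_iff)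
    ultimately show ?thesis by simp
  next
    case False
    then have "v \<omega> = (\<lambda>_. 0)" by (simp add: v_def fun_eq_iff)
    then show ?thesis by (simp add: hoelder_path_zero)
  qed
  have v_eq: "v \<omega> t = w t \<omega>" if "\<omega> \<in> G" "t \<ge> 0" for \<omega> t
  proof (cases "t = 0")
    case True
    have "w 0 \<omega> = 0" using N(1) that by (auto simp: G_def)
    then show ?thesis using True by (simp add: v_def)
  qed (use that in \<open>simp add: v_def\<close>)
  have v_meas: "(\<lambda>\<omega>. v \<omega> t) \<in> borel_measurable M" for t
  proof (cases "t > 0")
    case True
    have [measurable]: "w t \<in> borel_measurable M" "G \<in> sets M"
      using bm_measurable[OF assms(2), of t] True G by auto
    have "(\<lambda>\<omega>. if \<omega> \<in> G then w t \<omega> else 0) \<in> borel_measurable M" by measurable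
    then show ?thesis using True by (simp add: v_def)
  qed (simp add: v_def)
  note path = \<beta> \<gamma> q_def \<alpha>(1,3) v_path
  define V where "V t \<omega> = wint (v \<omega>) t" for t \<omega>
  define X where "X t \<omega> = frac_solution \<beta> q a X0 (v \<omega>) t" for t \<omega>
  have X_V: "X t \<omega> = X0 * mittag_leffler1 \<beta> (- a * t powr \<beta>) + V t \<omega>" for t \<omega>
    by (simp add: X_def frac_solution_def V_def)
  have riemann: "(\<lambda>n. \<Sum>i<Suc n. ?h (t - grid t n i) * (v \<omega> (grid t n (Suc i)) - v \<omega> (grid t n i))) \<longlonglongrightarrow> V t \<omega>"
    if t: "t > 0" for t \<omega>
  proof -
    obtain C c K where "kernel_path ?h ?h' q C c (v \<omega>) \<alpha> K"
      by (rule ml_kernel_kernel_path[OF path])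
    then show ?thesis unfolding V_def by (rule kernel_path.riemann_sum_tendsto_wint[OF _ t])
  qed
  have V_meas: "V t \<in> borel_measurable M" if "t > 0" for t
    by (rule borel_measurable_LIMSEQ_real[OF riemann[OF that]])
      (intro borel_measurable_sum borel_measurable_times borel_measurable_const borel_measurable_diff v_meas)
  have X_0: "X 0 \<omega> = X0" for \<omega>
    unfolding X_def by (rule frac_solution_0[OF path])
  have X_cont: "continuous_on {0..T} (\<lambda>t. X t \<omega>)" for T \<omega>
    unfolding X_def by (rule continuous_on_subset[OF frac_solution_continuous[OF path]]) auto
  have X_eq: "frac_int (1 - \<beta>) (\<lambda>s. X s \<omega>) t =
      - a * (LINT s:{0..t}|lebesgue. X s \<omega>) + frac_int (1 - \<gamma>) (\<lambda>s. w s \<omega>) t"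
    if "\<omega> \<in> G" "t \<ge> 0" for \<omega> t
    unfolding X_def by (rule frac_solution_equation[OF path that(2)]) (simp add: v_eq[OF that(1)])
  have X_sol: "classical_solution M w \<beta> \<gamma> a X0 T X" for T
    unfolding classical_solution_def
  proof (intro conjI ballI)
    fix t assume "t \<in> {0..T}"
    then consider "t = 0" | "t > 0" by fastforce
    then show "X t \<in> borel_measurable M"
    proof cases
      case 1
      then have "X t = (\<lambda>_. X0)" by (simp add: X_0 fun_eq_iff)
      then show ?thesis by simp
    next
      case 2
      then show ?thesis unfolding X_V[abs_def] using V_meas by simp
    qed
  next
    show "AE \<omega> in M. \<forall>t\<in>{0..T}. frac_int (1 - \<beta>) (\<lambda>s. X s \<omega>) t =
        - a * (LINT s:{0..t}|lebesgue. X s \<omega>) + frac_int (1 - \<gamma>) (\<lambda>s. w s \<omega>) t"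
      using AE_G by eventually_elim (use X_eq in auto)
  qed (use X_cont X_0 in auto)
  have X_E: "process_in_E M X"
    unfolding process_in_E_def X_def using frac_solution_class_E[OF path] by simp
  have X_unique: "AE \<omega> in M. \<forall>t\<in>{0..T}. Y t \<omega> = X t \<omega>"
    if T: "T > 0" and Y: "classical_solution M w \<beta> \<gamma> a X0 T Y" for T Y
  proof -
    have "AE \<omega> in M. continuous_on {0..T} (\<lambda>t. Y t \<omega>)" "AE \<omega> in M. Y 0 \<omega> = X0"
      "AE \<omega> in M. \<forall>t\<in>{0..T}. frac_int (1 - \<beta>) (\<lambda>s. Y s \<omega>) t =
        - a * (LINT s:{0..t}|lebesgue. Y s \<omega>) + frac_int (1 - \<gamma>) (\<lambda>s. w s \<omega>) t"
      using Y by (auto simp: classical_solution_def)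
    with AE_G show ?thesis
    proof eventually_elim
      case (elim \<omega>)
      show ?case
      proof
        fix t assume t: "t \<in> {0..T}"
        show "Y t \<omega> = X t \<omega>"
          by (rule fractional_equation_unique[OF \<beta> T X_cont elim(2),
                where R="\<lambda>t. frac_int (1 - \<gamma>) (\<lambda>s. w s \<omega>) t" and a=a])
            (use elim t X_0 X_eq in auto)
      qed
    qed
  qed
  have X_wiener: "\<exists>I. has_wiener_integral M w
        (\<lambda>s. (t - s) powr (\<beta> - \<gamma>) * mittag_leffler \<beta> (\<beta> - \<gamma> + 1) (- a * (t - s) powr \<beta>)) t I \<and>
      (AE \<omega> in M. X t \<omega> = X0 * mittag_leffler1 \<beta> (- a * t powr \<beta>) + I \<omega>)" if "t \<ge> 0" for t
  proof (cases "t = 0")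
    case True
    have "mittag_leffler1 \<beta> 0 = 1"
      using mittag_leffler_rec[of \<beta> 1 0] \<beta> by (simp add: rGamma_inverse_Gamma)
    with True show ?thesis
      using X_0 \<beta> by (intro exI[of _ "\<lambda>_. 0"] conjI) (auto simp: has_wiener_integral_0)
  next
    case False
    then have t: "t > 0" using that by simp
    have "has_wiener_integral M w (\<lambda>s. ?h (t - s)) t (V t)"
    proof (rule wiener_integral_limit[OF assms(2) t _ kernel_square_integrable[OF q(1) t] V_meas[OF t]
          _ _ _ step_approx_L2[OF q(1) t]])
      show "set_borel_measurable lborel {0..t} (\<lambda>s. ?h (t - s))"
        unfolding set_borel_measurable_def by measurable
      show "\<forall>i<Suc k. grid t k i < grid t k (Suc i)" for k
        using grid_less[OF t] by simp
      show "AE \<omega> in M. (\<lambda>k. step_integral w (Suc k) (grid t k) (\<lambda>i. ?h (t - grid t k i)) \<omega>) \<longlonglongrightarrow> V t \<omega>"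
        using AE_G
      proof eventually_elim
        case (elim \<omega>)
        have "0 \<le> grid t k i" for k i using grid_mono[OF t, of 0 i k] by simp
        then have "v \<omega> (grid t k i) = w (grid t k i) \<omega>" for k i using elim by (simp add: v_eq)
        with riemann[OF t, of \<omega>] show ?case by (simp only: step_integral_def)
      qed
    qed auto
    then have "has_wiener_integral M w
        (\<lambda>s. (t - s) powr (\<beta> - \<gamma>) * mittag_leffler \<beta> (\<beta> - \<gamma> + 1) (- a * (t - s) powr \<beta>)) t (V t)"
    proof (rule has_wiener_integral_cong[rotated])
      show "(t - s) powr (\<beta> - \<gamma>) * mittag_leffler \<beta> (\<beta> - \<gamma> + 1) (- a * (t - s) powr \<beta>) = ?h (t - s)"
        if "s \<in> {0..t}" for s
      proof -
        have "q - 1 = \<beta> - \<gamma>" "q = \<beta> - \<gamma> + 1" by (auto simp: q_def)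
        then show ?thesis using that by (cases "s = t") (auto simp: ml_kernel_def)
      qed
    qed
    then show ?thesis by (intro exI[of _ "V t"] conjI) (simp_all add: X_V)
  qed
  show ?thesis
    using X_E X_sol X_unique X_wiener by blast
qed

end
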